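(* There exist a constant $C_2>0$ and a bounded open set $\Omega_0\subset S_+$ with smooth, connected boundary $\partial\Omega_0\subset\overline{S_+}:=\{x_1\ge 0\}$ satisfying $$\operatorname{length}(\partial\Omega_0)\le 20,\qquad \partial\Omega_0\cap\partial S_+\ne\emptyset,$$ such that the solution $1_{\Omega_t}$ of the incompressible Euler equations in vorticity form on $S_+$ with initial data $1_{\Omega_0}$ satisfies $$\operatorname{length}(\partial\Omega_t)\ge C_2\,t\qquad\text{for all } t\ge 0 .$$
   Context: Domain: $S_+=\mathbb{R}_{>0}\times\mathbb{T}$ is the half cylinder with points $x=(x_1,x_2)$, where $\mathbb{T}=[-\pi,\pi)$ is the torus ($2\pi$-periodic in $x_2$). $\partial S_+=\{0\}\times\mathbb{T}$ is a circle. Boundaries of subsets of $S_+$ are taken in $\mathbb{R}\times\mathbb{T}$ (so they may contain points of $\partial S_+$). Euler equations in vorticity form: $\partial_t\omega+u\cdot\nabla\omega=0$ on $(0,\infty)\times S_+$, $\omega|_{t=0}=\omega_0$, where $u$ is given by the cylindrical Biot–Savart law $$u(t,x)=\int_{S_+}K(x,y)\,\omega(t,y)\,dy,\qquad K(x,y)=K_S(x-y)-K_S(x+\bar y),\quad \bar y=(y_1,-y_2),$$ $$K_S(x)=\frac{(\sin x_2,\,-\sinh x_1)}{4\pi(\cosh x_1-\cos x_2)}$$ (so that $u_1=0$ on $\{x_1=0\}$ and $u\to0$ as $x_1\to\infty$). Solution: for $\omega_0\in L^\infty(S_+)$ with bounded support there is a unique global-in-time (Yudovich) weak solution $\omega\in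 L^\infty(0,\infty;(L^1\cap L^\infty)(S_+))$; it is the transport of $\omega_0$ by the measure-preserving flow map of $u$. If $\omega_0=1_{\Omega_0}$ with $\Omega_0\subset S_+$ bounded and open, then $\omega(t)=1_{\Omega_t}$, where $\Omega_t$ is the image of $\Omega_0$ under the time-$t$ flow map on the cylinder generated by $u$ (i.e. $\frac{d}{dt}\Phi(t,x)=u(t,\Phi(t,x))$, $\Phi(0,x)=x$). If $\partial\Omega_0$ is smooth ($C^\infty$) and connected, so is $\partial\Omega_t$ for all $t\ge 0$. *)

theory Defs
  imports "HOL-Analysis.Analysis"
begin

text \<open>
  The cylinder \<open>\<real> \<times> \<T>\<close> is handled through its universal cover \<open>\<real>\<^sup>2\<close>: a subset of the
  cylinder is a subset of \<open>\<real>\<^sup>2\<close> invariant under the deck transformation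
  \<open>(x\<^sub>1, x\<^sub>2) \<mapsto> (x\<^sub>1, x\<^sub>2 + 2\<pi>)\<close>, and a map of the cylinder (isotopic to the identity) is a map
  commuting with it. The covering is a local isometry, so openness, boundaries, smoothness and
  derivatives may be taken in \<open>\<real>\<^sup>2\<close>. Global notions have to be taken downstairs: boundedness
  concerns the first coordinate only, connectedness is tested after projecting, and lengths and
  integrals are taken over one period \<open>-\<pi> \<le> x\<^sub>2 < \<pi>\<close>.
\<close>

definition deck :: "real \<times> real \<Rightarrow> real \<times> real" where
  "deck x = (fst x, snd x + 2 * pi)"

definition periodic_set :: "(real \<times> real) set \<Rightarrow> bool" where
  "periodic_set A \<longleftrightarrow> (\<forall>x. deck x \<in> A \<longleftrightarrow> x \<in> A)"

definition cyl_proj :: "real \<times> real \<Rightarrow> real \<times> complex" where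
  "cyl_proj x = (fst x, cis (snd x))"

definition S_plus :: "(real \<times> real) set" where
  "S_plus = {x. 0 < fst x}"

definition S_plus_boundary :: "(real \<times> real) set" where
  "S_plus_boundary = {x. fst x = 0}"

definition S_plus_closed :: "(real \<times> real) set" where
  "S_plus_closed = {x. 0 \<le> fst x}"

definition one_period :: "(real \<times> real) set" where
  "one_period = {x. - pi \<le> snd x \<and> snd x < pi}"

abbreviation S_plus_period :: "(real \<times> real) set" where
  "S_plus_period \<equiv> S_plus \<inter> one_period"

definition cyl_bounded :: "(real \<times> real) set \<Rightarrow> bool" where
  "cyl_bounded A \<longleftrightarrow> bounded (fst ` A)"

definition cyl_connected :: "(real \<times> real) set \<Rightarrow> bool" where
  "cyl_connected A \<longleftrightarrow> connected (cyl_proj ` A)"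


text \<open>
  The length of a curve, regarded as a point set, is its one-dimensional Hausdorff measure
  (with the normalisation giving a segment its usual length).
\<close>

definition hausdorff1 :: "'a::metric_space set \<Rightarrow> ennreal" where
  "hausdorff1 A =
     (SUP \<delta>\<in>{0::real<..}.
        INF U\<in>{U :: nat \<Rightarrow> 'a set.
                 A \<subseteq> (\<Union>i. U i) \<and> (\<forall>i. bounded (U i) \<and> diameter (U i) \<le> \<delta>)}.
          (\<Sum>i. ennreal (diameter (U i))))"

definition cyl_length :: "(real \<times> real) set \<Rightarrow> ennreal" where
  "cyl_length A = hausdorff1 (A \<inter> one_period)"


text \<open>\<open>C\<^sup>k\<close> and \<open>C\<^sup>\<infinity>\<close> functions; only used on open sets.\<close>

primrec Ck_on :: "nat \<Rightarrow> 'a::real_normed_vector set \<Rightarrow> ('a \<Rightarrow> real) \<Rightarrow> bool" where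
  "Ck_on 0 U f \<longleftrightarrow> continuous_on U f"
| "Ck_on (Suc k) U f \<longleftrightarrow>
     f differentiable_on U \<and> (\<forall>v. Ck_on k U (\<lambda>x. frechet_derivative f (at x) v))"

definition smooth_on :: "'a::real_normed_vector set \<Rightarrow> ('a \<Rightarrow> real) \<Rightarrow> bool" where
  "smooth_on U f \<longleftrightarrow> (\<forall>k. Ck_on k U f)"

text \<open>
  Near each of its boundary points, \<open>\<Omega>\<close> is a strict sublevel set \<open>{f < 0}\<close> of a \<open>C\<^sup>\<infinity>\<close> function
  without critical points; the boundary is then locally the curve \<open>{f = 0}\<close>.
\<close>

definition smooth_boundary :: "(real \<times> real) set \<Rightarrow> bool" where
  "smooth_boundary \<Omega> \<longleftrightarrow>
     (\<forall>p \<in> frontier \<Omega>. \<exists>U f.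
        open U \<and> p \<in> U \<and> smooth_on U f \<and>
        (\<forall>x\<in>U. \<exists>v. frechet_derivative f (at x) v \<noteq> 0) \<and>
        \<Omega> \<inter> U = {x \<in> U. f x < 0})"


definition K_S :: "real \<times> real \<Rightarrow> real \<times> real" where
  "K_S x =
     (sin (snd x) / (4 * pi * (cosh (fst x) - cos (snd x))),
      - sinh (fst x) / (4 * pi * (cosh (fst x) - cos (snd x))))"

definition K :: "real \<times> real \<Rightarrow> real \<times> real \<Rightarrow> real \<times> real" where
  "K x y = K_S (x - y) - K_S (x + (fst y, - snd y))"

definition biot_savart :: "(real \<times> real \<Rightarrow> real) \<Rightarrow> real \<times> real \<Rightarrow> real \<times> real" where
  "biot_savart w x = (LINT y:S_plus_period|lborel. w y *\<^sub>R K x y)"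


text \<open>
  Test functions are defined on all of \<open>\<real> \<times> \<real>\<^sup>2\<close>; their restrictions to \<open>t \<ge> 0\<close>, \<open>x\<^sub>1 \<ge> 0\<close> are
  the \<open>C\<^sup>\<infinity>\<close> functions with compact support in \<open>[0, \<infinity>) \<times> \<close>(closed half cylinder). They need not
  vanish for \<open>x\<^sub>1 = 0\<close>, in accordance with the slip condition \<open>u\<^sub>1 = 0\<close> there.
\<close>

definition test_function :: "(real \<times> real \<times> real \<Rightarrow> real) \<Rightarrow> bool" where
  "test_function \<phi> \<longleftrightarrow>
     smooth_on UNIV \<phi> \<and>
     (\<forall>t x. \<phi> (t, deck x) = \<phi> (t, x)) \<and>
     (\<exists>R. \<forall>t x. \<bar>t\<bar> > R \<or> \<bar>fst x\<bar> > R \<longrightarrow> \<phi> (t, x) = 0)"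

text \<open>
  Yudovich weak solutions in \<open>L\<^sup>\<infinity>(0,\<infinity>; L\<^sup>1 \<inter> L\<^sup>\<infinity>)\<close>. The derivative of \<open>\<phi>\<close> at \<open>(t, x)\<close> in
  direction \<open>(1, u(t, x))\<close> is \<open>\<partial>\<^sub>t\<phi> + u \<cdot> \<nabla>\<phi>\<close>.
\<close>

definition euler_weak_solution ::
  "(real \<times> real \<Rightarrow> real) \<Rightarrow> (real \<Rightarrow> real \<times> real \<Rightarrow> real) \<Rightarrow> bool" where
  "euler_weak_solution w0 w \<longleftrightarrow>
     (\<forall>t\<ge>0. \<forall>x\<in>S_plus. w t (deck x) = w t x) \<and>
     set_borel_measurable lborel ({0..} \<times> S_plus_period) (\<lambda>p. w (fst p) (snd p)) \<and>
     (\<exists>M. AE t in lborel. 0 < t \<longrightarrow>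
        set_integrable lborel S_plus_period (w t) \<and>
        (LINT x:S_plus_period|lborel. \<bar>w t x\<bar>) \<le> M \<and>
        (AE x in lborel. x \<in> S_plus_period \<longrightarrow> \<bar>w t x\<bar> \<le> M)) \<and>
     (\<forall>\<phi>. test_function \<phi> \<longrightarrow>
        (LINT p:{0..} \<times> S_plus_period|lborel.
           w (fst p) (snd p) *
           frechet_derivative \<phi> (at p) (1, biot_savart (w (fst p)) (snd p))) +
        (LINT x:S_plus_period|lborel. w0 x * \<phi> (0, x)) = 0)"

definition flow_map ::
  "(real \<Rightarrow> real \<times> real \<Rightarrow> real \<times> real) \<Rightarrow> (real \<Rightarrow> real \<times> real \<Rightarrow> real \<times> real) \<Rightarrow> bool" where
  "flow_map u \<Phi> \<longleftrightarrow>
     (\<forall>x\<in>S_plus_closed. \<Phi> 0 x = x) \<and>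
     (\<forall>t\<ge>0. \<forall>x\<in>S_plus_closed.
        \<Phi> t x \<in> S_plus_closed \<and>
        \<Phi> t (deck x) = deck (\<Phi> t x) \<and>
        ((\<lambda>s. \<Phi> s x) has_vector_derivative u t (\<Phi> t x)) (at t within {0..}))"

text \<open>For maps commuting with \<^const>\<open>deck\<close>, preserving area upstairs and downstairs is the same.\<close>

definition area_preserving :: "(real \<times> real \<Rightarrow> real \<times> real) \<Rightarrow> bool" where
  "area_preserving g \<longleftrightarrow>
     (let H = restrict_space lborel S_plus_closed in g \<in> measurable H H \<and> distr H H g = H)"

text \<open>
  \<open>\<Phi>\<close> is the flow of the Euler solution with initial datum \<open>1\<^bsub>\<Omega>0\<^esub>\<close>: with \<open>\<Omega>\<^sub>t = \<Phi>\<^sub>t(\<Omega>0)\<close>, the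
  function \<open>1\<^bsub>\<Omega>t\<^esub>\<close> is a Yudovich weak solution and \<open>\<Phi>\<close> is the measure-preserving flow of its
  Biot--Savart velocity. By Yudovich's theorem such a flow exists and is unique on the closed half
  cylinder for \<open>t \<ge> 0\<close>.
\<close>

definition euler_patch_flow ::
  "(real \<times> real) set \<Rightarrow> (real \<Rightarrow> real \<times> real \<Rightarrow> real \<times> real) \<Rightarrow> bool" where
  "euler_patch_flow \<Omega>0 \<Phi> \<longleftrightarrow>
     (let w = (\<lambda>t. indicator (\<Phi> t ` \<Omega>0))
      in euler_weak_solution (indicator \<Omega>0) w \<and>
         flow_map (\<lambda>t. biot_savart (w t)) \<Phi> \<and>
         (\<forall>t\<ge>0. area_preserving (\<Phi> t)))"

end

theory Submission
  imports Defs
begin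

text \<open>
  The patch is a disc touching the wall, of radius slightly below \<open>\<pi>\<close>. On the wall the velocity is
  tangential, and whatever the shape of a patch of area \<open>a\<close>, it is at least \<open>a / (2 \<pi>) - 2 ln 2\<close>. The
  mean velocity over the patch along the cylinder is at most about half of \<open>a / (2 \<pi>)\<close>: the free-space
  part of the kernel is antisymmetric and cancels, and only the interaction with the image remains.
  For our disc the first number exceeds the second. Hence the lifted boundary particle starting at the
  point of contact runs ahead linearly in time of the mean position of the patch, and so, at each time,
  of some particle of the patch. The image of the closed disc is connected, so the image of the circle
  has a projection to the second axis of linearly growing length. As the flow is injective and commutes
  with the deck transformation, the translates of the lifted circle are disjoint, and no length is lost
  on projecting to the cylinder.

  Only the conservation of area enters. Injectivity and continuity of the flow follow from the
  modulus of continuity \<open>C/e r\<^sup>1\<^sup>-\<^sup>e\<close> (for all \<open>0 < e \<le> 1\<close>) of the velocity by Yudovich's version of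
  Osgood's argument.
\<close>

section \<open>The kernel\<close>

text \<open>The shape of the patch at later times is out of control, so every velocity estimate may
  depend on the patch through its area alone. On the wall the kernel is
  \<open>sinh s / (cosh s - cos \<theta>) / (2 * pi)\<close>, which tends to
  \<open>1 / (2 * pi)\<close> far away: distant vorticity keeps pushing, and only vorticity near the
  wall can fall short. Charging the shortfall to the whole half cylinder costs a fixed amount; so
  does the excess of the image kernel over its own limit. A term linear in the area is thus compared
  with constants, and a large area decides it. The width of the cylinder and the bound 20 on the
  length leave little room for that.

  A second obstacle is circularity. A weak solution has its mass bounded for almost every time only,
  while the area at a given time is computed from the conservation law after the flow is known to be
  injective with open images. Hence Osgood's argument is run with almost-everywhere bounds;
  invariance of domain and conservation of area then give the exact area, and with it the velocity
  bounds, at every time.\<close>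

definition den :: "real \<times> real \<Rightarrow> real" where
  "den z = cosh (fst z) - cos (snd z)"

lemma cosh_gt_1: "cosh s > 1" if "s \<noteq> 0" for s :: real
  using cosh_real_strict_mono[of 0 "\<bar>s\<bar>"] that by (simp add: cosh_real_abs)

lemma den_pos: "fst z \<noteq> 0 \<Longrightarrow> den z > 0"
  unfolding den_def using cosh_gt_1[of "fst z"] cos_le_one[of "snd z"] by linarith

text \<open>
  With \<open>Z = x\<^sub>1 + \<i> x\<^sub>2\<close> the kernel is, up to a reflection, \<open>coth (Z/2) / (4 \<pi>)\<close>, and
  \<open>2 \<bar>sinh (Z/2)\<bar>\<^sup>2 = den\<close>; this is why differences of the kernel have a closed form.
\<close>

lemma norm_K_S_sq:
  assumes "den z > 0"
  shows "(norm (K_S z))\<^sup>2 = (1 + 2 * cos (snd z) / den z) / (4 * pi)\<^sup>2"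
proof -
  define s t where "s = fst z" and "t = snd z"
  have d: "cosh s - cos t > 0" using assms by (simp add: den_def s_def t_def)
  have "(norm (K_S z))\<^sup>2 = ((sin t)\<^sup>2 + (sinh s)\<^sup>2) / (4 * pi * (cosh s - cos t))\<^sup>2"
    by (simp add: K_S_def norm_prod_def s_def t_def power_divide add_divide_distrib)
  also have "(sin t)\<^sup>2 + (sinh s)\<^sup>2 = (cosh s - cos t) * (cosh s - cos t + 2 * cos t)"
    using cosh_square_eq[of s] sin_squared_eq[of t] by (simp add: algebra_simps power2_eq_square)
  also have "\<dots> / (4 * pi * (cosh s - cos t))\<^sup>2 = (1 + 2 * cos t / (cosh s - cos t)) / (4 * pi)\<^sup>2"
  proof -
    have "u * (u + 2 * c) / (4 * pi * u)\<^sup>2 = (1 + 2 * c / u) / (4 * pi)\<^sup>2" if "u \<noteq> 0" for u c :: real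
      using that by (simp add: field_simps power2_eq_square)
    from this[of "cosh s - cos t" "cos t"] d show ?thesis by (simp only: less_irrefl diff_gt_0_iff_gt neq_iff simp_thms)
  qed
  finally show ?thesis by (simp add: den_def s_def t_def)
qed

text \<open>This is the modulus of \<open>coth A - coth B = sinh (B - A) / (sinh A * sinh B)\<close>
  at half the complex arguments.\<close>

lemma norm_K_S_diff_sq:
  assumes "den z > 0" "den w > 0"
  shows "(norm (K_S z - K_S w))\<^sup>2 = (2 * den (z - w) / (den z * den w)) / (4 * pi)\<^sup>2"
proof -
  define s t where "s = fst z" and "t = snd z"
  define s' t' where "s' = fst w" and "t' = snd w"
  define D D' where "D = den z" and "D' = den w"
  have D: "D = cosh s - cos t" "D' = cosh s' - cos t'"
    by (simp_all add: D_def D'_def den_def s_def t_def s'_def t'_def)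
  have pos: "D > 0" "D' > 0" using assms by (simp_all add: D_def D'_def)
  have "(norm (K_S z - K_S w))\<^sup>2
      = (sin t / (4 * pi * D) - sin t' / (4 * pi * D'))\<^sup>2 + (sinh s / (4 * pi * D) - sinh s' / (4 * pi * D'))\<^sup>2"
    by (simp add: K_S_def norm_prod_def s_def t_def s'_def t'_def D_def D'_def den_def power2_eq_square)
       (simp add: algebra_simps)
  also have "\<dots> = ((sin t * D' - sin t' * D)\<^sup>2 + (sinh s * D' - sinh s' * D)\<^sup>2) / ((4 * pi)\<^sup>2 * (D * D')\<^sup>2)"
    using pos by (simp add: field_simps power2_eq_square)
  also have "(sin t * D' - sin t' * D)\<^sup>2 + (sinh s * D' - sinh s' * D)\<^sup>2
      = ((sin t)\<^sup>2 + (sinh s)\<^sup>2) * D'\<^sup>2 + ((sin t')\<^sup>2 + (sinh s')\<^sup>2) * D\<^sup>2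
        - 2 * (sin t * sin t' + sinh s * sinh s') * (D * D')"
    by (simp add: algebra_simps power2_eq_square)
  also have "(sin t)\<^sup>2 + (sinh s)\<^sup>2 = D * (cosh s + cos t)"
    using cosh_square_eq[of s] sin_squared_eq[of t] by (simp add: D algebra_simps power2_eq_square)
  also have "(sin t')\<^sup>2 + (sinh s')\<^sup>2 = D' * (cosh s' + cos t')"
    using cosh_square_eq[of s'] sin_squared_eq[of t'] by (simp add: D algebra_simps power2_eq_square)
  also have "D * (cosh s + cos t) * D'\<^sup>2 + D' * (cosh s' + cos t') * D\<^sup>2
        - 2 * (sin t * sin t' + sinh s * sinh s') * (D * D')
     = (D * D') * ((cosh s + cos t) * D' + (cosh s' + cos t') * D - 2 * (sin t * sin t' + sinh s * sinh s'))"
    by (simp add: algebra_simps power2_eq_square)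
  also have "(cosh s + cos t) * D' + (cosh s' + cos t') * D - 2 * (sin t * sin t' + sinh s * sinh s')
      = 2 * den (z - w)"
    by (simp add: D den_def s_def t_def s'_def t'_def cosh_diff cos_diff algebra_simps)
  finally show ?thesis
    using pos by (simp add: D_def[symmetric] D'_def[symmetric] field_simps power2_eq_square)
qed

lemma cosh_minus_one_le: "cosh s - 1 \<le> s\<^sup>2" if "\<bar>s\<bar> \<le> 1" for s :: real
proof -
  have *: "cosh s - 1 \<le> s\<^sup>2" if "0 \<le> s" "s \<le> 1" for s :: real
  proof -
    have 1: "exp s \<le> 1 + s + s\<^sup>2" using exp_bound that by auto
    have "exp (-s) \<le> 1 - s + s\<^sup>2"
    proof -
      have "1 + s \<le> exp s" by (rule exp_ge_add_one_self)
      hence "exp (-s) \<le> 1 / (1 + s)" using that by (simp add: exp_minus divide_simps)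
      also have "\<dots> \<le> 1 - s + s\<^sup>2" using that by (simp add: field_simps power2_eq_square)
      finally show ?thesis .
    qed
    thus ?thesis using 1 unfolding cosh_def by (simp add: field_simps)
  qed
  show ?thesis using *[of "\<bar>s\<bar>"] that by (simp add: cosh_real_abs)
qed

lemma den_le:
  assumes "norm z \<le> 1"
  shows "den z \<le> 2 * (norm z)\<^sup>2"
proof -
  have n: "(norm z)\<^sup>2 = (fst z)\<^sup>2 + (snd z)\<^sup>2" by (simp add: norm_prod_def)
  have "\<bar>fst z\<bar> \<le> 1" using norm_fst_le[of "fst z" "snd z"] assms by simp
  hence "cosh (fst z) - 1 \<le> (fst z)\<^sup>2" by (rule cosh_minus_one_le)
  moreover have "1 - cos (snd z) \<le> (snd z)\<^sup>2 / 2"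
  proof -
    have "cos (snd z) = 1 - 2 * (sin (snd z / 2))\<^sup>2" using cos_double_sin[of "snd z / 2"] by simp
    moreover have "(sin (snd z / 2))\<^sup>2 \<le> (snd z / 2)\<^sup>2"
      using abs_sin_x_le_abs_x[of "snd z / 2"] by (simp only: abs_le_square_iff)
    ultimately show ?thesis by (simp add: power_divide)
  qed
  moreover have "(snd z)\<^sup>2 \<ge> 0" "(fst z)\<^sup>2 \<ge> 0" by simp_all
  moreover have "c - k \<le> 2 * (a + b)" if "c - 1 \<le> a" "1 - k \<le> b / 2" "0 \<le> b" "0 \<le> a" for a b c k :: real
    using that by (simp add: field_simps)
  ultimately show ?thesis unfolding den_def n by blast
qed

text \<open>Near its zeros \<open>den\<close> is comparable to the squared distance, so this is the
  usual 1/r singularity of a planar vortex plus a bounded term.\<close>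

lemma norm_K_S_le:
  assumes "den z > 0"
  shows "norm (K_S z) \<le> (1 + 2 * den z powr (-(1/2))) / (4 * pi)"
proof -
  let ?D = "den z"
  have s: "?D powr (-(1/2)) = 1 / sqrt ?D"
    using assms by (simp add: powr_minus_divide powr_half_sqrt)
  have "(norm (K_S z))\<^sup>2 \<le> (1 + 2 / ?D) / (4 * pi)\<^sup>2"
    unfolding norm_K_S_sq[OF assms]
    using assms cos_le_one[of "snd z"] by (intro divide_right_mono add_left_mono) auto
  also have "1 + 2 / ?D \<le> (1 + 2 * ?D powr (-(1/2)))\<^sup>2"
  proof -
    have "2 / ?D \<le> 4 / ?D" "0 \<le> 4 / sqrt ?D" using assms by (simp_all add: divide_right_mono)
    hence "1 + 2 / ?D \<le> 1 + (4 / ?D + 4 / sqrt ?D)" by linarith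
    also have "\<dots> = (1 + 2 * (1 / sqrt ?D))\<^sup>2" using assms by (simp add: power2_sum power_divide)
    finally show ?thesis unfolding s .
  qed
  finally have "(norm (K_S z))\<^sup>2 \<le> ((1 + 2 * ?D powr (-(1/2))) / (4 * pi))\<^sup>2"
    by (simp add: power_divide divide_right_mono)
  thus ?thesis by (rule power2_le_imp_le) simp
qed

text \<open>Interpolation between \<open>2 den (z - w) / (den z * den w)\<close> and the triangle inequality.\<close>

lemma norm_K_S_diff_le:
  assumes z: "den z > 0" and w: "den w > 0" and e: "0 < e" "e \<le> 1"
  defines "p \<equiv> 1 - e / 2"
  shows "norm (K_S z - K_S w) \<le>
    norm (z - w) powr (1 - e) * (1 + den z powr (-p) + den w powr (-p))"
proof -
  define D D' \<rho> where "D = den z" and "D' = den w" and "\<rho> = norm (z - w)"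
  \<comment> \<open>One quantity for both singularities; the entry 1 makes powers of
    \<open>M\<close> increase with the exponent.\<close>
  define M where "M = max 1 (max (1 / D) (1 / D'))"
  define E where "E = 4 * pi * norm (K_S z - K_S w)"
  have D: "D > 0" "D' > 0" using z w by (simp_all add: D_def D'_def)
  have M: "M \<ge> 1" "1 / D \<le> M" "1 / D' \<le> M" by (simp_all add: M_def)
  have p: "1/2 \<le> p" "p \<le> 1" using e by (simp_all add: p_def)
  have E0: "E \<ge> 0" by (simp add: E_def)
  have EM: "E \<le> 6 * M powr (1/2)"
  proof -
    have "D powr (-(1/2)) \<le> M powr (1/2)" "D' powr (-(1/2)) \<le> M powr (1/2)"
      using D M powr_mono2[of "1/2" "1/D" M] powr_mono2[of "1/2" "1/D'" M]
      by (simp_all add: powr_minus_divide powr_divide)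
    moreover have "1 \<le> M powr (1/2)" using M by (simp add: ge_one_powr_ge_zero)
    moreover have "E \<le> (1 + 2 * D powr (-(1/2))) + (1 + 2 * D' powr (-(1/2)))"
    proof -
      have "norm (K_S z - K_S w) \<le> norm (K_S z) + norm (K_S w)" by (rule norm_triangle_ineq4)
      also have "\<dots> \<le> (1 + 2 * D powr (-(1/2))) / (4 * pi) + (1 + 2 * D' powr (-(1/2))) / (4 * pi)"
        using norm_K_S_le[OF z] norm_K_S_le[OF w] by (simp add: D_def D'_def add_mono)
      also have "\<dots> = ((1 + 2 * D powr (-(1/2))) + (1 + 2 * D' powr (-(1/2)))) / (4 * pi)"
        by (simp add: add_divide_distrib)
      finally show ?thesis by (simp add: E_def pos_le_divide_eq mult_ac)
    qed
    ultimately show ?thesis by linarith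
  qed
  have Mp: "M powr p \<le> 1 + D powr (-p) + D' powr (-p)"
  proof -
    have "M = 1 \<or> M = 1 / D \<or> M = 1 / D'" by (auto simp: M_def max_def)
    thus ?thesis using D by (auto simp: powr_minus_divide powr_divide)
  qed
  have "E \<le> 12 * \<rho> powr (1 - e) * M powr p"
  proof (cases "\<rho> \<le> 1")
    case False
    have "M powr (1/2) \<le> M powr p" using M p by (intro powr_mono) auto
    moreover have "1 \<le> \<rho> powr (1 - e)" using False e by (simp add: ge_one_powr_ge_zero)
    hence "1 * M powr p \<le> \<rho> powr (1 - e) * M powr p" by (intro mult_right_mono) auto
    moreover have "M powr p \<ge> 0" by simp
    ultimately show ?thesis using EM unfolding mult.assoc by linarith
  next
    case True
    have "E\<^sup>2 = 2 * den (z - w) / (D * D')"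
      using norm_K_S_diff_sq[OF z w] by (simp add: E_def D_def D'_def power_mult_distrib field_simps)
    also have "\<dots> \<le> (2 * \<rho>)\<^sup>2 * (1 / D * (1 / D'))"
      using den_le[of "z - w"] True D by (simp add: \<rho>_def power_mult_distrib field_simps)
    also have "\<dots> \<le> (2 * \<rho>)\<^sup>2 * (M * M)"
      using M D by (intro mult_left_mono mult_mono) auto
    finally have "E\<^sup>2 \<le> (2 * \<rho> * M)\<^sup>2" by (simp add: power_mult_distrib power2_eq_square mult_ac)
    hence E2: "E \<le> 2 * \<rho> * M"
      by (rule power2_le_imp_le) (use M in \<open>auto simp: \<rho>_def\<close>)
    show ?thesis
    proof (cases "E = 0")
      case True
      then show ?thesis by simp
    next
      case False
      hence Ep: "E > 0" using E0 by simp
      hence "\<rho> \<noteq> 0" using E2 by auto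
      hence \<rho>p: "\<rho> > 0" by (simp add: \<rho>_def)
      \<comment> \<open>The closed form of the difference is used to the power \<open>1 - e\<close>,
        the triangle inequality to the power \<open>e\<close>. The exponents of \<open>M\<close>
        then add up to \<open>(1 - e) + e / 2 = p < 1\<close>, which is integrable.\<close>
      have "E = E powr (1 - e) * E powr e" using Ep by (simp flip: powr_add)
      also have "\<dots> \<le> (2 * \<rho> * M) powr (1 - e) * (6 * M powr (1/2)) powr e"
        using E2 EM E0 e by (intro mult_mono powr_mono2) auto
      also have "\<dots> = (2 powr (1 - e) * 6 powr e) * \<rho> powr (1 - e) * (M powr (1 - e) * M powr (e / 2))"
        using \<rho>p M by (simp add: powr_mult powr_powr)
      also have "M powr (1 - e) * M powr (e / 2) = M powr p"
        by (simp add: p_def flip: powr_add)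
      also have "2 powr (1 - e) * 6 powr e \<le> 2 powr 1 * 6 powr (1::real)"
        using e by (intro mult_mono powr_mono) auto
      finally show ?thesis by (simp add: mult_right_mono mult_ac)
    qed
  qed
  also have "\<dots> \<le> 12 * \<rho> powr (1 - e) * (1 + D powr (-p) + D' powr (-p))"
    using Mp by (intro mult_left_mono) auto
  \<comment> \<open>\<open>E\<close> carries the factor \<open>4 * pi\<close>; the constant 12
    leaves 3, which is absorbed by \<open>pi > 3\<close>.\<close>
  finally have "pi * norm (K_S z - K_S w) \<le> 3 * (\<rho> powr (1 - e) * (1 + D powr (-p) + D' powr (-p)))"
    by (simp add: E_def)
  moreover have "3 * norm (K_S z - K_S w) \<le> pi * norm (K_S z - K_S w)"
    using pi_approx by (intro mult_right_mono) auto
  ultimately show ?thesis unfolding \<rho>_def D_def D'_def by linarith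
qed


section \<open>Integrals over the half cylinder\<close>

lemma suminf_indicator_unique:
  fixes P :: "nat \<Rightarrow> bool"
  assumes "\<And>m n. P m \<Longrightarrow> P n \<Longrightarrow> m = n"
  shows "(\<Sum>n. of_bool (P n) :: ennreal) = of_bool (\<exists>n. P n)"
proof (cases "\<exists>n. P n")
  case True
  then obtain n0 where n0: "P n0" by blast
  have "(\<lambda>n. of_bool (P n) :: ennreal) = (\<lambda>n. if n = n0 then 1 else 0)"
    using assms n0 by (auto simp: fun_eq_iff)
  then show ?thesis using True sums_single[of n0 "\<lambda>_. 1::ennreal"] by (simp add: sums_iff)
qed simp

lemma nn_integral_lborel_translate:
  fixes f :: "'a::euclidean_space \<Rightarrow> ennreal"
  assumes [measurable]: "f \<in> borel_measurable borel"
  shows "(\<integral>\<^sup>+x. f (x + c) \<partial>lborel) = (\<integral>\<^sup>+x. f x \<partial>lborel)"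
proof -
  have "(\<integral>\<^sup>+x. f x \<partial>lborel) = (\<integral>\<^sup>+x. f x \<partial>distr lborel borel ((+) c))"
    by (simp add: lborel_distr_plus)
  also have "\<dots> = (\<integral>\<^sup>+x. f (x + c) \<partial>lborel)" by (subst nn_integral_distr) (simp_all add: add.commute)
  finally show ?thesis ..
qed

text \<open>\<open>A\<close> is cut into the pieces that some translation carries into
  \<open>B\<close>, each moved there by translation invariance. Every point of \<open>A\<close> is
  counted at least once, and no point of \<open>B\<close> more than once since the translates of
  \<open>A\<close> are disjoint. The translations are enumerated through \<open>int_decode\<close>
  so that sums over the naturals apply.\<close>

lemma nn_integral_fundamental_domain_le:
  fixes f :: "'a::euclidean_space \<Rightarrow> ennreal"
  assumes [measurable]: "f \<in> borel_measurable borel" "A \<in> sets borel" "B \<in> sets borel"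
    and per: "\<And>x (k::int). f (x + of_int k *\<^sub>R v) = f x"
    and A: "\<And>x (k::int). x \<in> A \<Longrightarrow> x + of_int k *\<^sub>R v \<in> A \<Longrightarrow> k = 0"
    and AB: "\<And>x. x \<in> A \<Longrightarrow> \<exists>k::int. x + of_int k *\<^sub>R v \<in> B"
  shows "(\<integral>\<^sup>+x\<in>A. f x \<partial>lborel) \<le> (\<integral>\<^sup>+x\<in>B. f x \<partial>lborel)"
proof -
  define c where "c n = of_int (int_decode n) *\<^sub>R v" for n
  have "(\<integral>\<^sup>+x\<in>A. f x \<partial>lborel) \<le> (\<integral>\<^sup>+x. (\<Sum>n. f (x + c n) * (indicator A x * indicator B (x + c n))) \<partial>lborel)"
  proof (rule nn_integral_mono)
    fix x
    show "f x * indicator A x \<le> (\<Sum>n. f (x + c n) * (indicator A x * indicator B (x + c n)))"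
    proof (cases "x \<in> A")
      case True
      then obtain k :: int where "x + of_int k *\<^sub>R v \<in> B" using AB by blast
      then obtain n where n: "x + c n \<in> B" by (metis c_def surj_int_decode surjD)
      have "f x * indicator A x = (\<Sum>m\<in>{n}. f (x + c m) * (indicator A x * indicator B (x + c m)))"
        using n True per by (simp add: c_def)
      also have "\<dots> \<le> (\<Sum>n. f (x + c n) * (indicator A x * indicator B (x + c n)))"
        by (intro sum_le_suminf) auto
      finally show ?thesis .
    qed simp
  qed
  also have "\<dots> = (\<Sum>n. \<integral>\<^sup>+x. f (x + c n) * (indicator A x * indicator B (x + c n)) \<partial>lborel)"
    by (rule nn_integral_suminf) measurable
  also have "\<dots> = (\<Sum>n. \<integral>\<^sup>+x. f x * (indicator A (x - c n) * indicator B x) \<partial>lborel)"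
    using nn_integral_lborel_translate[of "\<lambda>x. f x * (indicator A (x - c n) * indicator B x)" "c n" for n] by simp
  also have "\<dots> = (\<integral>\<^sup>+x. (\<Sum>n. f x * (indicator A (x - c n) * indicator B x)) \<partial>lborel)"
    by (rule nn_integral_suminf[symmetric]) measurable
  also have "\<dots> \<le> (\<integral>\<^sup>+x\<in>B. f x \<partial>lborel)"
  proof (rule nn_integral_mono)
    fix x
    have uniq: "m = n" if "x - c m \<in> A" "x - c n \<in> A" for m n
    proof -
      have "x - c n = (x - c m) + of_int (int_decode m - int_decode n) *\<^sub>R v"
        by (simp add: c_def algebra_simps)
      hence "int_decode m - int_decode n = 0" using A that by metis
      thus ?thesis by (simp add: inj_eq[OF inj_int_decode])
    qed
    have "(\<Sum>n. f x * (indicator A (x - c n) * indicator B x)) = (f x * indicator B x) * (\<Sum>n. indicator A (x - c n))"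
      by (subst ennreal_suminf_cmult[symmetric]) (simp add: mult_ac)
    also have "(\<Sum>n. indicator A (x - c n) :: ennreal) = (\<Sum>n. of_bool (x - c n \<in> A))"
      by (simp add: indicator_def of_bool_def)
    also have "\<dots> \<le> 1" using uniq by (subst suminf_indicator_unique) auto
    finally show "(\<Sum>n. f x * (indicator A (x - c n) * indicator B x)) \<le> f x * indicator B x"
      by (simp add: mult_left_mono)
  qed
  finally show ?thesis .
qed

lemma nn_integral_fundamental_domain:
  fixes f :: "'a::euclidean_space \<Rightarrow> ennreal"
  assumes "f \<in> borel_measurable borel" "A \<in> sets borel" "B \<in> sets borel"
    and "\<And>x (k::int). f (x + of_int k *\<^sub>R v) = f x"
    and "\<And>x (k::int). x \<in> A \<Longrightarrow> x + of_int k *\<^sub>R v \<in> A \<Longrightarrow> k = 0"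
    and "\<And>x (k::int). x \<in> B \<Longrightarrow> x + of_int k *\<^sub>R v \<in> B \<Longrightarrow> k = 0"
    and "\<And>x. x \<in> A \<Longrightarrow> \<exists>k::int. x + of_int k *\<^sub>R v \<in> B"
    and "\<And>x. x \<in> B \<Longrightarrow> \<exists>k::int. x + of_int k *\<^sub>R v \<in> A"
  shows "(\<integral>\<^sup>+x\<in>A. f x \<partial>lborel) = (\<integral>\<^sup>+x\<in>B. f x \<partial>lborel)"
  by (rule antisym; rule nn_integral_fundamental_domain_le[where v = v]) (fact assms)+

lemma exists_shift_in_period:
  "\<exists>k::int. x + of_int k * (2 * pi) \<in> {-pi..<pi}"
proof (intro exI)
  let ?k = "- \<lfloor>(x + pi) / (2 * pi)\<rfloor>"
  have "of_int \<lfloor>(x + pi) / (2 * pi)\<rfloor> * (2 * pi) \<le> x + pi"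
    using of_int_floor_le[of "(x + pi) / (2 * pi)"] by (simp only: pos_le_divide_eq[OF mult_pos_pos[OF zero_less_numeral pi_gt_zero]])
  moreover have "x + pi < (of_int \<lfloor>(x + pi) / (2 * pi)\<rfloor> + 1) * (2 * pi)"
    using floor_correct[of "(x + pi) / (2 * pi)"]
    by (simp only: pos_divide_less_eq[OF mult_pos_pos[OF zero_less_numeral pi_gt_zero]] of_int_add of_int_1)
  ultimately show "x + of_int ?k * (2 * pi) \<in> {-pi..<pi}" by (simp add: algebra_simps)
qed

lemma shift_in_period_unique:
  assumes "\<bar>of_int k * (2 * pi)\<bar> < 2 * pi"
  shows "k = 0"
proof -
  have "\<bar>of_int k :: real\<bar> * (2 * pi) < 1 * (2 * pi)" using assms by (simp add: abs_mult)
  hence "\<bar>of_int k :: real\<bar> < 1" by (subst (asm) mult_less_cancel_right) auto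
  thus ?thesis by linarith
qed

text \<open>Reflection turns the half-open period into one that is open on the left and closed on
  the right; both are fundamental domains of the same translation.\<close>

lemma nn_integral_period_reflect:
  fixes f :: "real \<Rightarrow> ennreal"
  assumes [measurable]: "f \<in> borel_measurable borel"
    and per: "\<And>x (k::int). f (x + of_int k * (2 * pi)) = f x"
  shows "(\<integral>\<^sup>+y\<in>{-pi..<pi}. f (c - y) \<partial>lborel) = (\<integral>\<^sup>+y\<in>{-pi..<pi}. f y \<partial>lborel)"
proof -
  have "(\<integral>\<^sup>+y\<in>{-pi..<pi}. f (c - y) \<partial>lborel) = (\<integral>\<^sup>+y\<in>{c-pi<..c+pi}. f (c - y) \<partial>lborel)"
  proof (rule nn_integral_fundamental_domain[where v = "2 * pi"])
    fix x :: real and k :: int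
    show "f (c - (x + of_int k *\<^sub>R (2 * pi))) = f (c - x)"
      using per[of "c - x" "-k"] by (simp add: algebra_simps)
    show "k = 0" if "x \<in> {-pi..<pi}" "x + of_int k *\<^sub>R (2 * pi) \<in> {-pi..<pi}"
      using that by (intro shift_in_period_unique) auto
    show "k = 0" if "x \<in> {c-pi<..c+pi}" "x + of_int k *\<^sub>R (2 * pi) \<in> {c-pi<..c+pi}"
      using that by (intro shift_in_period_unique) auto
    show "\<exists>k::int. x + of_int k *\<^sub>R (2 * pi) \<in> {-pi..<pi}" using exists_shift_in_period by simp
    obtain j :: int where "(c - x) + of_int j * (2 * pi) \<in> {-pi..<pi}" using exists_shift_in_period by blast
    hence "x + of_int (-j) *\<^sub>R (2 * pi) \<in> {c-pi<..c+pi}" by (auto simp: algebra_simps)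
    thus "\<exists>k::int. x + of_int k *\<^sub>R (2 * pi) \<in> {c-pi<..c+pi}" by blast
  qed measurable
  also have "\<dots> = (\<integral>\<^sup>+y. f y * indicator {-pi..<pi} y \<partial>lborel)"
    by (subst nn_integral_real_affine[where c = "-1" and t = c])
       (auto intro!: nn_integral_cong simp: indicator_def)
  finally show ?thesis .
qed

text \<open>The antiderivative below sums the Fourier series \<open>1 + 2 \<Sum>\<^sub>k q\<^sup>k cos (k t)\<close> of the Poisson kernel.\<close>

lemma nn_integral_poisson_kernel:
  assumes "s > 0"
  shows "(\<integral>\<^sup>+\<theta>\<in>{-pi..<pi}. ennreal (sinh s / (cosh s - cos \<theta>)) \<partial>lborel) \<le> ennreal (2 * pi)"
proof -
  define q where "q = exp (-s)"
  have q: "0 < q" "q < 1" using assms by (auto simp: q_def)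
  have sc: "sinh s = (1 - q\<^sup>2) / (2 * q)" "cosh s = (1 + q\<^sup>2) / (2 * q)"
    using q by (simp_all add: sinh_def cosh_def q_def exp_minus field_simps power2_eq_square)
  define F where "F t = t + 2 * arctan (q * sin t / (1 - q * cos t))" for t
  \<comment> \<open>This keeps the denominator inside the arctangent positive, so \<open>F\<close>
    is one smooth branch over the whole period. The arctangent vanishes at both ends, and only the
    summand \<open>t\<close> contributes.\<close>
  have qc: "q * cos t < 1" for t
    using q mult_left_mono[OF cos_le_one[of t], of q] by linarith
  have dpos: "cosh s - cos t > 0" for t
    using den_pos[of "(s, t)"] assms by (simp add: den_def)
  have D: "(F has_real_derivative sinh s / (cosh s - cos t)) (at t)" for t
  proof -
    define w where "w = 1 - q * cos t"
    have w: "w > 0" using qc[of t] by (simp add: w_def)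
    have n: "w\<^sup>2 + (q * sin t)\<^sup>2 = 1 - 2 * q * cos t + q\<^sup>2"
      unfolding power_mult_distrib sin_squared_eq by (simp add: w_def power2_eq_square algebra_simps)
    have npos: "1 - 2 * q * cos t + q\<^sup>2 > 0"
      unfolding n[symmetric] using w by (simp add: add_pos_nonneg)
    have "(F has_real_derivative
        1 + 2 * (((q * cos t) * w - (q * sin t) * (q * sin t)) / (w * w) / (1 + (q * sin t / w)\<^sup>2))) (at t)"
      unfolding F_def w_def using qc[of t]
      by (auto intro!: derivative_eq_intros simp: field_simps)
    also have "((q * cos t) * w - (q * sin t) * (q * sin t)) / (w * w) / (1 + (q * sin t / w)\<^sup>2)
       = ((q * cos t) * w - (q * sin t)\<^sup>2) / (w\<^sup>2 + (q * sin t)\<^sup>2)"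
    proof -
      have "1 + (q * sin t / w)\<^sup>2 = (w\<^sup>2 + (q * sin t)\<^sup>2) / (w * w)"
        using w by (simp add: field_simps power2_eq_square)
      thus ?thesis using w by (simp add: power2_eq_square)
    qed
    also have "(q * cos t) * w - (q * sin t)\<^sup>2 = q * cos t - q\<^sup>2"
      unfolding power_mult_distrib sin_squared_eq by (simp add: w_def power2_eq_square algebra_simps)
    also have "1 + 2 * ((q * cos t - q\<^sup>2) / (w\<^sup>2 + (q * sin t)\<^sup>2)) = (1 - q\<^sup>2) / (1 - 2 * q * cos t + q\<^sup>2)"
      unfolding n using npos by (simp add: field_simps)
    also have "\<dots> = sinh s / (cosh s - cos t)"
    proof -
      have "cosh s - cos t = (1 - 2 * q * cos t + q\<^sup>2) / (2 * q)" using q by (simp add: sc field_simps)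
      thus ?thesis using q by (simp add: sc)
    qed
    finally show ?thesis .
  qed
  have "(\<integral>\<^sup>+\<theta>\<in>{-pi..<pi}. ennreal (sinh s / (cosh s - cos \<theta>)) \<partial>lborel)
      \<le> (\<integral>\<^sup>+\<theta>\<in>{-pi..pi}. ennreal (sinh s / (cosh s - cos \<theta>)) \<partial>lborel)"
    by (intro nn_integral_mono) (auto simp: indicator_def)
  also have "\<dots> = ennreal (F pi - F (-pi))"
    using D dpos assms by (intro nn_integral_FTC_Icc) (auto intro: less_imp_le)
  also have "F pi - F (-pi) = 2 * pi" by (simp add: F_def)
  finally show ?thesis .
qed

section \<open>Integrals of negative powers of \<open>den\<close>\<close>

lemma borel_measurable_den [measurable]: "den \<in> borel_measurable borel"
proof -
  have "continuous_on UNIV den" unfolding den_def by (intro continuous_intros)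
  thus ?thesis by (rule borel_measurable_continuous_onI)
qed

lemma sets_S_plus [measurable]: "S_plus \<in> sets borel"
  unfolding S_plus_def by (intro borel_open open_Collect_less continuous_intros)

lemma sets_one_period [measurable]: "one_period \<in> sets borel"
  unfolding one_period_def Collect_conj_eq
  by (intro sets.Int borel_open[OF open_Collect_less] borel_closed[OF closed_Collect_le] continuous_intros)

text \<open>Periodicity absorbs the angular shift \<open>d\<close>, which leaves radial slices. The
  coefficient \<open>m\<close> is -1 for the kernel itself and 1 for its mirror image.\<close>

lemma nn_integral_half_cylinder:
  fixes f :: "real \<times> real \<Rightarrow> ennreal"
  assumes f [measurable]: "f \<in> borel_measurable borel"
    and per: "\<And>s \<theta> (k::int). f (s, \<theta> + of_int k * (2 * pi)) = f (s, \<theta>)"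
  shows "(\<integral>\<^sup>+y\<in>S_plus_period. f (c + m * fst y, d - snd y) \<partial>lborel)
    = (\<integral>\<^sup>+s\<in>{0<..}. (\<integral>\<^sup>+\<theta>\<in>{-pi..<pi}. f (c + m * s, \<theta>) \<partial>lborel) \<partial>lborel)"
proof -
  have [measurable]: "f \<in> borel_measurable (borel \<Otimes>\<^sub>M borel)" using f by (simp add: borel_prod)
  have "(\<integral>\<^sup>+y\<in>S_plus_period. f (c + m * fst y, d - snd y) \<partial>lborel)
     = (\<integral>\<^sup>+y. f (c + m * fst y, d - snd y) * (indicator {0<..} (fst y) * indicator {-pi..<pi} (snd y)) \<partial>(lborel \<Otimes>\<^sub>M lborel))"
    unfolding lborel_prod by (intro nn_integral_cong) (auto simp: S_plus_def one_period_def indicator_def)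
  also have "\<dots> = (\<integral>\<^sup>+s. \<integral>\<^sup>+t. f (c + m * s, d - t) * (indicator {0<..} s * indicator {-pi..<pi} t) \<partial>lborel \<partial>lborel)"
    by (subst lborel.nn_integral_fst[symmetric]) simp_all
  also have "\<dots> = (\<integral>\<^sup>+s\<in>{0<..}. (\<integral>\<^sup>+t\<in>{-pi..<pi}. f (c + m * s, d - t) \<partial>lborel) \<partial>lborel)"
    by (intro nn_integral_cong) (auto simp: indicator_def)
  also have "\<dots> = (\<integral>\<^sup>+s\<in>{0<..}. (\<integral>\<^sup>+t\<in>{-pi..<pi}. f (c + m * s, t) \<partial>lborel) \<partial>lborel)"
  proof (rule nn_integral_cong)
    fix s :: real
    show "(\<integral>\<^sup>+t\<in>{-pi..<pi}. f (c + m * s, d - t) \<partial>lborel) * indicator {0<..} s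
       = (\<integral>\<^sup>+t\<in>{-pi..<pi}. f (c + m * s, t) \<partial>lborel) * indicator {0<..} s"
      by (subst nn_integral_period_reflect[where f = "\<lambda>t. f (c + m * s, t)"]) (simp_all add: per)
  qed
  finally show ?thesis .
qed

lemma sinh_ge_self: "s \<le> sinh s" if "0 \<le> s" for s :: real
proof -
  have "mono_on {0..} (\<lambda>x::real. sinh x - x)"
  proof (rule mono_onI)
    fix x y :: real assume xy: "x \<in> {0..}" "x \<le> y"
    show "sinh x - x \<le> sinh y - y"
      by (rule DERIV_nonneg_imp_nondecreasing[OF xy(2)])
         (auto intro!: exI[of _ "cosh _ - 1"] derivative_eq_intros simp: cosh_real_ge_1)
  qed
  from mono_onD[OF this, of 0 s] that show ?thesis by simp
qed

text \<open>
  The factor \<open>1 / (1 - p)\<close> in \<open>nn_integral_den_powr\<close> below must not be worse, since the Osgood argument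
  needs the modulus of continuity \<open>C/e r\<^sup>1\<^sup>-\<^sup>e\<close>. So the slices are bounded through the Poisson
  kernel, not by splitting the singularity evenly between the two variables.
\<close>

lemma nn_integral_den_powr_slice:
  assumes "s \<noteq> 0" "0 < p" "p \<le> 1"
  shows "(\<integral>\<^sup>+\<theta>\<in>{-pi..<pi}. ennreal (den (s, \<theta>) powr (-p)) \<partial>lborel) \<le> ennreal (4 * pi * \<bar>s\<bar> powr (-p))"
proof -
  \<comment> \<open>At this threshold \<open>X / \<mu>\<close> is exactly the Poisson kernel, whose
    integral is bounded independently of \<open>s\<close>. Below the threshold
    \<open>X powr p\<close> is at most \<open>\<mu> powr p\<close>; above it
    \<open>(X / \<mu>) powr p\<close> is at most \<open>X / \<mu>\<close> because
    \<open>p \<le> 1\<close>.\<close>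
  define \<mu> where "\<mu> = 1 / sinh \<bar>s\<bar>"
  have sh: "sinh \<bar>s\<bar> > 0" "\<bar>s\<bar> \<le> sinh \<bar>s\<bar>" using assms sinh_ge_self[of "\<bar>s\<bar>"] by auto
  have mu: "\<mu> > 0" using sh by (simp add: \<mu>_def)
  have dpos: "den (s, \<theta>) > 0" for \<theta> using den_pos assms by simp
  have pw: "den (s, \<theta>) powr (-p) \<le> \<mu> powr p * (sinh \<bar>s\<bar> / (cosh \<bar>s\<bar> - cos \<theta>)) + \<mu> powr p" for \<theta>
  proof -
    define X where "X = 1 / den (s, \<theta>)"
    have X: "X > 0" using dpos[of \<theta>] by (simp add: X_def)
    have "den (s, \<theta>) powr (-p) = X powr p" using dpos[of \<theta>] by (simp add: X_def powr_minus_divide powr_divide)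
    also have "\<dots> \<le> \<mu> powr p * (X / \<mu>) + \<mu> powr p"
    proof (cases "X \<le> \<mu>")
      case True
      hence "X powr p \<le> \<mu> powr p" using X assms by (intro powr_mono2) auto
      thus ?thesis using X mu by (simp add: add_increasing)
    next
      case False
      have "(X / \<mu>) powr p \<le> (X / \<mu>) powr 1" using False mu assms by (intro powr_mono) auto
      hence "\<mu> powr p * (X / \<mu>) powr p \<le> \<mu> powr p * (X / \<mu>)" using X mu by (intro mult_left_mono) auto
      also have "\<mu> powr p * (X / \<mu>) powr p = X powr p" using X mu by (simp flip: powr_mult)
      finally show ?thesis by (simp add: add_increasing2)
    qed
    also have "X / \<mu> = sinh \<bar>s\<bar> / (cosh \<bar>s\<bar> - cos \<theta>)" by (simp add: X_def \<mu>_def den_def cosh_real_abs)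
    finally show ?thesis .
  qed
  have "(\<integral>\<^sup>+\<theta>\<in>{-pi..<pi}. ennreal (den (s, \<theta>) powr (-p)) \<partial>lborel)
     \<le> (\<integral>\<^sup>+\<theta>. ennreal (\<mu> powr p) * (ennreal (sinh \<bar>s\<bar> / (cosh \<bar>s\<bar> - cos \<theta>)) * indicator {-pi..<pi} \<theta>)
             + ennreal (\<mu> powr p) * indicator {-pi..<pi} \<theta> \<partial>lborel)"
  proof (intro nn_integral_mono)
    fix \<theta>
    define X where "X = sinh \<bar>s\<bar> / (cosh \<bar>s\<bar> - cos \<theta>)"
    have "X \<ge> 0" using dpos[of \<theta>] sh by (simp add: X_def den_def cosh_real_abs)
    moreover have "den (s, \<theta>) powr (-p) \<le> \<mu> powr p * X + \<mu> powr p"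
      using pw[of \<theta>] by (simp only: X_def)
    ultimately show "ennreal (den (s, \<theta>) powr - p) * indicator {- pi..<pi} \<theta>
         \<le> ennreal (\<mu> powr p) * (ennreal (sinh \<bar>s\<bar> / (cosh \<bar>s\<bar> - cos \<theta>)) * indicator {-pi..<pi} \<theta>)
             + ennreal (\<mu> powr p) * indicator {-pi..<pi} \<theta>"
      unfolding X_def[symmetric]
      by (cases "\<theta> \<in> {-pi..<pi}") (simp_all add: ennreal_leI flip: ennreal_mult ennreal_plus)
  qed
  also have "\<dots> = ennreal (\<mu> powr p) * (\<integral>\<^sup>+\<theta>\<in>{-pi..<pi}. ennreal (sinh \<bar>s\<bar> / (cosh \<bar>s\<bar> - cos \<theta>)) \<partial>lborel)
       + ennreal (\<mu> powr p) * ennreal (2 * pi)"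
    by (simp add: nn_integral_add nn_integral_cmult nn_integral_cmult_indicator)
  also have "\<dots> \<le> ennreal (\<mu> powr p) * ennreal (2 * pi) + ennreal (\<mu> powr p) * ennreal (2 * pi)"
    using assms by (intro add_mono mult_left_mono nn_integral_poisson_kernel) auto
  also have "\<dots> = ennreal (4 * pi * \<mu> powr p)" by (simp flip: ennreal_mult ennreal_plus)
  also have "\<dots> \<le> ennreal (4 * pi * \<bar>s\<bar> powr (-p))"
  proof -
    have "\<mu> powr p \<le> (1 / \<bar>s\<bar>) powr p"
      unfolding \<mu>_def using sh assms by (intro powr_mono2 divide_left_mono) auto
    also have "\<dots> = \<bar>s\<bar> powr (-p)" by (simp add: powr_minus_divide powr_divide)
    finally show ?thesis by (intro ennreal_leI mult_left_mono) auto
  qed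
  finally show ?thesis .
qed

text \<open>The only source of the factor \<open>1 / (1 - p)\<close>.\<close>

lemma nn_integral_abs_powr:
  assumes "0 < p" "p < 1"
  shows "(\<integral>\<^sup>+s\<in>{-1..1}. ennreal (\<bar>s\<bar> powr (-p)) \<partial>lborel) \<le> ennreal (2 / (1 - p))"
proof -
  have "((\<lambda>x. x powr (-p)) has_integral 1 powr (-p + 1) / (-p + 1)) {0..1}"
    using assms by (intro has_integral_powr_from_0) auto
  hence 1: "(\<integral>\<^sup>+s\<in>{0..1}. ennreal (\<bar>s\<bar> powr (-p)) \<partial>lborel) = ennreal (1 / (1 - p))"
    by (intro nn_integral_has_integral_lebesgue') (auto intro: has_integral_eq)
  have "(\<integral>\<^sup>+s\<in>{-1..0}. ennreal (\<bar>s\<bar> powr (-p)) \<partial>lborel) = (\<integral>\<^sup>+s\<in>{0..1}. ennreal (\<bar>s\<bar> powr (-p)) \<partial>lborel)"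
    by (subst nn_integral_real_affine[where c = "-1" and t = 0])
       (auto intro!: nn_integral_cong simp: indicator_def)
  moreover have "(\<integral>\<^sup>+s\<in>{-1..1}. ennreal (\<bar>s\<bar> powr (-p)) \<partial>lborel)
     \<le> (\<integral>\<^sup>+s. ennreal (\<bar>s\<bar> powr (-p)) * indicator {-1..0} s + ennreal (\<bar>s\<bar> powr (-p)) * indicator {0..1} s \<partial>lborel)"
    by (intro nn_integral_mono) (auto simp: indicator_def)
  ultimately have "(\<integral>\<^sup>+s\<in>{-1..1}. ennreal (\<bar>s\<bar> powr (-p)) \<partial>lborel) \<le> ennreal (1 / (1 - p)) + ennreal (1 / (1 - p))"
    using 1 by (simp add: nn_integral_add)
  also have "\<dots> = ennreal (2 / (1 - p))" using assms by (simp flip: ennreal_plus)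
  finally show ?thesis .
qed

lemma den_ge_third: "den z \<ge> 1/3" if "\<bar>fst z\<bar> \<ge> 1"
proof -
  have "cosh 1 \<le> cosh \<bar>fst z\<bar>" using that by (subst cosh_real_nonneg_le_iff) auto
  moreover have "cosh 1 \<ge> (4/3 :: real)"
  proof -
    have "(1 + 1 + 1/2 :: real) \<le> exp 1" using exp_lower_Taylor_quadratic[of "1::real"] by simp
    moreover have "1/3 \<le> exp (-1 :: real)" using exp_le by (simp add: exp_minus divide_simps)
    ultimately show ?thesis by (simp add: cosh_def)
  qed
  ultimately show ?thesis using cos_le_one[of "snd z"] unfolding den_def cosh_real_abs by linarith
qed

text \<open>Within distance 1 in the first coordinate \<open>E\<close> is enlarged to the full
  strip, so its shape is forgotten. Farther out \<open>den\<close> is at least 1/3, the integrand is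
  at most 3, and only the area of \<open>E\<close> counts.\<close>

lemma nn_integral_den_powr:
  assumes E [measurable]: "E \<in> sets borel" and sub: "E \<subseteq> S_plus_period"
    and m: "\<bar>m\<bar> = 1" and p: "0 < p" "p < 1"
  shows "(\<integral>\<^sup>+y\<in>E. ennreal (den (c + m * fst y, d - snd y) powr (-p)) \<partial>lborel)
    \<le> ennreal (8 * pi / (1 - p)) + 3 * emeasure lborel E"
proof -
  define G where "G z = ennreal (den z powr (-p)) * indicator {-1..1} (fst z)" for z
  have "den \<in> borel_measurable (borel \<Otimes>\<^sub>M borel)" by (simp add: borel_prod)
  hence [measurable]: "G \<in> borel_measurable borel" unfolding G_def borel_prod[symmetric] by measurable
  have G': "G \<in> borel_measurable (borel \<Otimes>\<^sub>M borel)" by (simp add: borel_prod)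
  have [measurable]: "(\<lambda>s. \<integral>\<^sup>+\<theta>\<in>{-pi..<pi}. G (s, \<theta>) \<partial>lborel) \<in> borel_measurable borel"
    using G' by measurable
  have [measurable]: "(\<lambda>y. G (c + m * fst y, d - snd y)) \<in> borel_measurable borel"
    by (rule measurable_compose[where N = borel])
       (auto intro!: borel_measurable_continuous_onI continuous_intros)
  have far: "ennreal (den z powr (-p)) \<le> G z + 3" for z
  proof (cases "\<bar>fst z\<bar> \<le> 1")
    case True
    thus ?thesis by (auto simp: G_def indicator_def abs_le_iff)
  next
    case False
    hence d: "den z \<ge> 1/3" by (intro den_ge_third) auto
    have "den z powr (-p) \<le> (1/3) powr (-p)" using d p by (intro powr_mono2') auto
    also have "\<dots> = 3 powr p" by (simp add: powr_minus_divide powr_divide)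
    also have "\<dots> \<le> 3 powr 1" using p by (intro powr_mono) auto
    finally have "ennreal (den z powr (-p)) \<le> ennreal 3" by (intro ennreal_leI) simp
    thus ?thesis by (simp add: add_increasing)
  qed
  have "(\<integral>\<^sup>+y\<in>E. ennreal (den (c + m * fst y, d - snd y) powr (-p)) \<partial>lborel)
     \<le> (\<integral>\<^sup>+y. G (c + m * fst y, d - snd y) * indicator S_plus_period y + 3 * indicator E y \<partial>lborel)"
    using sub far by (intro nn_integral_mono) (auto simp: indicator_def)
  also have "\<dots> = (\<integral>\<^sup>+y\<in>S_plus_period. G (c + m * fst y, d - snd y) \<partial>lborel) + 3 * emeasure lborel E"
    by (simp add: nn_integral_add nn_integral_cmult_indicator)
  also have "(\<integral>\<^sup>+y\<in>S_plus_period. G (c + m * fst y, d - snd y) \<partial>lborel)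
     = (\<integral>\<^sup>+s\<in>{0<..}. (\<integral>\<^sup>+\<theta>\<in>{-pi..<pi}. G (c + m * s, \<theta>) \<partial>lborel) \<partial>lborel)"
  proof (rule nn_integral_half_cylinder)
    show "G (s, \<theta> + of_int k * (2 * pi)) = G (s, \<theta>)" for s \<theta> and k :: int
      using cos.plus_of_int[of \<theta> k] by (simp add: G_def den_def mult_ac)
  qed measurable
  also have "\<dots> \<le> (\<integral>\<^sup>+s. (\<integral>\<^sup>+\<theta>\<in>{-pi..<pi}. G (c + m * s, \<theta>) \<partial>lborel) \<partial>lborel)"
    by (intro nn_integral_mono) (auto simp: indicator_def)
  also have "\<dots> = (\<integral>\<^sup>+s. (\<integral>\<^sup>+\<theta>\<in>{-pi..<pi}. G (s, \<theta>) \<partial>lborel) \<partial>lborel)"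
    using m by (subst (2) nn_integral_real_affine[where c = m and t = c]) (auto simp: abs_if split: if_splits)
  also have "\<dots> \<le> (\<integral>\<^sup>+s. ennreal (4 * pi) * (ennreal (\<bar>s\<bar> powr (-p)) * indicator {-1..1} s) \<partial>lborel)"
  proof (rule nn_integral_mono_AE)
    have "AE s in lborel. s \<noteq> (0::real)" by (rule AE_lborel_singleton)
    thus "AE s in lborel. (\<integral>\<^sup>+\<theta>\<in>{-pi..<pi}. G (s, \<theta>) \<partial>lborel)
       \<le> ennreal (4 * pi) * (ennreal (\<bar>s\<bar> powr (-p)) * indicator {-1..1} s)"
    proof eventually_elim
      case (elim s)
      show ?case
      proof (cases "s \<in> {-1..1}")
        case True
        have "(\<integral>\<^sup>+\<theta>\<in>{-pi..<pi}. G (s, \<theta>) \<partial>lborel) \<le> ennreal (4 * pi * \<bar>s\<bar> powr (-p))"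
          using nn_integral_den_powr_slice[OF elim p(1)] p True by (simp add: G_def)
        thus ?thesis using True by (simp add: ennreal_mult)
      qed (simp add: G_def)
    qed
  qed
  also have "\<dots> = ennreal (4 * pi) * (\<integral>\<^sup>+s\<in>{-1..1}. ennreal (\<bar>s\<bar> powr (-p)) \<partial>lborel)"
    by (rule nn_integral_cmult) measurable
  also have "\<dots> \<le> ennreal (4 * pi) * ennreal (2 / (1 - p))"
    using p by (intro mult_left_mono nn_integral_abs_powr) auto
  also have "\<dots> = ennreal (8 * pi / (1 - p))" using p by (simp flip: ennreal_mult)
  finally show ?thesis by (simp add: add_right_mono)
qed


section \<open>The velocity of a patch\<close>

text \<open>For \<open>m = -1\<close> this is the displacement of \<open>x\<close> from
  \<open>y\<close>, for \<open>m = 1\<close> its displacement from the mirror image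
  \<open>(- fst y, snd y)\<close>. One parameter lets each estimate serve both halves of
  \<open>K\<close>.\<close>

definition conj_sum :: "real \<Rightarrow> real \<times> real \<Rightarrow> real \<times> real \<Rightarrow> real \<times> real" where
  "conj_sum m x y = (fst x + m * fst y, snd x - snd y)"

lemma K_conj_sum: "K x y = K_S (conj_sum (-1) x y) - K_S (conj_sum 1 x y)"
  by (simp add: K_def conj_sum_def minus_prod_def plus_prod_def)

lemma conj_sum_diff: "conj_sum m x y - conj_sum m x' y = x - x'"
  by (simp add: conj_sum_def prod_eq_iff)

lemma continuous_on_conj_sum:
  "continuous_on S f \<Longrightarrow> continuous_on S g \<Longrightarrow> continuous_on S (\<lambda>x. conj_sum m (f x) (g x))"
  unfolding conj_sum_def by (intro continuous_intros)

lemma borel_measurable_conj_sum [measurable]: "conj_sum m x \<in> borel_measurable borel"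
  by (intro borel_measurable_continuous_onI continuous_on_conj_sum continuous_intros)

lemma borel_measurable_K_S [measurable]: "K_S \<in> borel_measurable borel"
proof -
  have c: "sin \<circ> snd \<in> borel_measurable (borel :: (real \<times> real) measure)"
    "sinh \<circ> fst \<in> borel_measurable (borel :: (real \<times> real) measure)"
    unfolding o_def by (intro borel_measurable_continuous_onI continuous_intros)+
  have "(\<lambda>z. ((sin \<circ> snd) z / (4 * pi * den z), - (sinh \<circ> fst) z / (4 * pi * den z))) \<in> borel_measurable borel"
    using c by measurable
  thus ?thesis unfolding K_S_def den_def o_def by simp
qed

lemma borel_measurable_K [measurable]: "K x \<in> borel_measurable borel"
  unfolding K_conj_sum[abs_def] by measurable

lemma AE_lborel_fst_neq: "AE y :: real \<times> real in lborel. fst y \<noteq> c"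
proof -
  have "negligible {y :: real \<times> real. y \<bullet> (1, 0) = c}"
    by (rule negligible_standard_hyperplane) (auto simp: Basis_prod_def)
  moreover have "{y :: real \<times> real. y \<bullet> (1, 0) = c} = {y. fst y = c}" by (auto simp: inner_prod_def)
  moreover have "closed {y :: real \<times> real. fst y = c}" by (intro closed_Collect_eq continuous_intros)
  ultimately have "{y :: real \<times> real. fst y = c} \<in> null_sets lborel"
    by (simp add: negligible_iff_null_sets null_sets_completion_iff borel_closed)
  thus ?thesis by (rule AE_I') auto
qed

lemma AE_den_conj_sum_pos:
  assumes "\<bar>m\<bar> = 1"
  shows "AE y in lborel. den (conj_sum m x y) > 0"
  using AE_lborel_fst_neq[of "- m * fst x"]
proof eventually_elim
  case (elim y)
  have "m * m = 1" using assms by (metis abs_mult_self mult_1)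
  hence "fst x + m * fst y \<noteq> 0" using elim
    by (metis add.commute add_eq_0_iff minus_mult_minus mult.assoc mult_1 mult_minus_left)
  thus ?case by (intro den_pos) (simp add: conj_sum_def)
qed

lemma exp_minus_at_top: "((\<lambda>s. exp (- s :: real)) \<longlongrightarrow> 0) at_top"
  by (rule filterlim_compose[OF exp_at_bot filterlim_uminus_at_bot_at_top])

text \<open>One period of the patch at a frozen time, reduced to what survives the evolution:
  measurability and area.\<close>

locale vorticity_set =
  fixes E :: "(real \<times> real) set" and a :: real
  assumes E [measurable]: "E \<in> sets borel" and sub: "E \<subseteq> S_plus_period"
    and area: "emeasure lborel E = ennreal a" and a_nonneg: "0 \<le> a"
begin

definition vel :: "real \<times> real \<Rightarrow> real \<times> real" where
  "vel x = (LINT y:E|lborel. K x y)"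

text \<open>Twice \<open>7 * a + 32 * pi\<close>, once for the kernel and once for its image. With
  \<open>1 - p = e / 2\<close> the term \<open>16 * pi / (1 - p)\<close> becomes
  \<open>32 * pi / e\<close>.\<close>

definition C :: real where "C = 14 * a + 64 * pi"

lemma C_pos: "C > 0" using a_nonneg by (simp add: C_def add_nonneg_pos)

lemma nn_integral_two_den_powr:
  assumes m: "\<bar>m\<bar> = 1" "\<bar>m'\<bar> = 1" and p: "0 < p" "p < 1"
  shows "(\<integral>\<^sup>+y\<in>E. ennreal (1 + den (conj_sum m x y) powr (-p) + den (conj_sum m' x' y) powr (-p)) \<partial>lborel)
    \<le> ennreal (7 * a + 16 * pi / (1 - p))"
proof -
  have one: "(\<integral>\<^sup>+y\<in>E. ennreal (den (conj_sum m x y) powr (-p)) \<partial>lborel) \<le> ennreal (8 * pi / (1 - p) + 3 * a)"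
    if "\<bar>m\<bar> = 1" for m x
  proof -
    have "ennreal (8 * pi / (1 - p)) + 3 * emeasure lborel E = ennreal (8 * pi / (1 - p) + 3 * a)"
      using p a_nonneg by (simp add: area ennreal_mult ennreal_plus)
    thus ?thesis using nn_integral_den_powr[OF E sub that p, of "fst x" "snd x"] by (simp add: conj_sum_def)
  qed
  have "(\<integral>\<^sup>+y\<in>E. ennreal (1 + den (conj_sum m x y) powr (-p) + den (conj_sum m' x' y) powr (-p)) \<partial>lborel)
      = (\<integral>\<^sup>+y. indicator E y + ennreal (den (conj_sum m x y) powr (-p)) * indicator E y
            + ennreal (den (conj_sum m' x' y) powr (-p)) * indicator E y \<partial>lborel)"
    by (intro nn_integral_cong) (auto simp: indicator_def ennreal_plus)
  also have "\<dots> = emeasure lborel E + (\<integral>\<^sup>+y\<in>E. ennreal (den (conj_sum m x y) powr (-p)) \<partial>lborel)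
      + (\<integral>\<^sup>+y\<in>E. ennreal (den (conj_sum m' x' y) powr (-p)) \<partial>lborel)"
    by (simp add: nn_integral_add)
  also have "\<dots> \<le> ennreal a + ennreal (8 * pi / (1 - p) + 3 * a) + ennreal (8 * pi / (1 - p) + 3 * a)"
    using one m area by (intro add_mono) auto
  also have "\<dots> = ennreal (7 * a + 16 * pi / (1 - p))"
    using p a_nonneg by (simp flip: ennreal_plus)
  finally show ?thesis .
qed

lemma nn_integral_norm_K_S:
  assumes m: "\<bar>m\<bar> = 1"
  shows "(\<integral>\<^sup>+y\<in>E. ennreal (norm (K_S (conj_sum m x y))) \<partial>lborel) \<le> ennreal (C / 2)"
proof -
  have "(\<integral>\<^sup>+y\<in>E. ennreal (norm (K_S (conj_sum m x y))) \<partial>lborel)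
     \<le> (\<integral>\<^sup>+y\<in>E. ennreal (1 + den (conj_sum m x y) powr (-(1/2)) + den (conj_sum m x y) powr (-(1/2))) \<partial>lborel)"
  proof (rule nn_integral_mono_AE)
    show "AE y in lborel. ennreal (norm (K_S (conj_sum m x y))) * indicator E y
       \<le> ennreal (1 + den (conj_sum m x y) powr (-(1/2)) + den (conj_sum m x y) powr (-(1/2))) * indicator E y"
      using AE_den_conj_sum_pos[OF m, of x]
    proof eventually_elim
      case (elim y)
      let ?q = "1 + 2 * den (conj_sum m x y) powr (-(1/2))"
      have "norm (K_S (conj_sum m x y)) \<le> ?q / (4 * pi)" by (rule norm_K_S_le[OF elim])
      also have "\<dots> \<le> ?q / 1" using pi_gt3 by (intro divide_left_mono) auto
      finally show ?case by (intro mult_right_mono ennreal_leI) auto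
    qed
  qed
  also have "\<dots> \<le> ennreal (7 * a + 16 * pi / (1 - 1/2))" using m by (intro nn_integral_two_den_powr) auto
  also have "7 * a + 16 * pi / (1 - 1/2) = C / 2" by (simp add: C_def field_simps)
  finally show ?thesis .
qed

lemma integrable_K_S:
  assumes "\<bar>m\<bar> = 1"
  shows "integrable lborel (\<lambda>y. indicator E y *\<^sub>R K_S (conj_sum m x y))"
proof (rule integrableI_bounded)
  have "(\<integral>\<^sup>+y. ennreal (norm (indicator E y *\<^sub>R K_S (conj_sum m x y))) \<partial>lborel)
      = (\<integral>\<^sup>+y\<in>E. ennreal (norm (K_S (conj_sum m x y))) \<partial>lborel)"
    by (intro nn_integral_cong) (auto simp: indicator_def)
  also have "\<dots> < \<infinity>" using nn_integral_norm_K_S[OF assms, of x] by (simp add: order_le_less_trans)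
  finally show "(\<integral>\<^sup>+y. ennreal (norm (indicator E y *\<^sub>R K_S (conj_sum m x y))) \<partial>lborel) < \<infinity>" .
qed measurable

lemma integrable_K: "integrable lborel (\<lambda>y. indicator E y *\<^sub>R K x y)"
  unfolding K_conj_sum scaleR_diff_right
  by (intro Bochner_Integration.integrable_diff integrable_K_S) auto

lemma norm_vel_le: "norm (vel x) \<le> C"
proof -
  have "ennreal (norm (vel x)) \<le> (\<integral>\<^sup>+y. ennreal (norm (indicator E y *\<^sub>R K x y)) \<partial>lborel)"
    unfolding vel_def set_lebesgue_integral_def by (rule integral_norm_bound_ennreal[OF integrable_K])
  also have "\<dots> \<le> (\<integral>\<^sup>+y. ennreal (norm (K_S (conj_sum (-1) x y))) * indicator E y
       + ennreal (norm (K_S (conj_sum 1 x y))) * indicator E y \<partial>lborel)"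
    by (intro nn_integral_mono)
       (auto simp: indicator_def K_conj_sum norm_triangle_ineq4 ennreal_leI simp flip: ennreal_plus)
  also have "\<dots> \<le> ennreal (C / 2) + ennreal (C / 2)"
    by (subst nn_integral_add) (auto intro!: add_mono nn_integral_norm_K_S)
  also have "\<dots> = ennreal C" using C_pos by (simp flip: ennreal_plus)
  finally show ?thesis using C_pos by simp
qed

text \<open>The exponent \<open>p = 1 - e / 2\<close> turns the integrability factor
  \<open>1 / (1 - p)\<close> into \<open>2 / e\<close>. The constant thus grows no faster than
  \<open>1 / e\<close> as \<open>e\<close> tends to 0, the rate that Osgood's argument
  tolerates.\<close>

lemma norm_vel_diff_le:
  assumes e: "0 < e" "e \<le> 1"
  shows "norm (vel x - vel x') \<le> C / e * norm (x - x') powr (1 - e)"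
proof -
  define p where "p = 1 - e / 2"
  define \<rho> where "\<rho> = norm (x - x') powr (1 - e)"
  have p: "0 < p" "p < 1" using e by (simp_all add: p_def)
  define T where "T m y = \<rho> * (1 + den (conj_sum m x y) powr (-p) + den (conj_sum m x' y) powr (-p))" for m y
  have piece: "(\<integral>\<^sup>+y\<in>E. ennreal (T m y) \<partial>lborel) \<le> ennreal (\<rho> * (7 * a + 32 * pi / e))" if "\<bar>m\<bar> = 1" for m
  proof -
    have "(\<integral>\<^sup>+y\<in>E. ennreal (T m y) \<partial>lborel)
       = ennreal \<rho> * (\<integral>\<^sup>+y\<in>E. ennreal (1 + den (conj_sum m x y) powr (-p) + den (conj_sum m x' y) powr (-p)) \<partial>lborel)"
      by (subst nn_integral_cmult[symmetric]) (auto simp: T_def \<rho>_def ennreal_mult mult_ac intro!: nn_integral_cong)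
    also have "\<dots> \<le> ennreal \<rho> * ennreal (7 * a + 16 * pi / (1 - p))"
      using that p by (intro mult_left_mono nn_integral_two_den_powr) auto
    also have "16 * pi / (1 - p) = 32 * pi / e" by (simp add: p_def)
    also have "ennreal \<rho> * ennreal (7 * a + 32 * pi / e) = ennreal (\<rho> * (7 * a + 32 * pi / e))"
      using e a_nonneg by (intro ennreal_mult[symmetric]) (auto simp: \<rho>_def)
    finally show ?thesis .
  qed
  have "vel x - vel x' = (\<integral>y. indicator E y *\<^sub>R (K x y - K x' y) \<partial>lborel)"
    unfolding vel_def set_lebesgue_integral_def scaleR_diff_right
    by (rule Bochner_Integration.integral_diff[symmetric]) (rule integrable_K)+
  also have "ennreal (norm \<dots>) \<le> (\<integral>\<^sup>+y. ennreal (norm (indicator E y *\<^sub>R (K x y - K x' y))) \<partial>lborel)"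
    unfolding scaleR_diff_right
    by (intro integral_norm_bound_ennreal Bochner_Integration.integrable_diff integrable_K)
  also have "\<dots> \<le> (\<integral>\<^sup>+y. ennreal (T (-1) y) * indicator E y + ennreal (T 1 y) * indicator E y \<partial>lborel)"
  proof (rule nn_integral_mono_AE)
    have "AE y in lborel. den (conj_sum (-1) x y) > 0" "AE y in lborel. den (conj_sum 1 x y) > 0"
      "AE y in lborel. den (conj_sum (-1) x' y) > 0" "AE y in lborel. den (conj_sum 1 x' y) > 0"
      by (intro AE_den_conj_sum_pos; simp)+
    thus "AE y in lborel. ennreal (norm (indicator E y *\<^sub>R (K x y - K x' y)))
        \<le> ennreal (T (-1) y) * indicator E y + ennreal (T 1 y) * indicator E y"
    proof eventually_elim
      case (elim y)
      have "K x y - K x' y = (K_S (conj_sum (-1) x y) - K_S (conj_sum (-1) x' y))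
           - (K_S (conj_sum 1 x y) - K_S (conj_sum 1 x' y))" by (simp add: K_conj_sum)
      hence "norm (K x y - K x' y) \<le> norm (K_S (conj_sum (-1) x y) - K_S (conj_sum (-1) x' y))
           + norm (K_S (conj_sum 1 x y) - K_S (conj_sum 1 x' y))" by (metis norm_triangle_ineq4)
      also have "\<dots> \<le> T (-1) y + T 1 y"
        using norm_K_S_diff_le[OF elim(1,3) e] norm_K_S_diff_le[OF elim(2,4) e]
        by (intro add_mono) (simp_all add: T_def p_def \<rho>_def conj_sum_diff)
      finally have "ennreal (norm (K x y - K x' y)) \<le> ennreal (T (-1) y) + ennreal (T 1 y)"
        by (simp add: T_def \<rho>_def ennreal_leI flip: ennreal_plus)
      thus ?case by (auto simp: indicator_def)
    qed
  qed
  also have "\<dots> = (\<integral>\<^sup>+y\<in>E. ennreal (T (-1) y) \<partial>lborel) + (\<integral>\<^sup>+y\<in>E. ennreal (T 1 y) \<partial>lborel)"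
    unfolding T_def by (rule nn_integral_add) measurable
  also have "\<dots> \<le> ennreal (\<rho> * (7 * a + 32 * pi / e)) + ennreal (\<rho> * (7 * a + 32 * pi / e))"
    by (intro add_mono piece) auto
  also have "\<dots> = ennreal (2 * (\<rho> * (7 * a + 32 * pi / e)))"
    using e a_nonneg by (simp add: \<rho>_def flip: ennreal_plus)
  also have "\<dots> \<le> ennreal (C / e * \<rho>)"
  proof (rule ennreal_leI)
    have "7 * a * e \<le> 7 * a * 1" using e a_nonneg by (intro mult_left_mono) auto
    hence "7 * a \<le> 7 * a / e" using e by (subst pos_le_divide_eq) simp_all
    hence "7 * a + 32 * pi / e \<le> (7 * a + 32 * pi) / e" by (simp add: add_divide_distrib)
    hence "\<rho> * (7 * a + 32 * pi / e) \<le> \<rho> * ((7 * a + 32 * pi) / e)" by (intro mult_left_mono) (auto simp: \<rho>_def)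
    moreover have "2 * (\<rho> * ((7 * a + 32 * pi) / e)) = C / e * \<rho>" by (simp add: C_def algebra_simps add_divide_distrib)
    ultimately show "2 * (\<rho> * (7 * a + 32 * pi / e)) \<le> C / e * \<rho>" by linarith
  qed
  finally show ?thesis using C_pos e by (simp add: \<rho>_def)
qed

text \<open>The first component of \<open>K_S\<close> is even in the first coordinate, so at a wall
  point a vortex and its mirror image cancel in that component.\<close>

lemma fst_vel_wall: "fst (vel (0, d)) = 0"
proof -
  have "fst (vel (0, d)) = (\<integral>y. fst (indicator E y *\<^sub>R K (0, d) y) \<partial>lborel)"
    unfolding vel_def set_lebesgue_integral_def
    by (rule integral_bounded_linear[OF bounded_linear_fst integrable_K, symmetric])
  also have "\<dots> = 0" by (simp add: K_conj_sum conj_sum_def K_S_def)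
  finally show ?thesis .
qed

lemma vel_shift: "vel (fst x, snd x + of_int k * (2 * pi)) = vel x"
proof -
  have "K (fst x, snd x + of_int k * (2 * pi)) y = K x y" for y
  proof -
    have eq: "snd x + of_int k * (2 * pi) - snd y = (snd x - snd y) + of_int k * (2 * pi)" by (simp add: algebra_simps)
    have "sin (snd x + of_int k * (2 * pi) - snd y) = sin (snd x - snd y)"
      "cos (snd x + of_int k * (2 * pi) - snd y) = cos (snd x - snd y)"
      unfolding eq using sin.plus_of_int[of "snd x - snd y" k] cos.plus_of_int[of "snd x - snd y" k] by simp_all
    thus ?thesis by (simp only: K_conj_sum K_S_def conj_sum_def fst_conv snd_conv)
  qed
  thus ?thesis by (simp add: vel_def)
qed

lemma continuous_on_vel: "continuous_on UNIV vel"
proof -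
  have "(vel \<longlongrightarrow> vel x) (at x)" for x
  proof -
    have "((\<lambda>y. 2 * C * sqrt (norm (y - x))) \<longlongrightarrow> 2 * C * sqrt (norm (x - x))) (at x)"
      by (intro tendsto_intros)
    hence lim: "((\<lambda>y. 2 * C * sqrt (norm (y - x))) \<longlongrightarrow> 0) (at x)" by simp
    have bd: "norm (vel y - vel x) \<le> 2 * C * sqrt (norm (y - x))" for y
    proof -
      have "norm (vel y - vel x) \<le> C / (1/2) * norm (y - x) powr (1 - 1/2)"
        by (rule norm_vel_diff_le) simp_all
      moreover have "norm (y - x) powr (1 - 1/2) = sqrt (norm (y - x))"
        using powr_half_sqrt[of "norm (y - x)"] by simp
      ultimately show ?thesis by (simp only:) simp
    qed
    have "((\<lambda>y. vel y - vel x) \<longlongrightarrow> 0) (at x)"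
      by (rule Lim_null_comparison[OF always_eventually lim]) (use bd in blast)
    thus ?thesis by (simp add: LIM_zero_iff)
  qed
  thus ?thesis by (simp add: continuous_on_def)
qed

lemma borel_measurable_vel [measurable]: "vel \<in> borel_measurable borel"
  by (rule borel_measurable_continuous_onI[OF continuous_on_vel])

section \<open>Lower bound for the velocity along the wall\<close>

lemma exp_plus_one_neq_0: "exp x + 1 \<noteq> (0 :: real)"
  using exp_gt_zero[of x] by linarith

text \<open>The integrand is \<open>1 - tanh (s / 2)\<close> at \<open>s = fst y\<close>, the
  largest possible shortfall of the normalised wall kernel from its limit 1. Its radial integral is
  \<open>2 * ln 2\<close>, and the angle contributes \<open>2 * pi\<close>.\<close>

lemma nn_integral_wall_tail:
  "(\<integral>\<^sup>+y\<in>S_plus_period. ennreal (2 / (exp (fst y) + 1)) \<partial>lborel) \<le> ennreal (4 * pi * ln 2)"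
proof -
  define F where "F s = - 2 * ln (1 + exp (-s))" for s :: real
  have D: "(F has_real_derivative 2 / (exp s + 1)) (at s)" for s
  proof -
    have "1 + exp (-s) > 0" by (simp add: add_pos_pos)
    hence "(F has_real_derivative - 2 * (- exp (-s) / (1 + exp (-s)))) (at s)"
      unfolding F_def by (auto intro!: derivative_eq_intros)
    also have "- 2 * (- exp (-s) / (1 + exp (-s))) = 2 / (exp s + 1)"
    proof -
      have "- 2 * (- (1 / q) / (1 + 1 / q)) = 2 / (q + 1)" if "q > 0" for q :: real
        using that by (simp add: divide_simps)
      from this[of "exp s"] show ?thesis by (simp add: exp_minus inverse_eq_divide)
    qed
    finally show ?thesis .
  qed
  have lim: "(F \<longlongrightarrow> 0) at_top" unfolding F_def
    by (rule tendsto_eq_intros exp_minus_at_top refl | simp)+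
  have m: "(\<lambda>z. ennreal (2 / (exp (fst z) + 1))) \<in> borel_measurable (borel :: (real \<times> real) measure)"
    by (intro measurable_compose[OF _ measurable_ennreal] borel_measurable_continuous_onI continuous_intros)
       (simp add: exp_plus_one_neq_0)
  have "(\<integral>\<^sup>+y\<in>S_plus_period. ennreal (2 / (exp (fst y) + 1)) \<partial>lborel)
     = (\<integral>\<^sup>+s\<in>{0<..}. (\<integral>\<^sup>+\<theta>\<in>{-pi..<pi}. ennreal (2 / (exp s + 1)) \<partial>lborel) \<partial>lborel)"
    using nn_integral_half_cylinder[OF m, of 0 1 0] by simp
  also have "\<dots> \<le> (\<integral>\<^sup>+s. ennreal (2 * pi) * (ennreal (2 / (exp s + 1)) * indicator {0..} s) \<partial>lborel)"
  proof (rule nn_integral_mono)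
    fix s :: real
    have "(\<integral>\<^sup>+\<theta>\<in>{-pi..<pi}. ennreal (2 / (exp s + 1)) \<partial>lborel) = ennreal (2 * pi) * ennreal (2 / (exp s + 1))"
      by (subst nn_integral_cmult_indicator) (simp_all add: mult.commute)
    thus "(\<integral>\<^sup>+\<theta>\<in>{-pi..<pi}. ennreal (2 / (exp s + 1)) \<partial>lborel) * indicator {0<..} s
        \<le> ennreal (2 * pi) * (ennreal (2 / (exp s + 1)) * indicator {0..} s)"
      by (auto simp: indicator_def)
  qed
  also have "\<dots> = ennreal (2 * pi) * (\<integral>\<^sup>+s\<in>{0..}. ennreal (2 / (exp s + 1)) \<partial>lborel)"
    by (rule nn_integral_cmult) measurable
  also have "(\<integral>\<^sup>+s\<in>{0..}. ennreal (2 / (exp s + 1)) \<partial>lborel) = ennreal (0 - F 0)"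
    by (rule nn_integral_FTC_atLeast[OF _ D _ lim]) (auto simp: add_nonneg_nonneg)
  also have "0 - F 0 = 2 * ln 2" by (simp add: F_def)
  also have "ennreal (2 * pi) * ennreal (2 * ln 2) = ennreal (4 * pi * ln 2)" by (simp flip: ennreal_mult)
  finally show ?thesis .
qed

text \<open>On the wall a vortex and its image contribute equally to the tangential velocity, whence
  \<open>2 * pi\<close> in place of \<open>4 * pi\<close>. The kernel is smallest at the opposite
  angle, where \<open>cos \<theta> = -1\<close> and it becomes \<open>tanh (s / 2)\<close>; the
  shortfall from 1 is integrated over the whole half cylinder, so that the position of
  \<open>E\<close> does not matter.\<close>

lemma snd_vel_wall_ge: "snd (vel (0, d)) \<ge> a / (2 * pi) - 2 * ln 2"
proof -
  have snd_K: "snd (K (0, d) y) \<ge> (1 - 2 / (exp (fst y) + 1)) / (2 * pi)" if "y \<in> E" for y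
  proof -
    have y: "fst y > 0" using that sub by (auto simp: S_plus_def)
    define s \<theta> where "s = fst y" and "\<theta> = d - snd y"
    have dpos: "cosh s - cos \<theta> > 0" using den_pos[of "(s, \<theta>)"] y by (simp add: den_def s_def)
    have eq: "snd (K (0, d) y) = sinh s / (cosh s - cos \<theta>) / (2 * pi)"
      using dpos by (simp add: K_conj_sum conj_sum_def K_S_def s_def[symmetric] \<theta>_def[symmetric] divide_simps)
    have "1 - 2 / (exp s + 1) = sinh s / (cosh s + 1)"
    proof -
      define q where "q = exp s"
      have q: "q > 0" "exp (-s) = 1 / q" by (simp_all add: q_def exp_minus field_simps)
      have "sinh s = (q - 1) * (q + 1) / (2 * q)" "cosh s + 1 = (q + 1) * (q + 1) / (2 * q)"
        using q by (simp_all add: sinh_def cosh_def q_def[symmetric] field_simps)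
      moreover have "(q - 1) * (q + 1) / (2 * q) / ((q + 1) * (q + 1) / (2 * q)) = 1 - 2 / (q + 1)"
        using q by (simp add: divide_simps)
      ultimately show ?thesis unfolding q_def[symmetric] by (simp only:)
    qed
    also have "\<dots> \<le> sinh s / (cosh s - cos \<theta>)"
      using dpos y cos_ge_minus_one[of \<theta>] by (intro divide_left_mono mult_pos_pos) (auto simp: s_def add_pos_pos)
    finally show ?thesis unfolding eq s_def by (intro divide_right_mono) auto
  qed
  have int_one: "integrable lborel (\<lambda>y. indicator E y :: real)"
    using area by (simp add: integrable_indicator_iff)
  have int_h: "integrable lborel (\<lambda>y. indicator E y * (2 / (exp (fst y) + 1)) :: real)"
  proof (rule Bochner_Integration.integrable_bound[OF int_one])
    have "(\<lambda>y :: real \<times> real. 2 / (exp (fst y) + 1)) \<in> borel_measurable borel"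
      by (intro borel_measurable_continuous_onI continuous_intros) (simp add: exp_plus_one_neq_0)
    thus "(\<lambda>y. indicator E y * (2 / (exp (fst y) + 1)) :: real) \<in> borel_measurable lborel" by measurable
    show "AE y in lborel. norm (indicator E y * (2 / (exp (fst y) + 1)) :: real) \<le> norm (indicator E y :: real)"
    proof (intro AE_I2)
      fix y
      have "2 / (exp (fst y) + 1) \<le> 1" if "y \<in> E"
        using that sub one_le_exp_iff[of "fst y"] by (subst divide_le_eq_1_pos) (auto simp: S_plus_def add_pos_pos)
      thus "norm (indicator E y * (2 / (exp (fst y) + 1)) :: real) \<le> norm (indicator E y :: real)"
        by (auto simp: indicator_def)
    qed
  qed
  have tail: "(\<integral>y. indicator E y * (2 / (exp (fst y) + 1)) \<partial>lborel) \<le> 4 * pi * ln 2"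
  proof (rule integral_real_bounded)
    have "(\<integral>\<^sup>+y. ennreal (indicator E y * (2 / (exp (fst y) + 1))) \<partial>lborel)
       \<le> (\<integral>\<^sup>+y\<in>S_plus_period. ennreal (2 / (exp (fst y) + 1)) \<partial>lborel)"
      using sub by (intro nn_integral_mono) (auto simp: indicator_def)
    thus "(\<integral>\<^sup>+y. ennreal (indicator E y * (2 / (exp (fst y) + 1))) \<partial>lborel) \<le> ennreal (4 * pi * ln 2)"
      using nn_integral_wall_tail by (rule order_trans)
  qed simp
  have "a / (2 * pi) - 2 * ln 2 = (a - 4 * pi * ln 2) / (2 * pi)" by (simp add: field_simps)
  also have "\<dots> \<le> (a - (\<integral>y. indicator E y * (2 / (exp (fst y) + 1)) \<partial>lborel)) / (2 * pi)"
    using tail by (intro divide_right_mono) auto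
  also have "\<dots> = (\<integral>y. (indicator E y - indicator E y * (2 / (exp (fst y) + 1))) / (2 * pi) \<partial>lborel)"
    using int_one int_h area a_nonneg by (simp add: measure_def)
  also have "\<dots> \<le> (\<integral>y. snd (indicator E y *\<^sub>R K (0, d) y) \<partial>lborel)"
  proof (rule integral_mono)
    show "integrable lborel (\<lambda>y. (indicator E y - indicator E y * (2 / (exp (fst y) + 1))) / (2 * pi))"
      using int_one int_h by simp
    show "integrable lborel (\<lambda>y. snd (indicator E y *\<^sub>R K (0, d) y))"
      by (rule integrable_bounded_linear[OF bounded_linear_snd integrable_K])
    show "(indicator E y - indicator E y * (2 / (exp (fst y) + 1))) / (2 * pi) \<le> snd (indicator E y *\<^sub>R K (0, d) y)" for y
      using snd_K[of y] by (auto simp: indicator_def)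
  qed
  also have "\<dots> = snd (vel (0, d))"
    unfolding vel_def set_lebesgue_integral_def
    by (rule integral_bounded_linear[OF bounded_linear_snd integrable_K])
  finally show ?thesis .
qed

end

section \<open>Upper bound for the mean velocity of a patch\<close>

lemma sinh_over_cosh_minus_one: "sinh s / (cosh s - 1) = 1 + 2 / (exp s - 1)" if "s > 0" for s :: real
proof -
  define q where "q = exp s"
  have q: "q > 1" "exp (-s) = 1 / q" using that by (simp_all add: q_def exp_minus field_simps)
  have "sinh s = (q - 1) * (q + 1) / (2 * q)" "cosh s - 1 = (q - 1) * (q - 1) / (2 * q)"
    using q by (simp_all add: sinh_def cosh_def q_def[symmetric] field_simps)
  moreover have "(q - 1) * (q + 1) / (2 * q) / ((q - 1) * (q - 1) / (2 * q)) = 1 + 2 / (q - 1)"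
    using q by (simp add: divide_simps)
  ultimately show ?thesis unfolding q_def[symmetric] by (simp only:)
qed

text \<open>The factor \<open>2 / (exp s - 1)\<close> is \<open>coth (s / 2) - 1\<close>, the
  largest excess of the image kernel over its limit. It behaves like \<open>2 / s\<close> at 0 and
  is not integrable there, hence the cut at 1; the value of the antiderivative at the cut is the
  origin of \<open>ln (1 - exp (-1))\<close>.\<close>

lemma nn_integral_image_tail:
  "(\<integral>\<^sup>+y\<in>S_plus_period. ennreal (2 / (exp (fst y) - 1)) * indicator {1..} (fst y) \<partial>lborel)
     \<le> ennreal (4 * pi * (- ln (1 - exp (-1))))"
proof -
  define F where "F s = 2 * ln (1 - exp (-s))" for s :: real
  have D: "(F has_real_derivative 2 / (exp s - 1)) (at s)" if "1 \<le> s" for s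
  proof -
    have "1 - exp (-s) > 0" using that by simp
    hence "(F has_real_derivative 2 * (exp (-s) / (1 - exp (-s)))) (at s)"
      unfolding F_def by (auto intro!: derivative_eq_intros)
    also have "2 * (exp (-s) / (1 - exp (-s))) = 2 / (exp s - 1)"
    proof -
      have "2 * ((1 / q) / (1 - 1 / q)) = 2 / (q - 1)" if "q > 1" for q :: real
        using that by (simp add: divide_simps)
      from this[of "exp s"] that show ?thesis by (simp add: exp_minus inverse_eq_divide)
    qed
    finally show ?thesis .
  qed
  have lim: "(F \<longlongrightarrow> 0) at_top" unfolding F_def
    by (rule tendsto_eq_intros exp_minus_at_top refl | simp)+
  have m: "(\<lambda>z. ennreal (2 / (exp (fst z) - 1)) * indicator {1..} (fst z)) \<in> borel_measurable (borel :: (real \<times> real) measure)"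
    unfolding borel_prod[symmetric] by measurable
  have "(\<integral>\<^sup>+y\<in>S_plus_period. ennreal (2 / (exp (fst y) - 1)) * indicator {1..} (fst y) \<partial>lborel)
     = (\<integral>\<^sup>+s\<in>{0<..}. (\<integral>\<^sup>+\<theta>\<in>{-pi..<pi}. ennreal (2 / (exp s - 1)) * indicator {1..} s \<partial>lborel) \<partial>lborel)"
    using nn_integral_half_cylinder[OF m, of 0 1 0] by simp
  also have "\<dots> \<le> (\<integral>\<^sup>+s. ennreal (2 * pi) * (ennreal (2 / (exp s - 1)) * indicator {1..} s) \<partial>lborel)"
  proof (rule nn_integral_mono)
    fix s :: real
    have "(\<integral>\<^sup>+\<theta>\<in>{-pi..<pi}. ennreal (2 / (exp s - 1)) * indicator {1..} s \<partial>lborel)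
       = ennreal (2 * pi) * (ennreal (2 / (exp s - 1)) * indicator {1..} s)"
      by (subst nn_integral_cmult_indicator) (simp_all add: mult_ac)
    thus "(\<integral>\<^sup>+\<theta>\<in>{-pi..<pi}. ennreal (2 / (exp s - 1)) * indicator {1..} s \<partial>lborel) * indicator {0<..} s
        \<le> ennreal (2 * pi) * (ennreal (2 / (exp s - 1)) * indicator {1..} s)"
      by (auto simp: indicator_def)
  qed
  also have "\<dots> = ennreal (2 * pi) * (\<integral>\<^sup>+s\<in>{1..}. ennreal (2 / (exp s - 1)) \<partial>lborel)"
    by (rule nn_integral_cmult) measurable
  also have "(\<integral>\<^sup>+s\<in>{1..}. ennreal (2 / (exp s - 1)) \<partial>lborel) = ennreal (0 - F 1)"
    by (rule nn_integral_FTC_atLeast[OF _ D _ lim]) auto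
  also have "ennreal (2 * pi) * ennreal (0 - F 1) = ennreal (4 * pi * (- ln (1 - exp (-1))))"
    by (simp add: F_def mult.assoc flip: ennreal_mult)
  finally show ?thesis .
qed

text \<open>Close to the wall the maximum over the angle is too large to integrate when
  \<open>c = 0\<close>. Integrating over the angle instead gives a Poisson kernel at distance
  \<open>c + fst y\<close>, whose integral over a circle is at most \<open>2 * pi\<close> at every
  positive distance.\<close>

lemma nn_integral_image_near:
  assumes "0 \<le> c"
  shows "(\<integral>\<^sup>+y\<in>S_plus_period. ennreal (sinh (c + fst y) / den (conj_sum 1 (c, d) y)) * indicator {..<1} (fst y) \<partial>lborel)
     \<le> ennreal (2 * pi)"
proof -
  define G where "G z = ennreal (sinh (fst z) / den z) * indicator {..<c + 1} (fst z)" for z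
  have sinh_m: "(\<lambda>z. sinh (fst z)) \<in> borel_measurable (borel :: (real \<times> real) measure)"
    by (intro borel_measurable_continuous_onI continuous_intros)
  have ind_m: "(\<lambda>z. indicator {..<c + 1} (fst z) :: ennreal) \<in> borel_measurable (borel :: (real \<times> real) measure)"
    unfolding borel_prod[symmetric] by measurable
  have [measurable]: "G \<in> borel_measurable borel" unfolding G_def using sinh_m ind_m by measurable
  have "(\<integral>\<^sup>+y\<in>S_plus_period. ennreal (sinh (c + fst y) / den (conj_sum 1 (c, d) y)) * indicator {..<1} (fst y) \<partial>lborel)
     = (\<integral>\<^sup>+y\<in>S_plus_period. G (c + 1 * fst y, d - snd y) \<partial>lborel)"
    by (intro nn_integral_cong) (auto simp: G_def conj_sum_def indicator_def)
  also have "\<dots> = (\<integral>\<^sup>+s\<in>{0<..}. (\<integral>\<^sup>+\<theta>\<in>{-pi..<pi}. G (c + 1 * s, \<theta>) \<partial>lborel) \<partial>lborel)"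
  proof (rule nn_integral_half_cylinder)
    show "G (s, \<theta> + of_int k * (2 * pi)) = G (s, \<theta>)" for s \<theta> and k :: int
      using cos.plus_of_int[of \<theta> k] by (simp add: G_def den_def mult_ac)
  qed measurable
  also have "\<dots> \<le> (\<integral>\<^sup>+s. ennreal (2 * pi) * indicator {0..1::real} s \<partial>lborel)"
  proof (rule nn_integral_mono)
    fix s :: real
    show "(\<integral>\<^sup>+\<theta>\<in>{-pi..<pi}. G (c + 1 * s, \<theta>) \<partial>lborel) * indicator {0<..} s \<le> ennreal (2 * pi) * indicator {0..1} s"
    proof (cases "0 < s \<and> s < 1")
      case True
      have "(\<integral>\<^sup>+\<theta>\<in>{-pi..<pi}. G (c + 1 * s, \<theta>) \<partial>lborel)
         = (\<integral>\<^sup>+\<theta>\<in>{-pi..<pi}. ennreal (sinh (c + s) / (cosh (c + s) - cos \<theta>)) \<partial>lborel)"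
        using True by (simp add: G_def den_def)
      also have "\<dots> \<le> ennreal (2 * pi)" using True assms by (intro nn_integral_poisson_kernel) simp
      finally show ?thesis using True by simp
    qed (auto simp: G_def indicator_def)
  qed
  also have "\<dots> = ennreal (2 * pi)" by (subst nn_integral_cmult_indicator) auto
  finally show ?thesis .
qed

context vorticity_set
begin

text \<open>Beyond the cut at 1 the kernel splits into its limit 1, charged to the area of
  \<open>E\<close>, and an excess charged to the half cylinder; before the cut all of it is charged
  to the strip. Only the first charge grows with the patch.\<close>

lemma nn_integral_image_kernel_le:
  assumes c: "0 \<le> c"
  shows "(\<integral>\<^sup>+y\<in>E. ennreal (sinh (c + fst y) / den (conj_sum 1 (c, d) y)) \<partial>lborel)
     \<le> ennreal (a + 2 * pi + 4 * pi * (- ln (1 - exp (-1))))"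
proof -
  let ?k = "\<lambda>y. ennreal (sinh (c + fst y) / den (conj_sum 1 (c, d) y))"
  have "(\<lambda>y. sinh (c + fst y)) \<in> borel_measurable (borel :: (real \<times> real) measure)"
    by (intro borel_measurable_continuous_onI continuous_intros)
  hence km [measurable]: "?k \<in> borel_measurable borel" by measurable
  have ind_m [measurable]: "(\<lambda>z. indicator {..<1} (fst z) :: ennreal) \<in> borel_measurable (borel :: (real \<times> real) measure)"
    unfolding borel_prod[symmetric] by measurable
  have tm [measurable]: "(\<lambda>z. ennreal (2 / (exp (fst z) - 1)) * indicator {1..} (fst z)) \<in> borel_measurable (borel :: (real \<times> real) measure)"
    unfolding borel_prod[symmetric] by measurable
  have "(\<integral>\<^sup>+y\<in>E. ?k y \<partial>lborel) \<le> (\<integral>\<^sup>+y. (?k y * indicator {..<1} (fst y)) * indicator S_plus_period y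
      + (indicator E y + (ennreal (2 / (exp (fst y) - 1)) * indicator {1..} (fst y)) * indicator S_plus_period y) \<partial>lborel)"
  proof (rule nn_integral_mono)
    fix y
    show "?k y * indicator E y \<le> (?k y * indicator {..<1} (fst y)) * indicator S_plus_period y
      + (indicator E y + (ennreal (2 / (exp (fst y) - 1)) * indicator {1..} (fst y)) * indicator S_plus_period y)"
    proof (cases "y \<in> E")
      case True
      hence yS: "y \<in> S_plus_period" using sub by blast
      show ?thesis
      proof (cases "fst y < 1")
        case True
        thus ?thesis using yS by (auto simp: indicator_def intro: add_increasing2)
      next
        case False
        define s \<theta> where "s = c + fst y" and "\<theta> = d - snd y"
        have s: "s > 0" "fst y \<le> s" "fst y > 0" using False c by (simp_all add: s_def)
        have "sinh s / (cosh s - cos \<theta>) \<le> sinh s / (cosh s - 1)"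
        proof -
          have "cos \<theta> \<le> 1" "cosh s > 1" using s by (auto intro: cosh_gt_1)
          moreover from this have "cos \<theta> < cosh s" by linarith
          ultimately show ?thesis using s by (intro divide_left_mono mult_pos_pos) auto
        qed
        also have "\<dots> = 1 + 2 / (exp s - 1)" by (rule sinh_over_cosh_minus_one[OF s(1)])
        \<comment> \<open>The excess decreases with distance, so the observer may be moved to the
          wall; this removes \<open>c\<close> from the bound.\<close>
        also have "\<dots> \<le> 1 + 2 / (exp (fst y) - 1)"
          using s by (intro add_left_mono divide_left_mono mult_pos_pos) auto
        finally have "?k y \<le> ennreal (1 + 2 / (exp (fst y) - 1))"
          by (intro ennreal_leI) (simp add: s_def \<theta>_def conj_sum_def den_def)
        also have "\<dots> = 1 + ennreal (2 / (exp (fst y) - 1))" using s by (subst ennreal_plus) auto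
        finally show ?thesis using yS False \<open>y \<in> E\<close> by (simp add: indicator_def)
      qed
    qed simp
  qed
  also have "\<dots> = (\<integral>\<^sup>+y\<in>S_plus_period. ?k y * indicator {..<1} (fst y) \<partial>lborel)
      + (emeasure lborel E + (\<integral>\<^sup>+y\<in>S_plus_period. ennreal (2 / (exp (fst y) - 1)) * indicator {1..} (fst y) \<partial>lborel))"
    by (subst nn_integral_add, measurable, subst nn_integral_add) simp_all
  also have "\<dots> \<le> ennreal (2 * pi) + (ennreal a + ennreal (4 * pi * (- ln (1 - exp (-1)))))"
    using area by (intro add_mono nn_integral_image_near[OF c] nn_integral_image_tail) auto
  also have "\<dots> = ennreal (a + 2 * pi + 4 * pi * (- ln (1 - exp (-1))))"
  proof -
    define X where "X = 4 * pi * (- ln (1 - exp (-1 :: real)))"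
    have "0 \<le> X" by (simp add: X_def mult_nonneg_nonpos)
    hence "ennreal (2 * pi) + (ennreal a + ennreal X) = ennreal (2 * pi + (a + X))"
      using a_nonneg by (simp flip: ennreal_plus)
    also have "2 * pi + (a + X) = a + 2 * pi + X" by simp
    finally show ?thesis by (simp only: X_def)
  qed
  finally show ?thesis .
qed

lemma borel_measurable_K_S_conj_sum_pair:
  "(\<lambda>z. K_S (conj_sum m (fst z) (snd z))) \<in> borel_measurable (lborel \<Otimes>\<^sub>M lborel)"
proof -
  have "(\<lambda>z. conj_sum m (fst z) (snd z)) \<in> borel_measurable (borel :: ((real \<times> real) \<times> (real \<times> real)) measure)"
    by (intro borel_measurable_continuous_onI continuous_on_conj_sum continuous_intros)
  from measurable_compose[OF this borel_measurable_K_S]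
  show ?thesis by (simp add: lborel_prod)
qed

text \<open>Absolute integrability over pairs of points permits the exchange of integrations that
  cancels the antisymmetric part.\<close>

lemma integrable_K_S_pair:
  assumes "\<bar>m\<bar> = 1"
  shows "integrable (lborel \<Otimes>\<^sub>M lborel) (\<lambda>(x, y). indicator E x *\<^sub>R indicator E y *\<^sub>R K_S (conj_sum m x y))"
proof (rule integrableI_bounded)
  note [measurable] = borel_measurable_K_S_conj_sum_pair
  show m: "(\<lambda>(x, y). indicator E x *\<^sub>R indicator E y *\<^sub>R K_S (conj_sum m x y)) \<in> borel_measurable (lborel \<Otimes>\<^sub>M lborel)"
    unfolding case_prod_beta by measurable
  have "(\<integral>\<^sup>+z. ennreal (norm (case z of (x, y) \<Rightarrow> indicator E x *\<^sub>R indicator E y *\<^sub>R K_S (conj_sum m x y))) \<partial>(lborel \<Otimes>\<^sub>M lborel))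
     = (\<integral>\<^sup>+x. \<integral>\<^sup>+y. ennreal (norm (indicator E x *\<^sub>R indicator E y *\<^sub>R K_S (conj_sum m x y))) \<partial>lborel \<partial>lborel)"
    using m by (subst lborel.nn_integral_fst[symmetric]) auto
  also have "\<dots> \<le> (\<integral>\<^sup>+x. ennreal (C / 2) * indicator E x \<partial>lborel)"
  proof (rule nn_integral_mono)
    fix x
    show "(\<integral>\<^sup>+y. ennreal (norm (indicator E x *\<^sub>R indicator E y *\<^sub>R K_S (conj_sum m x y))) \<partial>lborel) \<le> ennreal (C / 2) * indicator E x"
    proof (cases "x \<in> E")
      case True
      have "(\<integral>\<^sup>+y. ennreal (norm (indicator E x *\<^sub>R indicator E y *\<^sub>R K_S (conj_sum m x y))) \<partial>lborel)
         = (\<integral>\<^sup>+y\<in>E. ennreal (norm (K_S (conj_sum m x y))) \<partial>lborel)"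
        using True by (intro nn_integral_cong) (auto simp: indicator_def)
      thus ?thesis using True nn_integral_norm_K_S[OF assms, of x] by simp
    qed simp
  qed
  also have "\<dots> = ennreal (C / 2) * ennreal a" by (simp add: nn_integral_cmult_indicator area)
  also have "\<dots> < \<infinity>" by (simp add: ennreal_mult_less_top)
  finally show "(\<integral>\<^sup>+z. ennreal (norm (case z of (x, y) \<Rightarrow> indicator E x *\<^sub>R indicator E y *\<^sub>R K_S (conj_sum m x y))) \<partial>(lborel \<Otimes>\<^sub>M lborel)) < \<infinity>" .
qed

text \<open>After the cancellation of the self-interaction each particle feels only the image, with
  weight \<open>1 / (4 * pi)\<close> per unit area at large distance. This is half the weight on the
  wall, and the difference of the two carries the theorem.\<close>

lemma integral_snd_vel_le:
  "(LINT x:E|lborel. snd (vel x)) \<le> a * (a / (4 * pi) + 1/2 - ln (1 - exp (-1)))"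
proof -
  define f where "f m x y = indicator E x *\<^sub>R indicator E y *\<^sub>R snd (K_S (conj_sum m x y))" for m x y
  have int: "integrable (lborel \<Otimes>\<^sub>M lborel) (case_prod (f m))" if "\<bar>m\<bar> = 1" for m
  proof -
    have "case_prod (f m) = (\<lambda>z. snd (case z of (x, y) \<Rightarrow> indicator E x *\<^sub>R indicator E y *\<^sub>R K_S (conj_sum m x y)))"
      by (auto simp: fun_eq_iff f_def)
    thus ?thesis using integrable_bounded_linear[OF bounded_linear_snd integrable_K_S_pair[OF that]] by simp
  qed
  have intx: "integrable lborel (\<lambda>x. \<integral>y. f m x y \<partial>lborel)" if "\<bar>m\<bar> = 1" for m
    using lborel_pair.integrable_fst'[OF int[OF that]] by simp
  have inty: "integrable lborel (f m x)" if "\<bar>m\<bar> = 1" for m x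
    using integrable_scaleR_right[OF integrable_bounded_linear[OF bounded_linear_snd integrable_K_S[OF that]], of "indicator E x" x]
    by (simp add: f_def[abs_def])
  have anti: "f (-1) x y = - f (-1) y x" for x y
  proof -
    have 1: "fst y - fst x = - (fst x - fst y)" "snd y - snd x = - (snd x - snd y)" by simp_all
    have "snd (K_S (conj_sum (-1) y x)) = - snd (K_S (conj_sum (-1) x y))"
      unfolding K_S_def conj_sum_def by (simp del: minus_diff_eq cosh_real_eq_iff add: 1)
    thus ?thesis by (simp add: f_def)
  qed
  have zero: "(\<integral>x. (\<integral>y. f (-1) x y \<partial>lborel) \<partial>lborel) = 0"
  proof -
    have "(\<integral>x. (\<integral>y. f (-1) x y \<partial>lborel) \<partial>lborel) = (\<integral>y. (\<integral>x. f (-1) x y \<partial>lborel) \<partial>lborel)"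
      by (rule lborel_pair.Fubini_integral[OF int, symmetric]) simp
    also have "\<dots> = (\<integral>y. (\<integral>x. - f (-1) y x \<partial>lborel) \<partial>lborel)" by (subst anti) simp
    also have "\<dots> = - (\<integral>x. (\<integral>y. f (-1) x y \<partial>lborel) \<partial>lborel)" by simp
    finally show ?thesis by simp
  qed
  define k where "k = a / (4 * pi) + 1/2 - ln (1 - exp (-1 :: real))"
  have k: "k = (a + 2 * pi + 4 * pi * (- ln (1 - exp (-1)))) / (4 * pi)"
    by (simp add: k_def field_simps)
  have k0: "k \<ge> 0"
  proof -
    have "ln (1 - exp (-1 :: real)) \<le> 0" by simp
    moreover have "0 \<le> a / (4 * pi)" using a_nonneg by simp
    ultimately show ?thesis unfolding k_def by linarith
  qed
  have inner: "- (\<integral>y. f 1 x y \<partial>lborel) \<le> indicator E x * k" for x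
  proof (cases "x \<in> E")
    case True
    hence x: "fst x > 0" using sub by (auto simp: S_plus_def)
    have "(\<integral>y. - f 1 x y \<partial>lborel) \<le> k"
    proof (rule integral_real_bounded[OF k0])
      have "(\<integral>\<^sup>+y. ennreal (- f 1 x y) \<partial>lborel)
          = (\<integral>\<^sup>+y. ennreal (1 / (4 * pi)) * (ennreal (sinh (fst x + fst y) / den (conj_sum 1 (fst x, snd x) y)) * indicator E y) \<partial>lborel)"
      proof (intro nn_integral_cong)
        fix y
        show "ennreal (- f 1 x y)
          = ennreal (1 / (4 * pi)) * (ennreal (sinh (fst x + fst y) / den (conj_sum 1 (fst x, snd x) y)) * indicator E y)"
        proof (cases "y \<in> E")
          case y: True
          have "- f 1 x y = 1 / (4 * pi) * (sinh (fst x + fst y) / den (conj_sum 1 (fst x, snd x) y))"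
            using True y by (simp add: f_def K_S_def conj_sum_def den_def)
          hence "ennreal (- f 1 x y) = ennreal (1 / (4 * pi)) * ennreal (sinh (fst x + fst y) / den (conj_sum 1 (fst x, snd x) y))"
            by (subst ennreal_mult'[symmetric]) simp_all
          thus ?thesis using y by simp
        qed (simp add: f_def)
      qed
      also have "\<dots> = ennreal (1 / (4 * pi)) * (\<integral>\<^sup>+y\<in>E. ennreal (sinh (fst x + fst y) / den (conj_sum 1 (fst x, snd x) y)) \<partial>lborel)"
      proof (rule nn_integral_cmult)
        have "(\<lambda>y. sinh (fst x + fst y)) \<in> borel_measurable (borel :: (real \<times> real) measure)"
          by (intro borel_measurable_continuous_onI continuous_intros)
        thus "(\<lambda>y. ennreal (sinh (fst x + fst y) / den (conj_sum 1 (fst x, snd x) y)) * indicator E y) \<in> borel_measurable lborel"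
          by measurable
      qed
      also have "\<dots> \<le> ennreal (1 / (4 * pi)) * ennreal (a + 2 * pi + 4 * pi * (- ln (1 - exp (-1))))"
        using x by (intro mult_left_mono nn_integral_image_kernel_le) auto
      also have "\<dots> = ennreal k" by (simp add: k flip: ennreal_mult')
      finally show "(\<integral>\<^sup>+y. ennreal (- f 1 x y) \<partial>lborel) \<le> ennreal k" .
    qed
    thus ?thesis using True by simp
  qed (simp add: f_def)
  have "(LINT x:E|lborel. snd (vel x)) = (\<integral>x. (\<integral>y. f (-1) x y \<partial>lborel) - (\<integral>y. f 1 x y \<partial>lborel) \<partial>lborel)"
    unfolding set_lebesgue_integral_def
  proof (rule Bochner_Integration.integral_cong[OF refl])
    fix x
    have "snd (vel x) = (\<integral>y. snd (indicator E y *\<^sub>R K x y) \<partial>lborel)"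
      unfolding vel_def set_lebesgue_integral_def
      by (rule integral_bounded_linear[OF bounded_linear_snd integrable_K, symmetric])
    hence "indicator E x *\<^sub>R snd (vel x) = (\<integral>y. indicator E x *\<^sub>R snd (indicator E y *\<^sub>R K x y) \<partial>lborel)" by simp
    also have "\<dots> = (\<integral>y. f (-1) x y - f 1 x y \<partial>lborel)"
      by (intro Bochner_Integration.integral_cong) (auto simp: f_def K_conj_sum algebra_simps)
    also have "\<dots> = (\<integral>y. f (-1) x y \<partial>lborel) - (\<integral>y. f 1 x y \<partial>lborel)"
      by (rule Bochner_Integration.integral_diff) (auto intro: inty)
    finally show "indicator E x *\<^sub>R snd (vel x) = (\<integral>y. f (-1) x y \<partial>lborel) - (\<integral>y. f 1 x y \<partial>lborel)" .
  qed
  also have "\<dots> = (\<integral>x. - (\<integral>y. f 1 x y \<partial>lborel) \<partial>lborel)"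
    using zero by (subst Bochner_Integration.integral_diff) (auto intro: intx)
  also have "\<dots> \<le> (\<integral>x. indicator E x * k \<partial>lborel)"
    using intx[of 1] inner area by (intro integral_mono) (auto simp: integrable_indicator_iff)
  also have "\<dots> = a * k" using area a_nonneg by (simp add: measure_def)
  finally show ?thesis by (simp add: k_def)
qed

end


section \<open>Osgood's argument\<close>

text \<open>
  A weak solution has bounded mass only for almost every time, so a priori the velocity is
  controlled only for almost every time. As the flow is differentiable at every time, the
  fundamental theorem for the gauge integral still applies.
\<close>

lemma abs_increment_le_AE_derivative_bound:
  fixes f :: "real \<Rightarrow> real"
  assumes der: "\<And>t. 0 \<le> t \<Longrightarrow> (f has_vector_derivative f' t) (at t within {0..})"
    and bd: "AE t in lborel. 0 < t \<longrightarrow> \<bar>f' t\<bar> \<le> C" and C: "0 \<le> C"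
    and st: "0 \<le> s" "s \<le> t"
  shows "\<bar>f t - f s\<bar> \<le> C * (t - s)"
proof -
  obtain N where N: "N \<in> null_sets lborel" "{t. \<not> (0 < t \<longrightarrow> \<bar>f' t\<bar> \<le> C)} \<subseteq> N"
    using bd by (auto elim!: AE_E simp: null_sets_def)
  have neg: "negligible (insert 0 N)"
    using N(1) by (simp add: negligible_iff_null_sets null_sets_completionI)
  have "(f' has_integral (f t - f s)) {s..t}"
  proof (rule fundamental_theorem_of_calculus[OF st(2)])
    fix x assume "x \<in> {s..t}"
    thus "(f has_vector_derivative f' x) (at x within {s..t})"
      using st by (intro has_vector_derivative_within_subset[OF der]) auto
  qed
  \<comment> \<open>On the exceptional null set the derivative may be arbitrarily large; the gauge
    integral allows replacing it by 0 there. The time 0 is included because the bound is assumed for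
    positive times only.\<close>
  hence "((\<lambda>x. if x \<in> insert 0 N then 0 else f' x) has_integral (f t - f s)) {s..t}"
    by (rule has_integral_spike[OF neg, rotated]) auto
  moreover have "norm (if x \<in> insert 0 N then 0 else f' x) \<le> C" if "x \<in> cbox s t" for x
  proof (cases "x \<in> insert 0 N")
    case False
    hence "0 < x" "x \<notin> N" using that st by auto
    thus ?thesis using N(2) False by auto
  qed (use C in simp)
  ultimately have "norm (f t - f s) \<le> C * measure lborel (cbox s t)"
    using C by (intro has_integral_bound) auto
  thus ?thesis using st by simp
qed

text \<open>Formally the derivative of \<open>norm Z powr e\<close> is at most
  \<open>e * norm Z powr (e - 1) * norm Z'\<close>, and the hypothesis makes this at most
  \<open>C\<close>, the factors \<open>e\<close> and \<open>1 / e\<close> cancelling. The norm is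
  not differentiable where \<open>Z\<close> vanishes, so the calculation is made for
  \<open>\<eta> + (norm Z)\<^sup>2\<close> and \<open>\<eta>\<close> tends to 0.\<close>

lemma osgood_modulus:
  fixes Z :: "real \<Rightarrow> 'a::real_inner"
  assumes der: "\<And>t. 0 \<le> t \<Longrightarrow> (Z has_vector_derivative Z' t) (at t within {0..})"
    and bd: "AE t in lborel. 0 < t \<longrightarrow> norm (Z' t) \<le> C / e * norm (Z t) powr (1 - e)"
    and C: "0 \<le> C" and e: "0 < e" "e \<le> 1" and st: "0 \<le> s" "0 \<le> t"
  shows "norm (Z t) powr e \<le> norm (Z s) powr e + C * \<bar>t - s\<bar>"
proof -
  have *: "(\<eta> + (norm (Z t))\<^sup>2) powr (e / 2) \<le> (\<eta> + (norm (Z s))\<^sup>2) powr (e / 2) + C * \<bar>t - s\<bar>" if "\<eta> > 0" for \<eta>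
  proof -
    define f where "f t = (\<eta> + Z t \<bullet> Z t) powr (e / 2)" for t
    define f' where "f' t = (e / 2) * (\<eta> + Z t \<bullet> Z t) powr (e / 2 - 1) * (2 * (Z t \<bullet> Z' t))" for t
    have pos: "\<eta> + Z t \<bullet> Z t > 0" for t using that by (simp add: add_pos_nonneg)
    have der_f: "(f has_vector_derivative f' t) (at t within {0..})" if "0 \<le> t" for t
    proof -
      have "((\<lambda>t. \<eta> + Z t \<bullet> Z t) has_real_derivative 2 * (Z t \<bullet> Z' t)) (at t within {0..})"
        using der[OF that] unfolding has_vector_derivative_def has_field_derivative_def
        by (auto intro!: derivative_eq_intros simp: fun_eq_iff inner_commute algebra_simps)
      hence "(f has_real_derivative f' t) (at t within {0..})"
        unfolding f_def f'_def by (rule DERIV_chain2[where f = "\<lambda>z. z powr (e / 2)" and g = "\<lambda>t. \<eta> + Z t \<bullet> Z t", OF has_real_derivative_powr[OF pos]])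
      thus ?thesis by (simp add: has_real_derivative_iff_has_vector_derivative)
    qed
    have bd_f: "AE t in lborel. 0 < t \<longrightarrow> \<bar>f' t\<bar> \<le> C"
      using bd
    proof eventually_elim
      case (elim t)
      show ?case
      proof
        assume t: "0 < t"
        define R where "R = \<eta> + Z t \<bullet> Z t"
        have R: "R > 0" "(norm (Z t))\<^sup>2 \<le> R" using pos[of t] that by (simp_all add: R_def power2_norm_eq_inner)
        have nR: "norm (Z t) \<le> R powr (1/2)"
          using R by (simp add: powr_half_sqrt real_le_rsqrt)
        have "\<bar>Z t \<bullet> Z' t\<bar> \<le> norm (Z t) * norm (Z' t)" by (rule Cauchy_Schwarz_ineq2)
        also have "\<dots> \<le> norm (Z t) * (C / e * norm (Z t) powr (1 - e))"
          using elim t by (intro mult_left_mono) auto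
        also have "\<dots> \<le> R powr (1/2) * (C / e * (R powr (1/2)) powr (1 - e))"
          using nR C e by (intro mult_mono powr_mono2 mult_nonneg_nonneg) auto
        also have "\<dots> = C / e * R powr (1/2 + 1/2 * (1 - e))"
          by (simp only: powr_powr powr_add mult_ac)
        also have "1/2 + 1/2 * (1 - e) = 1 - e / 2" by (simp add: field_simps)
        finally have ZZ: "\<bar>Z t \<bullet> Z' t\<bar> \<le> C / e * R powr (1 - e / 2)" .
        have "\<bar>f' t\<bar> = e * R powr (e / 2 - 1) * \<bar>Z t \<bullet> Z' t\<bar>"
          using e by (simp add: f'_def R_def abs_mult)
        also have "\<dots> \<le> e * R powr (e / 2 - 1) * (C / e * R powr (1 - e / 2))"
          using ZZ e by (intro mult_left_mono) auto
        also have "\<dots> = C * (R powr (e / 2 - 1) * R powr (1 - e / 2))" using e by simp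
        also have "\<dots> = C" using R by (simp flip: powr_add)
        finally show "\<bar>f' t\<bar> \<le> C" .
      qed
    qed
    \<comment> \<open>The bound on the derivative is two-sided, so \<open>s\<close> may precede or
      follow \<open>t\<close>; the backward direction later yields injectivity.\<close>
    have "\<bar>f (max s t) - f (min s t)\<bar> \<le> C * (max s t - min s t)"
      using st by (intro abs_increment_le_AE_derivative_bound[OF der_f bd_f C]) auto
    hence "f t \<le> f s + C * \<bar>t - s\<bar>" by (auto simp: max_def min_def abs_if split: if_splits)
    thus ?thesis by (simp add: f_def power2_norm_eq_inner)
  qed
  have lim: "((\<lambda>\<eta>. (\<eta> + x) powr (e / 2)) \<longlongrightarrow> (0 + x) powr (e / 2)) (at_right 0)" if "x \<ge> 0" for x :: real
    using that e by (intro tendsto_powr2 tendsto_intros) (auto intro!: eventually_at_right_less[THEN eventually_mono] )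
  have "(0 + (norm (Z t))\<^sup>2) powr (e / 2) \<le> (0 + (norm (Z s))\<^sup>2) powr (e / 2) + C * \<bar>t - s\<bar>"
  proof (rule tendsto_le[OF _ tendsto_add[OF lim tendsto_const] lim])
    show "\<forall>\<^sub>F \<eta> in at_right 0. (\<eta> + (norm (Z t))\<^sup>2) powr (e / 2) \<le> (\<eta> + (norm (Z s))\<^sup>2) powr (e / 2) + C * \<bar>t - s\<bar>"
      using * by (auto intro!: eventually_at_right_less[THEN eventually_mono])
  qed auto
  moreover have "(x\<^sup>2) powr (e / 2) = x powr e" if "x \<ge> 0" for x :: real
  proof -
    have "(x\<^sup>2) powr (e / 2) = (x powr 2) powr (e / 2)" using that by (simp add: powr_numeral)
    also have "\<dots> = x powr e" unfolding powr_powr by simp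
    finally show ?thesis .
  qed
  ultimately show ?thesis by simp
qed

text \<open>
  A single exponent \<open>e\<close> gives no uniqueness, but letting \<open>e \<rightarrow> 0\<close> in \<open>r\<^sup>e \<le> 1/2\<close> does; this
  controls times up to \<open>1 / (4 C)\<close>, and longer times follow by iteration.
\<close>

lemma osgood_uniform:
  fixes r :: "'i \<Rightarrow> real \<Rightarrow> real"
  assumes r0: "\<And>i t. r i t \<ge> 0" and C: "0 < C"
    and mod: "\<And>i e s t. 0 < e \<Longrightarrow> e \<le> 1 \<Longrightarrow> 0 \<le> s \<Longrightarrow> 0 \<le> t \<Longrightarrow> i \<in> I \<Longrightarrow>
      r i t powr e \<le> r i s powr e + C * \<bar>t - s\<bar>"
    and st: "0 \<le> s" "0 \<le> t" and \<delta>: "0 < \<delta>"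
  shows "\<exists>\<delta>'>0. \<forall>i\<in>I. r i s < \<delta>' \<longrightarrow> r i t < \<delta>"
proof -
  have small: "\<exists>\<delta>'>0. \<forall>i\<in>I. r i s < \<delta>' \<longrightarrow> r i t < \<delta>"
    if st: "0 \<le> s" "0 \<le> t" "C * \<bar>t - s\<bar> \<le> 1/4" and \<delta>: "0 < \<delta>" for s t \<delta>
  proof -
    define d where "d = min \<delta> (1/2)"
    have d: "0 < d" "d \<le> \<delta>" "d < 1" using \<delta> by (auto simp: d_def)
    \<comment> \<open>However small the target \<open>d\<close> is, a small exponent lifts
      \<open>d powr e\<close> above 1/2. This is why a threshold independent of \<open>d\<close>
      suffices.\<close>
    have "((\<lambda>e. d powr e) \<longlongrightarrow> d powr 0) (at_right 0)"
      using d by (intro tendsto_intros) auto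
    hence "\<forall>\<^sub>F e in at_right 0. 1/2 < d powr e" using d by (intro order_tendstoD) auto
    moreover have "\<forall>\<^sub>F e in at_right (0::real). e < 1" by (rule order_tendstoD[OF tendsto_ident_at]) simp
    ultimately have "\<forall>\<^sub>F e in at_right (0::real). 0 < e \<and> e < 1 \<and> 1/2 < d powr e"
      using eventually_at_right_less[of "0::real"] by eventually_elim auto
    then obtain e where e: "0 < e" "e < 1" "1/2 < d powr e"
      using eventually_happens'[of "at_right (0::real)"] by force
    \<comment> \<open>The witness makes the initial value of \<open>r powr e\<close> at most 1/4;
      the elapsed time adds at most another 1/4.\<close>
    show ?thesis
    proof (intro exI[of _ "(1/4) powr (1 / e)"] conjI ballI impI)
      fix i assume i: "i \<in> I" "r i s < (1/4) powr (1 / e)"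
      have "r i s powr e \<le> ((1/4) powr (1 / e)) powr e" using i e r0 by (intro powr_mono2) auto
      also have "\<dots> = 1/4" using e by (simp add: powr_powr)
      finally have "r i t powr e \<le> 1/2" using mod[of e s t i] e st i by simp
      hence "r i t powr e < d powr e" using e by simp
      hence "r i t < d" using e d r0 by (metis linorder_not_less powr_mono2 order_less_le)
      thus "r i t < \<delta>" using d by simp
    qed simp
  qed
  have "\<exists>\<delta>'>0. \<forall>i\<in>I. r i s < \<delta>' \<longrightarrow> r i t < \<delta>"
    if "0 \<le> s" "0 \<le> t" "C * \<bar>t - s\<bar> \<le> real n / 4" "0 < \<delta>" for n s t \<delta>
    using that
  proof (induction n arbitrary: t \<delta>)
    case 0
    hence "t = s" using C by (simp add: mult_le_0_iff)
    thus ?case using 0 by auto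
  next
    case (Suc n)
    \<comment> \<open>The last of \<open>n + 1\<close> equal legs, in either time direction:
      \<open>n\<close> legs lead from \<open>s\<close> to \<open>m\<close>, and a short one from
      \<open>m\<close> to \<open>t\<close>.\<close>
    define m where "m = s + (t - s) * (real n / real (Suc n))"
    have m: "m = s * (1 - real n / real (Suc n)) + t * (real n / real (Suc n))"
      unfolding m_def by (simp only: algebra_simps mult_1_right)
    have "0 \<le> m" unfolding m using Suc.prems by (intro add_nonneg_nonneg mult_nonneg_nonneg) auto
    have "C * \<bar>m - s\<bar> = (C * \<bar>t - s\<bar>) * (real n / real (Suc n))" by (simp add: m_def abs_mult)
    also have "\<dots> \<le> real (Suc n) / 4 * (real n / real (Suc n))"
      using Suc.prems by (intro mult_right_mono) auto
    also have "\<dots> = real n / 4" by (simp del: of_nat_Suc)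
    finally have 1: "C * \<bar>m - s\<bar> \<le> real n / 4" .
    have "t - m = (t - s) * (1 / real (Suc n))" by (simp add: m_def field_simps)
    hence "C * \<bar>t - m\<bar> = (C * \<bar>t - s\<bar>) * (1 / real (Suc n))" by (simp add: abs_mult)
    also have "\<dots> \<le> real (Suc n) / 4 * (1 / real (Suc n))"
      using Suc.prems by (intro mult_right_mono) auto
    also have "\<dots> = 1/4" by (simp del: of_nat_Suc)
    finally have 2: "C * \<bar>t - m\<bar> \<le> 1/4" .
    obtain \<delta>1 where "\<delta>1 > 0" "\<forall>i\<in>I. r i m < \<delta>1 \<longrightarrow> r i t < \<delta>"
      using small[OF \<open>0 \<le> m\<close> _ 2] Suc.prems by blast
    moreover obtain \<delta>2 where "\<delta>2 > 0" "\<forall>i\<in>I. r i s < \<delta>2 \<longrightarrow> r i m < \<delta>1"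
      using Suc.IH[of m \<delta>1] Suc.prems \<open>0 \<le> m\<close> 1 \<open>\<delta>1 > 0\<close> by blast
    ultimately show ?case by blast
  qed
  moreover obtain n :: nat where "C * \<bar>t - s\<bar> \<le> real n / 4"
    using real_arch_simple[of "4 * (C * \<bar>t - s\<bar>)"] by (auto simp: field_simps)
  ultimately show ?thesis using st \<delta> by blast
qed


section \<open>Hausdorff measure of curves\<close>

text \<open>A covering set is arbitrary and its projection may fail to be measurable; the interval
  from infimum to supremum takes its place.\<close>

lemma emeasure_image_snd_le_diameter:
  fixes U :: "(real \<times> real) set"
  assumes "bounded U"
  shows "\<exists>V\<in>sets borel. snd ` U \<subseteq> V \<and> emeasure lborel V \<le> ennreal (diameter U)"
proof (cases "U = {}")
  case False
  define S where "S = snd ` U"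
  have S: "S \<noteq> {}" using False by (simp add: S_def)
  have d: "\<bar>x - y\<bar> \<le> diameter U" if xy: "x \<in> S" "y \<in> S" for x y
  proof -
    obtain p q where pq: "p \<in> U" "q \<in> U" "x = snd p" "y = snd q" using xy by (auto simp: S_def)
    have "\<bar>x - y\<bar> \<le> dist p q" using dist_snd_le[of p q] pq by (simp add: dist_real_def)
    also have "\<dots> \<le> diameter U" using pq assms by (intro diameter_bounded_bound) auto
    finally show ?thesis .
  qed
  have bd: "bounded S" using assms unfolding S_def by (rule bounded_snd)
  have "Sup S - diameter U \<le> Inf S"
  proof (intro cInf_greatest[OF S])
    fix y assume y: "y \<in> S"
    have "Sup S \<le> y + diameter U" by (intro cSup_least[OF S]) (use d[OF _ y] in force)
    thus "Sup S - diameter U \<le> y" by simp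
  qed
  moreover have "S \<subseteq> {Inf S..Sup S}"
    using bd by (auto intro!: cInf_lower cSup_upper simp: bounded_imp_bdd_above bounded_imp_bdd_below)
  moreover have "Inf S \<le> Sup S" using S \<open>S \<subseteq> {Inf S..Sup S}\<close> by force
  ultimately show ?thesis
    by (intro bexI[of _ "{Inf S..Sup S}"]) (auto simp: S_def intro!: ennreal_leI)
qed (auto intro!: bexI[of _ "{}"])

lemma uniform_separation:
  fixes G :: "'i \<Rightarrow> 'a::heine_borel set"
  assumes "finite J" and "\<And>j. j \<in> J \<Longrightarrow> compact (G j)"
    and "\<And>i j. i \<in> J \<Longrightarrow> j \<in> J \<Longrightarrow> i \<noteq> j \<Longrightarrow> G i \<inter> G j = {}"
  obtains \<delta> where "\<delta> > 0"
    "\<And>i j x y. i \<in> J \<Longrightarrow> j \<in> J \<Longrightarrow> i \<noteq> j \<Longrightarrow> x \<in> G i \<Longrightarrow> y \<in> G j \<Longrightarrow> \<delta> < dist x y"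
proof -
  have "\<exists>d>0. \<forall>x\<in>G i. \<forall>y\<in>G j. d \<le> dist x y" if "i \<in> J" "j \<in> J" "i \<noteq> j" for i j
    using separate_compact_closed[of "G i" "G j"] assms that by (simp add: compact_imp_closed)
  then obtain d where d: "\<And>i j. i \<in> J \<Longrightarrow> j \<in> J \<Longrightarrow> i \<noteq> j \<Longrightarrow> d i j > 0 \<and> (\<forall>x\<in>G i. \<forall>y\<in>G j. d i j \<le> dist x y)"
    by metis
  define P where "P = {p \<in> J \<times> J. fst p \<noteq> snd p}"
  define \<epsilon> where "\<epsilon> = Min (insert 1 ((\<lambda>p. d (fst p) (snd p)) ` P))"
  have fin: "finite P" unfolding P_def using assms(1) by simp
  have "\<epsilon> > 0" unfolding \<epsilon>_def using fin d by (subst Min_gr_iff) (auto simp: P_def)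
  moreover have "\<epsilon> \<le> d i j" if "i \<in> J" "j \<in> J" "i \<noteq> j" for i j
    unfolding \<epsilon>_def using fin that by (intro Min_le) (auto simp: P_def intro!: image_eqI[of _ _ "(i, j)"])
  ultimately show thesis using d by (intro that[of "\<epsilon> / 2"]) (force, fastforce)
qed

text \<open>The pieces are disjoint but their projections may overlap, so projecting the union would
  lose length. Covering sets smaller than the separation of the compact pieces meet at most one
  piece each, and the projected lengths add up.\<close>

lemma sum_emeasure_proj_le_hausdorff1:
  fixes G :: "'i \<Rightarrow> (real \<times> real) set"
  assumes J: "finite J" and cpt: "\<And>j. j \<in> J \<Longrightarrow> compact (G j)"
    and disj: "\<And>i j. i \<in> J \<Longrightarrow> j \<in> J \<Longrightarrow> i \<noteq> j \<Longrightarrow> G i \<inter> G j = {}"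
    and sub: "\<And>j. j \<in> J \<Longrightarrow> G j \<subseteq> A"
  shows "(\<Sum>j\<in>J. emeasure lborel (snd ` G j)) \<le> hausdorff1 A"
proof -
  obtain \<delta> where \<delta>: "\<delta> > 0"
    and sep: "\<And>i j x y. i \<in> J \<Longrightarrow> j \<in> J \<Longrightarrow> i \<noteq> j \<Longrightarrow> x \<in> G i \<Longrightarrow> y \<in> G j \<Longrightarrow> \<delta> < dist x y"
    using uniform_separation[of J G] J cpt disj by metis
  have "(\<Sum>j\<in>J. emeasure lborel (snd ` G j)) \<le> (\<Sum>i. ennreal (diameter (U i)))"
    if cov: "A \<subseteq> (\<Union>i. U i)" and U: "\<And>i. bounded (U i)" "\<And>i. diameter (U i) \<le> \<delta>"
    for U :: "nat \<Rightarrow> (real \<times> real) set"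
  proof -
    obtain V where V: "\<And>i. V i \<in> sets borel" "\<And>i. snd ` U i \<subseteq> V i" "\<And>i. emeasure lborel (V i) \<le> ennreal (diameter (U i))"
      using emeasure_image_snd_le_diameter[OF U(1)] by metis
    define W where "W j i = (if U i \<inter> G j = {} then {} else V i)" for j i
    have "emeasure lborel (snd ` G j) \<le> (\<Sum>i. emeasure lborel (W j i))" if j: "j \<in> J" for j
    proof -
      have "snd ` G j \<subseteq> (\<Union>i. W j i)"
      proof
        fix y assume "y \<in> snd ` G j"
        then obtain x where x: "x \<in> G j" "y = snd x" by blast
        then obtain i where "x \<in> U i" using cov sub[OF j] by blast
        thus "y \<in> (\<Union>i. W j i)" using x V(2)[of i] by (auto simp: W_def)
      qed
      moreover have W: "W j i \<in> sets borel" for i using V by (simp add: W_def)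
      ultimately have "emeasure lborel (snd ` G j) \<le> emeasure lborel (\<Union>i. W j i)"
        by (intro emeasure_mono) auto
      also have "\<dots> \<le> (\<Sum>i. emeasure lborel (W j i))" using W by (intro emeasure_subadditive_countably) auto
      finally show ?thesis .
    qed
    hence "(\<Sum>j\<in>J. emeasure lborel (snd ` G j)) \<le> (\<Sum>j\<in>J. \<Sum>i. emeasure lborel (W j i))" by (intro sum_mono)
    also have "\<dots> = (\<Sum>i. \<Sum>j\<in>J. emeasure lborel (W j i))" by (rule suminf_sum[symmetric]) simp
    also have "\<dots> \<le> (\<Sum>i. ennreal (diameter (U i)))"
    proof (intro suminf_le)
      fix i
      show "(\<Sum>j\<in>J. emeasure lborel (W j i)) \<le> ennreal (diameter (U i))"
      proof (cases "\<exists>j\<in>J. U i \<inter> G j \<noteq> {}")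
        case True
        then obtain j x where j: "j \<in> J" "x \<in> U i" "x \<in> G j" by blast
        have "W k i = {}" if "k \<in> J" "k \<noteq> j" for k
        proof (rule ccontr)
          assume "W k i \<noteq> {}"
          then obtain y where y: "y \<in> U i" "y \<in> G k" by (auto simp: W_def split: if_splits)
          have "dist x y \<le> diameter (U i)" using j y U(1) by (intro diameter_bounded_bound) auto
          thus False using sep[of j k x y] that j y U(2)[of i] by simp
        qed
        hence "(\<Sum>k\<in>J. emeasure lborel (W k i)) = (\<Sum>k\<in>J. if k = j then emeasure lborel (W j i) else 0)"
          by (intro sum.cong) auto
        also have "\<dots> = emeasure lborel (W j i)" using J j by simp
        also have "\<dots> \<le> emeasure lborel (V i)" by (simp add: W_def)
        finally show ?thesis using V(3)[of i] by simp
      next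
        case False
        hence "(\<Sum>j\<in>J. emeasure lborel (W j i)) = 0" by (intro sum.neutral) (auto simp: W_def)
        thus ?thesis by simp
      qed
    qed auto
    finally show ?thesis .
  qed
  hence "(\<Sum>j\<in>J. emeasure lborel (snd ` G j)) \<le>
    (INF U\<in>{U :: nat \<Rightarrow> (real \<times> real) set. A \<subseteq> (\<Union>i. U i) \<and> (\<forall>i. bounded (U i) \<and> diameter (U i) \<le> \<delta>)}.
          (\<Sum>i. ennreal (diameter (U i))))"
    by (intro INF_greatest) auto
  also have "\<dots> \<le> hausdorff1 A" unfolding hausdorff1_def using \<delta> by (intro SUP_upper) auto
  finally show ?thesis .
qed

text \<open>\<open>\<Gamma>\<close> is sliced by height into periods and each slice is moved into
  the base period. The moved slices are disjoint by the second hypothesis even where their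
  projections overlap, so together they account for the whole interval.\<close>

lemma cyl_length_ge:
  fixes \<Gamma> F :: "(real \<times> real) set"
  assumes cpt: "compact \<Gamma>"
    and inj: "\<And>x (k::int). x \<in> \<Gamma> \<Longrightarrow> x + of_int k *\<^sub>R (0, 2 * pi) \<in> \<Gamma> \<Longrightarrow> k = 0"
    and sub: "\<And>x (k::int). x \<in> \<Gamma> \<Longrightarrow> x + of_int k *\<^sub>R (0, 2 * pi) \<in> F"
    and proj: "{\<alpha>..\<beta>} \<subseteq> snd ` \<Gamma>"
  shows "ennreal (\<beta> - \<alpha>) \<le> cyl_length F"
proof (cases "\<alpha> \<le> \<beta>")
  case False
  thus ?thesis by (simp add: ennreal_neg)
next
  case True
  obtain n :: nat where n: "max \<bar>\<alpha>\<bar> \<bar>\<beta>\<bar> \<le> real n" using real_arch_simple by blast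
  define J where "J = {- int n..int n}"
  show ?thesis
  proof (rule ennreal_le_epsilon)
    fix e :: real assume e: "0 < e"
    \<comment> \<open>The base period is half-open, whereas the separation argument needs compact
      slices. Each slice therefore stops \<open>\<eta>\<close> below its upper end, and the
      \<open>card J\<close> omitted gaps cost at most \<open>e\<close> in total.\<close>
    define \<eta> where "\<eta> = min pi (e / real (card J))"
    have cJ: "card J > 0" by (simp add: J_def)
    have \<eta>: "0 < \<eta>" "\<eta> \<le> pi" "real (card J) * \<eta> \<le> e"
      using e cJ by (auto simp: \<eta>_def min_def field_simps)
    define S where "S k = \<Gamma> \<inter> {x. (2 * of_int k - 1) * pi \<le> snd x} \<inter> {x. snd x \<le> (2 * of_int k + 1) * pi - \<eta>}" for k :: int
    define G where "G k = (\<lambda>x. x - of_int k *\<^sub>R (0, 2 * pi)) ` S k" for k :: int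
    define l u where "l k = max \<alpha> ((2 * of_int k - 1) * pi)" and "u k = min \<beta> ((2 * of_int k + 1) * pi - \<eta>)" for k :: int
    have "compact (S k)" for k
      unfolding S_def by (intro compact_Int_closed cpt closed_Collect_le continuous_intros)
    hence G_cpt: "compact (G k)" for k
      unfolding G_def by (intro compact_continuous_image continuous_intros)
    have G_sub: "G k \<subseteq> F \<inter> one_period" for k
    proof
      fix y assume "y \<in> G k"
      then obtain x where x: "x \<in> S k" "y = x + of_int (- k) *\<^sub>R (0, 2 * pi)" by (auto simp: G_def)
      hence "y \<in> F" unfolding x(2) by (intro sub) (auto simp: S_def)
      moreover have "y \<in> one_period" using x \<eta> by (auto simp: S_def one_period_def algebra_simps)
      ultimately show "y \<in> F \<inter> one_period" by simp
    qed
    have disj: "G i \<inter> G j = {}" if "i \<noteq> j" for i j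
    proof (rule ccontr)
      assume "G i \<inter> G j \<noteq> {}"
      then obtain p where "p \<in> G i" "p \<in> G j" by blast
      then obtain x y where "x \<in> S i" "p = x - of_int i *\<^sub>R (0, 2 * pi)" "y \<in> S j" "p = y - of_int j *\<^sub>R (0, 2 * pi)"
        unfolding G_def by blast
      hence xy: "x \<in> \<Gamma>" "y \<in> \<Gamma>" "x - of_int i *\<^sub>R (0, 2 * pi) = y - of_int j *\<^sub>R (0, 2 * pi)"
        by (simp_all add: S_def)
      have "y = x - of_int i *\<^sub>R (0, 2 * pi) + of_int j *\<^sub>R (0, 2 * pi)" unfolding xy(3) by simp
      also have "\<dots> = x + of_int (j - i) *\<^sub>R (0, 2 * pi)" by (simp add: algebra_simps)
      finally show False using inj[of x "j - i"] xy that by simp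
    qed
    have piece: "emeasure lborel {l k..u k} \<le> emeasure lborel (snd ` G k)" for k
    proof -
      have "emeasure lborel {l k..u k} = emeasure lborel {l k - of_int k * (2 * pi)..u k - of_int k * (2 * pi)}"
        by (cases "l k \<le> u k") auto
      also have "\<dots> \<le> emeasure lborel (snd ` G k)"
      proof (rule emeasure_mono)
        show "{l k - of_int k * (2 * pi)..u k - of_int k * (2 * pi)} \<subseteq> snd ` G k"
        proof
          fix y assume "y \<in> {l k - of_int k * (2 * pi)..u k - of_int k * (2 * pi)}"
          hence z: "y + of_int k * (2 * pi) \<in> {l k..u k}" by auto
          hence "y + of_int k * (2 * pi) \<in> {\<alpha>..\<beta>}" by (auto simp: l_def u_def)
          then obtain x where x: "x \<in> \<Gamma>" "snd x = y + of_int k * (2 * pi)" using proj by force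
          hence "x \<in> S k" using z by (auto simp: S_def l_def u_def)
          thus "y \<in> snd ` G k" using x by (auto simp: G_def image_iff intro!: bexI[of _ x])
        qed
        show "snd ` G k \<in> sets lborel"
          using compact_continuous_image[OF continuous_on_snd[OF continuous_on_id] G_cpt[of k]]
          by (simp add: borel_compact)
      qed
      finally show ?thesis .
    qed
    have "{\<alpha>..\<beta>} \<subseteq> (\<Union>k\<in>J. {l k..u k} \<union> {(2 * of_int k + 1) * pi - \<eta>..(2 * of_int k + 1) * pi})"
    proof
      fix y assume y: "y \<in> {\<alpha>..\<beta>}"
      define k where "k = \<lfloor>(y + pi) / (2 * pi)\<rfloor>"
      have k1: "(2 * of_int k - 1) * pi \<le> y"
      proof -
        have "of_int k * (2 * pi) \<le> y + pi"
          using of_int_floor_le[of "(y + pi) / (2 * pi)"] unfolding k_def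
          by (subst (asm) pos_le_divide_eq) simp_all
        thus ?thesis by (simp add: algebra_simps)
      qed
      have k2: "y < (2 * of_int k + 1) * pi"
      proof -
        have "(y + pi) / (2 * pi) < of_int k + 1" unfolding k_def by linarith
        thus ?thesis by (simp add: pos_divide_less_eq algebra_simps)
      qed
      have yn: "\<bar>y\<bar> \<le> real n" using y n by auto
      have "k \<in> J"
      proof -
        have "(2 * of_int k - 1) * pi \<le> real n" using k1 yn by linarith
        also have "real n \<le> real n * pi" using pi_gt3 by (intro mult_left_mono[of 1 pi, simplified]) auto
        finally have "2 * of_int k - 1 \<le> real n" using pi_gt_zero by (simp add: mult_le_cancel_right)
        moreover have "- real n \<le> (2 * of_int k + 1) * pi" using k2 yn by linarith
        hence "- real n * pi \<le> (2 * of_int k + 1) * pi"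
          using \<open>real n \<le> real n * pi\<close> by (simp add: algebra_simps)
        hence "- real n \<le> 2 * of_int k + 1" using pi_gt_zero by (subst (asm) mult_le_cancel_right) auto
        ultimately show ?thesis unfolding J_def by auto
      qed
      moreover have "y \<in> {l k..u k} \<union> {(2 * of_int k + 1) * pi - \<eta>..(2 * of_int k + 1) * pi}"
        using y k1 k2 by (auto simp: l_def u_def)
      ultimately show "y \<in> (\<Union>k\<in>J. {l k..u k} \<union> {(2 * of_int k + 1) * pi - \<eta>..(2 * of_int k + 1) * pi})" by blast
    qed
    hence "emeasure lborel {\<alpha>..\<beta>} \<le> emeasure lborel (\<Union>k\<in>J. {l k..u k} \<union> {(2 * of_int k + 1) * pi - \<eta>..(2 * of_int k + 1) * pi})"
      by (rule emeasure_mono) (auto simp: J_def)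
    also have "\<dots> \<le> (\<Sum>k\<in>J. emeasure lborel ({l k..u k} \<union> {(2 * of_int k + 1) * pi - \<eta>..(2 * of_int k + 1) * pi}))"
      by (rule emeasure_subadditive_finite) (auto simp: J_def)
    also have "\<dots> \<le> (\<Sum>k\<in>J. emeasure lborel (snd ` G k) + ennreal \<eta>)"
    proof (rule sum_mono)
      fix k
      have "emeasure lborel ({l k..u k} \<union> {(2 * of_int k + 1) * pi - \<eta>..(2 * of_int k + 1) * pi})
         \<le> emeasure lborel {l k..u k} + emeasure lborel {(2 * of_int k + 1) * pi - \<eta>..(2 * of_int k + 1) * pi}"
        by (rule emeasure_subadditive) auto
      also have "\<dots> \<le> emeasure lborel (snd ` G k) + ennreal \<eta>" using piece[of k] \<eta> by (intro add_mono) auto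
      finally show "emeasure lborel ({l k..u k} \<union> {(2 * of_int k + 1) * pi - \<eta>..(2 * of_int k + 1) * pi})
         \<le> emeasure lborel (snd ` G k) + ennreal \<eta>" .
    qed
    also have "\<dots> = (\<Sum>k\<in>J. emeasure lborel (snd ` G k)) + ennreal (real (card J) * \<eta>)"
      using \<eta> by (simp add: sum.distrib ennreal_mult ennreal_of_nat_eq_real_of_nat)
    also have "\<dots> \<le> hausdorff1 (F \<inter> one_period) + ennreal e"
      using G_cpt G_sub disj \<eta> by (intro add_mono sum_emeasure_proj_le_hausdorff1 ennreal_leI) (auto simp: J_def)
    finally show "ennreal (\<beta> - \<alpha>) \<le> cyl_length F + ennreal e" using True by (simp add: cyl_length_def)
  qed
qed

text \<open>The cover consists of \<open>n\<close> equal arcs; a chord is no longer than its arc, so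
  their diameters sum to at most the circumference.\<close>

lemma hausdorff1_circle_le:
  fixes r :: real
  assumes r: "0 < r" and sub: "A \<subseteq> sphere (c :: real \<times> real) r"
  shows "hausdorff1 A \<le> ennreal (2 * pi * r)"
  unfolding hausdorff1_def
proof (rule SUP_least)
  fix \<delta> :: real assume "\<delta> \<in> {0<..}"
  hence \<delta>: "\<delta> > 0" by simp
  obtain n :: nat where n: "2 * pi * r / \<delta> < real n" using reals_Archimedean2 by blast
  have "0 < 2 * pi * r / \<delta>" using r \<delta> by simp
  hence n0: "n > 0" using n by (auto intro: gr0I)
  define g where "g t = c + (r * cos t, r * sin t)" for t
  define I where "I i = {2 * pi * real i / real n..2 * pi * real (Suc i) / real n}" for i
  define U where "U i = (if i < n then g ` I i else {})" for i
  have lip: "dist (g a) (g b) \<le> r * \<bar>a - b\<bar>" for a b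
  proof -
    have "g a - g b = (r * (cos a - cos b), r * (sin a - sin b))" by (simp add: g_def algebra_simps)
    hence "(dist (g a) (g b))\<^sup>2 = r\<^sup>2 * ((cos a - cos b)\<^sup>2 + (sin a - sin b)\<^sup>2)"
      by (simp add: dist_norm norm_Pair power_mult_distrib distrib_left)
    also have "(cos a - cos b)\<^sup>2 + (sin a - sin b)\<^sup>2 = 2 - 2 * cos (a - b)"
      using sin_cos_squared_add[of a] sin_cos_squared_add[of b]
      by (simp add: cos_diff power2_eq_square algebra_simps)
    also have "\<dots> = (2 * sin ((a - b) / 2))\<^sup>2"
    proof -
      have "cos (a - b) = cos (2 * ((a - b) / 2))" by (simp only: mult_2 field_sum_of_halves)
      thus ?thesis unfolding cos_double_sin by (simp add: power_mult_distrib)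
    qed
    also have "\<dots> \<le> (a - b)\<^sup>2"
      using abs_sin_x_le_abs_x[of "(a - b) / 2"] by (simp only: abs_le_square_iff[symmetric]) (simp add: abs_mult)
    finally have "(dist (g a) (g b))\<^sup>2 \<le> (r * \<bar>a - b\<bar>)\<^sup>2" by (simp add: power_mult_distrib mult_left_mono)
    thus ?thesis by (rule power2_le_imp_le) (use r in simp)
  qed
  have dist_U: "dist x y \<le> 2 * pi * r / real n" if "x \<in> U i" "y \<in> U i" for x y i
  proof -
    have "x \<in> g ` I i" "y \<in> g ` I i" using that by (simp_all add: U_def split: if_splits)
    then obtain a b where ab: "a \<in> I i" "b \<in> I i" "x = g a" "y = g b" by blast
    have "\<bar>a - b\<bar> \<le> 2 * pi * real (Suc i) / real n - 2 * pi * real i / real n" using ab by (auto simp: I_def)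
    also have "\<dots> = 2 * pi / real n" by (simp add: diff_divide_distrib[symmetric] algebra_simps)
    finally have "r * \<bar>a - b\<bar> \<le> r * (2 * pi / real n)" using r by (intro mult_left_mono) auto
    thus ?thesis using lip[of a b] ab by (simp add: mult_ac)
  qed
  have diam: "diameter (U i) \<le> 2 * pi * r / real n" for i
    using dist_U r by (intro diameter_le) (auto simp: dist_norm)
  have bdd: "bounded (U i)" for i
    unfolding bounded_two_points using dist_U by blast
  have cov: "A \<subseteq> (\<Union>i. U i)"
  proof
    fix x assume "x \<in> A"
    hence x: "dist c x = r" using sub by auto
    have "((fst x - fst c) / r)\<^sup>2 + ((snd x - snd c) / r)\<^sup>2 = (dist c x)\<^sup>2 / r\<^sup>2"
      by (simp add: dist_prod_def dist_real_def power_divide add_divide_distrib power2_commute)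
    also have "\<dots> = 1" using x r by simp
    finally obtain t where t: "0 \<le> t" "t < 2 * pi" "(fst x - fst c) / r = cos t" "(snd x - snd c) / r = sin t"
      using sincos_total_2pi by metis
    have gx: "g t = x" using t(3,4) r by (simp add: g_def prod_eq_iff field_simps)
    define i where "i = nat \<lfloor>t * real n / (2 * pi)\<rfloor>"
    have nn: "0 \<le> t * real n / (2 * pi)" using t by simp
    have i1: "real i \<le> t * real n / (2 * pi)" unfolding i_def using nn by (simp add: of_nat_floor)
    have i2: "t * real n / (2 * pi) < real (Suc i)" unfolding i_def using nn by linarith
    have "t * real n / (2 * pi) < real n" using t n0 by (simp add: pos_divide_less_eq)
    hence "i < n" using i1 by linarith
    moreover have "t \<in> I i" using i1 i2 n0 by (auto simp: I_def field_simps)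
    ultimately show "x \<in> (\<Union>i. U i)" using gx by (auto simp: U_def)
  qed
  have "(\<Sum>i. ennreal (diameter (U i))) = (\<Sum>i<n. ennreal (diameter (U i)))"
    by (rule suminf_finite) (auto simp: U_def)
  also have "\<dots> \<le> (\<Sum>i<n. ennreal (2 * pi * r / real n))" by (intro sum_mono ennreal_leI diam)
  also have "\<dots> = ennreal (2 * pi * r)"
    using n0 r by (simp add: ennreal_of_nat_eq_real_of_nat flip: ennreal_mult)
  finally have sum: "(\<Sum>i. ennreal (diameter (U i))) \<le> ennreal (2 * pi * r)" .
  have "2 * pi * r / real n \<le> \<delta>" using n n0 \<delta> by (simp add: field_simps)
  hence "diameter (U i) \<le> \<delta>" for i using diam[of i] by simp
  thus "(INF U\<in>{U. A \<subseteq> (\<Union>i. U i) \<and> (\<forall>i. bounded (U i) \<and> diameter (U i) \<le> \<delta>)}. \<Sum>i. ennreal (diameter (U i)))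
      \<le> ennreal (2 * pi * r)"
    using cov bdd sum by (intro INF_lower2[of U]) auto
qed


section \<open>The initial disc\<close>

text \<open>The value 3.14 lies below \<open>pi\<close>, so that the closed translates are disjoint;
  the circumference is about 19.7, within the bound 20; and the area is large enough to make
  \<open>speed_gap\<close> positive.\<close>

definition radius :: real where "radius = 157 / 50"

definition centre :: "real \<times> real" where "centre = (radius, 0)"

definition disc :: "(real \<times> real) set" where "disc = ball centre radius"

definition shift :: "int \<Rightarrow> real \<times> real \<Rightarrow> real \<times> real" where
  "shift k x = x + of_int k *\<^sub>R (0, 2 * pi)"

definition patch :: "(real \<times> real) set" where
  "patch = {x. \<exists>k. shift k x \<in> disc}"

lemma radius_pos: "radius > 0" and radius_less_pi: "radius < pi"
  using pi_approx by (simp_all add: radius_def)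

lemma shift_shift [simp]: "shift j (shift k x) = shift (j + k) x"
  by (simp add: shift_def algebra_simps)

lemma shift_0 [simp]: "shift 0 x = x"
  by (simp add: shift_def prod_eq_iff)

lemma fst_shift [simp]: "fst (shift k x) = fst x"
  and snd_shift: "snd (shift k x) = snd x + of_int k * (2 * pi)"
  by (simp_all add: shift_def)

lemma deck_eq_shift: "deck = shift 1"
  by (auto simp: deck_def shift_def prod_eq_iff)

lemma continuous_on_shift: "continuous_on S (shift k)"
  unfolding shift_def by (intro continuous_intros)

lemma shift_in_patch_iff [simp]: "shift k x \<in> patch \<longleftrightarrow> x \<in> patch"
proof -
  have "shift k x \<in> patch" if "x \<in> patch" for k x
  proof -
    obtain j where "shift j x \<in> disc" using \<open>x \<in> patch\<close> by (auto simp: patch_def)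
    hence "shift (j - k) (shift k x) \<in> disc" by simp
    thus ?thesis unfolding patch_def by blast
  qed
  from this[of x k] this[of "shift k x" "-k"] show ?thesis by auto
qed

lemma disc_subset_patch: "disc \<subseteq> patch"
  unfolding patch_def by (auto intro!: exI[of _ 0])

lemma cball_snd_le:
  assumes "x \<in> cball centre radius"
  shows "\<bar>snd x\<bar> \<le> radius"
  using assms dist_snd_le[of centre x] by (auto simp: centre_def dist_real_def)

lemma cball_fst:
  assumes "x \<in> cball centre radius"
  shows "0 \<le> fst x" "fst x \<le> 2 * radius"
  using assms dist_fst_le[of centre x] by (auto simp: centre_def dist_real_def)

lemma disc_fst_pos: "x \<in> disc \<Longrightarrow> 0 < fst x"
  using dist_fst_le[of centre x] by (auto simp: disc_def centre_def dist_real_def)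

lemma disc_subset_cball: "disc \<subseteq> cball centre radius"
  by (auto simp: disc_def)

lemma int_zero_if_shift_small:
  assumes "\<bar>s\<bar> < 2 * pi - radius" "\<bar>s + of_int k * (2 * pi)\<bar> \<le> radius"
  shows "k = 0"
  using assms by (intro shift_in_period_unique) linarith

text \<open>As \<open>radius < pi\<close>, this strip is wider than a period, yet it misses all
  other translates of the disc. Local questions about \<open>patch\<close> thereby reduce to
  \<open>disc\<close>.\<close>

lemma patch_near_disc:
  assumes "\<bar>snd x\<bar> < 2 * pi - radius" "x \<in> patch"
  shows "x \<in> disc"
proof -
  obtain k where k: "shift k x \<in> disc" using assms by (auto simp: patch_def)
  hence "\<bar>snd x + of_int k * (2 * pi)\<bar> \<le> radius"
    using cball_snd_le[of "shift k x"] disc_subset_cball by (auto simp: snd_shift)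
  hence "k = 0" by (rule int_zero_if_shift_small[OF assms(1)])
  thus ?thesis using k by simp
qed

lemma cball_shift_unique:
  assumes "x \<in> cball centre radius" "shift k x \<in> cball centre radius"
  shows "k = 0"
  using cball_snd_le[OF assms(1)] cball_snd_le[OF assms(2)] radius_less_pi
  by (intro int_zero_if_shift_small[of "snd x"]) (auto simp: snd_shift)

lemma open_patch: "open patch"
proof -
  have eq: "patch = (\<Union>k. shift k -` disc)" unfolding patch_def by blast
  have "open (shift k -` disc)" for k
    by (intro open_vimage continuous_on_shift) (simp add: disc_def)
  thus ?thesis unfolding eq by (intro open_UN) blast
qed

lemma patch_fst:
  assumes "x \<in> patch"
  shows "0 < fst x" "fst x \<le> 2 * radius"
proof -
  obtain k where "shift k x \<in> disc" using assms by (auto simp: patch_def)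
  thus "0 < fst x" "fst x \<le> 2 * radius"
    using disc_fst_pos[of "shift k x"] cball_fst(2)[of "shift k x"] disc_subset_cball by auto
qed

lemma patch_subset_S_plus: "patch \<subseteq> S_plus"
  unfolding S_plus_def using patch_fst(1) by blast

lemma periodic_patch: "periodic_set patch"
  by (simp add: periodic_set_def deck_eq_shift)

lemma cyl_bounded_patch: "cyl_bounded patch"
  unfolding cyl_bounded_def
proof (rule bounded_subset[of "{0..2 * radius}"])
  show "fst ` patch \<subseteq> {0..2 * radius}"
  proof (rule image_subsetI)
    fix x assume "x \<in> patch"
    thus "fst x \<in> {0..2 * radius}" using patch_fst[of x] by simp
  qed
qed simp

lemma exists_shift_period: "\<exists>k. -pi \<le> snd (shift k x) \<and> snd (shift k x) < pi"
  using exists_shift_in_period[of "snd x"] by (simp add: snd_shift)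

lemma closure_shift:
  assumes "x \<in> closure S" "\<And>y. y \<in> S \<Longrightarrow> shift k y \<in> T"
  shows "shift k x \<in> closure T"
proof -
  have "shift k ` closure S \<subseteq> closure (shift k ` S)"
    by (rule image_closure_subset[OF continuous_on_shift closed_closure closure_subset])
  moreover have "closure (shift k ` S) \<subseteq> closure T" using assms(2) by (intro closure_mono) auto
  ultimately show ?thesis using assms(1) by blast
qed

text \<open>For an infinite union this rests on local finiteness: every point has a translate in the
  strip of \<open>patch_near_disc\<close>, where a single disc is visible.\<close>

lemma frontier_patch: "frontier patch = {x. \<exists>k. shift k x \<in> sphere centre radius}"
proof (intro set_eqI iffI)
  fix x assume x: "x \<in> frontier patch"
  hence xc: "x \<in> closure patch" "x \<notin> patch" using open_patch by (auto simp: frontier_def interior_open)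
  obtain k where k: "-pi \<le> snd (shift k x)" "snd (shift k x) < pi" using exists_shift_period by blast
  let ?U = "{x :: real \<times> real. \<bar>snd x\<bar> < 2 * pi - radius}"
  have "open ?U" by (intro open_Collect_less continuous_intros)
  moreover have "shift k x \<in> closure patch" using xc(1) by (rule closure_shift) simp
  moreover have "shift k x \<in> ?U" using k radius_less_pi by auto
  ultimately have "shift k x \<in> closure (?U \<inter> patch)" by (metis IntI open_Int_closure_subset subsetD)
  also have "closure (?U \<inter> patch) \<subseteq> cball centre radius"
    using patch_near_disc disc_subset_cball by (intro closure_minimal) auto
  finally have "shift k x \<in> cball centre radius" .
  moreover have "shift k x \<notin> disc" using xc(2) disc_subset_patch shift_in_patch_iff by blast
  ultimately have "shift k x \<in> sphere centre radius" by (auto simp: disc_def)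
  thus "x \<in> {x. \<exists>k. shift k x \<in> sphere centre radius}" by blast
next
  fix x assume "x \<in> {x. \<exists>k. shift k x \<in> sphere centre radius}"
  then obtain k where k: "shift k x \<in> sphere centre radius" by blast
  have "shift k x \<in> closure disc" using k radius_pos by (simp add: disc_def)
  hence "shift (-k) (shift k x) \<in> closure patch"
    by (rule closure_shift) (use disc_subset_patch in auto)
  hence "x \<in> closure patch" by simp
  moreover have "x \<notin> patch"
  proof
    assume "x \<in> patch"
    hence "shift k x \<in> patch" by simp
    hence "shift k x \<in> disc"
      using cball_snd_le[of "shift k x"] k radius_less_pi by (intro patch_near_disc) auto
    thus False using k by (simp add: disc_def)
  qed
  ultimately show "x \<in> frontier patch" using open_patch by (simp add: frontier_def interior_open)
qed

section \<open>Smoothness, connectedness and length of the initial boundary\<close>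

lemma Ck_on_const: "Ck_on k U (\<lambda>x. c)"
  by (induction k arbitrary: c) auto

lemma Ck_on_inner_linear: "Ck_on k U (\<lambda>x :: 'a::real_inner. c * ((x - b) \<bullet> w))"
proof (cases k)
  case (Suc n)
  have der: "((\<lambda>x. c * ((x - b) \<bullet> w)) has_derivative (\<lambda>v. c * (v \<bullet> w))) (at x)" for x
    by (auto intro!: derivative_eq_intros)
  have "(\<lambda>x. c * ((x - b) \<bullet> w)) differentiable_on U"
    using der by (auto simp: differentiable_on_def differentiable_def intro: has_derivative_at_withinI)
  thus ?thesis using Suc by (simp add: frechet_derivative_at[OF der, symmetric] Ck_on_const)
qed (auto intro!: continuous_intros)

lemma smooth_on_dist_sq: "smooth_on U (\<lambda>x :: 'a::real_inner. (x - b) \<bullet> (x - b) - c)"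
  and frechet_derivative_dist_sq:
    "frechet_derivative (\<lambda>x :: 'a::real_inner. (x - b) \<bullet> (x - b) - c) (at x) = (\<lambda>v. 2 * ((x - b) \<bullet> v))"
proof -
  have der: "((\<lambda>x. (x - b) \<bullet> (x - b) - c) has_derivative (\<lambda>v. 2 * ((x - b) \<bullet> v))) (at x)" for x :: 'a
    by (auto intro!: derivative_eq_intros simp: fun_eq_iff inner_commute)
  thus fd: "frechet_derivative (\<lambda>x :: 'a. (x - b) \<bullet> (x - b) - c) (at x) = (\<lambda>v. 2 * ((x - b) \<bullet> v))" for x
    by (rule frechet_derivative_at[symmetric])
  have "Ck_on k U (\<lambda>x :: 'a. (x - b) \<bullet> (x - b) - c)" for k
  proof (cases k)
    case (Suc n)
    have "(\<lambda>x. (x - b) \<bullet> (x - b) - c) differentiable_on U"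
      using der by (auto simp: differentiable_on_def differentiable_def intro: has_derivative_at_withinI)
    thus ?thesis using Suc by (simp add: fd Ck_on_inner_linear)
  qed (auto intro!: continuous_intros)
  thus "smooth_on U (\<lambda>x :: 'a. (x - b) \<bullet> (x - b) - c)" by (simp add: smooth_on_def)
qed

lemma smooth_boundary_patch: "smooth_boundary patch"
  unfolding smooth_boundary_def
proof
  fix p assume "p \<in> frontier patch"
  then obtain k where k: "shift k p \<in> sphere centre radius" by (auto simp: frontier_patch)
  define b where "b = centre - of_int k *\<^sub>R (0, 2 * pi)"
  have xb: "x - b = shift k x - centre" for x by (simp add: b_def shift_def)
  define f where "f x = (x - b) \<bullet> (x - b) - radius\<^sup>2" for x
  \<comment> \<open>The strip isolates one disc; its centre is removed because \<open>f\<close> has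
    its only critical point there.\<close>
  define U where "U = {x. \<bar>snd (shift k x)\<bar> < 2 * pi - radius} \<inter> {x. shift k x \<noteq> centre}"
  show "\<exists>U f. open U \<and> p \<in> U \<and> smooth_on U f \<and> (\<forall>x\<in>U. \<exists>v. frechet_derivative f (at x) v \<noteq> 0) \<and>
      patch \<inter> U = {x \<in> U. f x < 0}"
  proof (intro exI conjI)
    show "open U" unfolding U_def
      by (intro open_Int open_Collect_less open_Collect_neq continuous_intros continuous_on_shift)
    show "p \<in> U"
      using k radius_pos radius_less_pi cball_snd_le[of "shift k p"] by (auto simp: U_def)
    show "smooth_on U f" unfolding f_def by (rule smooth_on_dist_sq)
    show "\<forall>x\<in>U. \<exists>v. frechet_derivative f (at x) v \<noteq> 0"
    proof
      fix x assume "x \<in> U"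
      hence "(x - b) \<bullet> (x - b) \<noteq> 0" by (simp add: U_def xb)
      hence "frechet_derivative f (at x) (x - b) \<noteq> 0" unfolding f_def frechet_derivative_dist_sq by simp
      thus "\<exists>v. frechet_derivative f (at x) v \<noteq> 0" by blast
    qed
    have "x \<in> patch \<longleftrightarrow> f x < 0" if x: "x \<in> U" for x
    proof -
      have "x \<in> patch \<longleftrightarrow> shift k x \<in> patch" by simp
      also have "\<dots> \<longleftrightarrow> shift k x \<in> disc"
        using patch_near_disc[of "shift k x"] disc_subset_patch x by (auto simp: U_def)
      also have "\<dots> \<longleftrightarrow> norm (shift k x - centre) < radius" by (simp add: disc_def dist_norm norm_minus_commute)
      also have "\<dots> \<longleftrightarrow> (norm (shift k x - centre))\<^sup>2 < radius\<^sup>2"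
        using radius_pos by (auto intro: power_strict_mono power_less_imp_less_base)
      also have "\<dots> \<longleftrightarrow> f x < 0" by (simp add: f_def xb power2_norm_eq_inner)
      finally show ?thesis .
    qed
    thus "patch \<inter> U = {x \<in> U. f x < 0}" by blast
  qed
qed

text \<open>In the plane the frontier is an infinite family of disjoint circles; all of them project
  onto the same circle of the cylinder.\<close>

lemma cyl_connected_frontier_patch: "cyl_connected (frontier patch)"
proof -
  have proj: "cyl_proj (shift k x) = cyl_proj x" for k x
  proof -
    have "cis (snd x + of_int k * (2 * pi)) = cis (snd x)"
      using sin.plus_of_int[of "snd x" k] cos.plus_of_int[of "snd x" k] by (simp add: complex_eq_iff)
    thus ?thesis by (simp add: cyl_proj_def snd_shift)
  qed
  have "cyl_proj ` frontier patch \<subseteq> cyl_proj ` sphere centre radius"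
  proof (rule image_subsetI)
    fix x assume "x \<in> frontier patch"
    then obtain k where "shift k x \<in> sphere centre radius" unfolding frontier_patch by blast
    hence "cyl_proj (shift k x) \<in> cyl_proj ` sphere centre radius" by (rule imageI)
    thus "cyl_proj x \<in> cyl_proj ` sphere centre radius" by (simp only: proj)
  qed
  moreover have "sphere centre radius \<subseteq> frontier patch"
    unfolding frontier_patch by (rule subsetI, rule CollectI, rule exI[of _ 0]) simp
  ultimately have eq: "cyl_proj ` frontier patch = cyl_proj ` sphere centre radius" by blast
  have "continuous_on (sphere centre radius) cyl_proj"
    unfolding cyl_proj_def by (intro continuous_intros)
  moreover have "connected (sphere centre radius)" by (rule connected_sphere) simp
  ultimately show ?thesis unfolding cyl_connected_def eq by (rule connected_continuous_image)
qed

lemma cyl_length_frontier_patch: "cyl_length (frontier patch) \<le> 20"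
proof -
  have "frontier patch \<inter> one_period \<subseteq> sphere centre radius"
  proof
    fix x assume x: "x \<in> frontier patch \<inter> one_period"
    then obtain k where k: "shift k x \<in> sphere centre radius" by (auto simp: frontier_patch)
    have "\<bar>snd x\<bar> < 2 * pi - radius" using x radius_less_pi by (auto simp: one_period_def)
    moreover have "\<bar>snd x + of_int k * (2 * pi)\<bar> \<le> radius"
      using cball_snd_le[of "shift k x"] k by (auto simp: snd_shift)
    ultimately have "k = 0" by (rule int_zero_if_shift_small)
    thus "x \<in> sphere centre radius" using k by simp
  qed
  hence "cyl_length (frontier patch) \<le> ennreal (2 * pi * radius)"
    unfolding cyl_length_def by (rule hausdorff1_circle_le[OF radius_pos])
  also have "\<dots> \<le> ennreal 20"
    using pi_approx by (intro ennreal_leI) (simp add: radius_def)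
  finally show ?thesis by simp
qed

lemma origin_in_sphere: "(0, 0) \<in> sphere centre radius"
  using radius_pos by (simp add: centre_def dist_Pair_Pair)

lemma frontier_patch_meets_boundary: "frontier patch \<inter> S_plus_boundary \<noteq> {}"
proof -
  have "(0, 0) \<in> frontier patch" unfolding frontier_patch using origin_in_sphere by (auto intro!: exI[of _ 0])
  thus ?thesis by (auto simp: S_plus_boundary_def)
qed

lemma emeasure_disc: "emeasure lborel disc = ennreal (pi * radius\<^sup>2)"
  using emeasure_ball[of radius centre] radius_pos by (simp add: disc_def unit_ball_vol_2 power2_eq_square)

text \<open>
  The bounds for the wall speed and for the mean speed of the patch, with area \<open>\<pi> radius\<^sup>2\<close>. The
  difference is positive only for a disc nearly as wide as the period: already \<open>radius = 3\<close> fails.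
\<close>

definition speed_gap :: real where
  "speed_gap = (radius\<^sup>2 / 2 - 2 * ln 2) - (radius\<^sup>2 / 4 + 1/2 - ln (1 - exp (-1)))"

lemma speed_gap_pos: "speed_gap > 0"
proof -
  have "ln (2 :: real) \<le> 25/36" by (rule ln2_le_25_over_36)
  moreover have "ln (1 - exp (-1 :: real)) > - 57/100"
  proof -
    have e: "exp (1 :: real) \<ge> 27/10"
    proof -
      have "(\<Sum>k<5. 1 / fact k) \<le> (\<Sum>k. 1 / fact k :: real)"
        using summable_exp[of "1::real"] by (intro sum_le_suminf) (auto simp: divide_inverse mult.commute)
      also have "\<dots> = exp 1" by (simp add: exp_def divide_inverse)
      finally show ?thesis by (simp add: eval_nat_numeral)
    qed
    have "exp (-1 :: real) \<le> 10/27" using e by (simp add: exp_minus field_simps)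
    \<comment> \<open>793/1000 is just below the square root of 17/27. The bound
      \<open>ln x \<le> x - 1\<close> applied directly to 27/17 would give 10/17, which is too weak;
      after taking a square root it gives 414/793.\<close>
    hence "(793/1000)\<^sup>2 \<le> 1 - exp (-1 :: real)" by (simp add: power2_eq_square)
    hence "ln ((793/1000)\<^sup>2) \<le> ln (1 - exp (-1 :: real))" by (intro ln_mono) auto
    moreover have "ln ((793/1000 :: real)\<^sup>2) = - 2 * ln (1000/793)"
      by (simp add: ln_realpow ln_div)
    moreover have "ln (1000/793 :: real) \<le> 1000/793 - 1" by (rule ln_le_minus_one) simp
    ultimately show ?thesis by simp
  qed
  ultimately show ?thesis by (simp add: speed_gap_def radius_def power2_eq_square)
qed


section \<open>The flow of the disc\<close>

text \<open>Point reflection in the centre changes the sign of the integrand. The mean height thus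
  starts at 0, level with the point of contact.\<close>

lemma integral_disc_snd:
  "(\<integral>x. indicator disc x * snd x \<partial>lborel) = (0 :: real)"
proof -
  let ?f = "\<lambda>x. indicator disc x * snd x :: real"
  have snd_m: "(snd :: real \<times> real \<Rightarrow> real) \<in> borel_measurable borel"
    by (intro borel_measurable_continuous_onI continuous_intros)
  have disc_m: "disc \<in> sets borel" by (simp add: disc_def)
  have m: "?f \<in> borel_measurable borel" using snd_m disc_m by measurable
  have "lborel = distr lborel borel (\<lambda>x. 2 *\<^sub>R centre - x)"
    using lborel_affine[of "-1" "2 *\<^sub>R centre"] by (simp add: density_1)
  hence "(\<integral>x. ?f x \<partial>lborel) = (\<integral>x. ?f x \<partial>distr lborel borel (\<lambda>x. 2 *\<^sub>R centre - x))" by simp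
  also have "\<dots> = (\<integral>x. ?f (2 *\<^sub>R centre - x) \<partial>lborel)"
    using m by (intro integral_distr) auto
  also have "\<dots> = (\<integral>x. - ?f x \<partial>lborel)"
  proof (rule Bochner_Integration.integral_cong[OF refl])
    fix x
    have "centre - (2 *\<^sub>R centre - x) = - (centre - x)" by (simp add: scaleR_2)
    hence "dist centre (2 *\<^sub>R centre - x) = dist centre x" by (simp only: dist_norm norm_minus_cancel)
    hence "2 *\<^sub>R centre - x \<in> disc \<longleftrightarrow> x \<in> disc" by (simp add: disc_def)
    thus "?f (2 *\<^sub>R centre - x) = - ?f x" by (simp add: indicator_def centre_def)
  qed
  finally show ?thesis by simp
qed

lemma increment_ge_derivative_bound:
  fixes f :: "real \<Rightarrow> real"
  assumes "\<And>t. 0 \<le> t \<Longrightarrow> (f has_vector_derivative f' t) (at t within {0..})"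
    and "\<And>t. 0 \<le> t \<Longrightarrow> c \<le> f' t" and "0 \<le> t"
  shows "c * t \<le> f t - f 0"
proof -
  have "(f' has_integral (f t - f 0)) {0..t}"
  proof (rule fundamental_theorem_of_calculus[OF assms(3)])
    fix x assume "x \<in> {0..t}"
    thus "(f has_vector_derivative f' x) (at x within {0..t})"
      by (intro has_vector_derivative_within_subset[OF assms(1)]) auto
  qed
  moreover have const: "((\<lambda>_. c) has_integral (c * t)) {0..t}"
    using has_integral_const_real[of c 0 t] assms(3) by (simp add: mult.commute)
  ultimately show ?thesis using has_integral_le[OF const] assms(2) by auto
qed

lemma norm_fst_le': "norm (fst z) \<le> norm z"
  by (cases z) (simp add: norm_fst_le)

lemma S_plus_closed_closed: "closed S_plus_closed"
  unfolding S_plus_closed_def by (intro closed_Collect_le continuous_intros)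

lemma cball_subset_S_plus_closed: "cball centre radius \<subseteq> S_plus_closed"
  unfolding S_plus_closed_def using cball_fst(1) by blast

lemma disc_subset_S_plus_closed: "disc \<subseteq> S_plus_closed"
  using disc_subset_cball cball_subset_S_plus_closed by blast

lemma patch_subset_S_plus_closed: "patch \<subseteq> S_plus_closed"
  using patch_subset_S_plus by (auto simp: S_plus_def S_plus_closed_def)

lemma shift_in_S_plus_closed: "shift k x \<in> S_plus_closed \<longleftrightarrow> x \<in> S_plus_closed"
  by (simp add: S_plus_closed_def)

locale patch_flow =
  fixes \<Phi> :: "real \<Rightarrow> real \<times> real \<Rightarrow> real \<times> real"
  assumes flow: "euler_patch_flow patch \<Phi>"
begin

definition E :: "real \<Rightarrow> (real \<times> real) set" where "E t = \<Phi> t ` patch \<inter> S_plus_period"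

definition u :: "real \<Rightarrow> real \<times> real \<Rightarrow> real \<times> real" where
  "u t x = (LINT y:E t|lborel. K x y)"

lemma biot_savart_eq_u: "biot_savart (indicator (\<Phi> t ` patch)) = u t"
  unfolding biot_savart_def u_def E_def set_lebesgue_integral_def
  by (intro ext Bochner_Integration.integral_cong) (auto simp: indicator_def)

lemma \<Phi>_0: "x \<in> S_plus_closed \<Longrightarrow> \<Phi> 0 x = x"
  and \<Phi>_in: "0 \<le> t \<Longrightarrow> x \<in> S_plus_closed \<Longrightarrow> \<Phi> t x \<in> S_plus_closed"
  and \<Phi>_deck: "0 \<le> t \<Longrightarrow> x \<in> S_plus_closed \<Longrightarrow> \<Phi> t (deck x) = deck (\<Phi> t x)"
  and \<Phi>_derivative: "0 \<le> t \<Longrightarrow> x \<in> S_plus_closed \<Longrightarrow>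
    ((\<lambda>s. \<Phi> s x) has_vector_derivative u t (\<Phi> t x)) (at t within {0..})"
  using flow by (auto simp: euler_patch_flow_def flow_map_def Let_def biot_savart_eq_u)

lemma \<Phi>_shift:
  assumes "0 \<le> t" "x \<in> S_plus_closed"
  shows "\<Phi> t (shift k x) = shift k (\<Phi> t x)"
proof -
  have nat: "\<Phi> t (shift (int n) x) = shift (int n) (\<Phi> t x)" if "x \<in> S_plus_closed" for n x
  proof (induction n)
    case (Suc n)
    have "\<Phi> t (shift (int (Suc n)) x) = \<Phi> t (deck (shift (int n) x))" by (simp add: deck_eq_shift)
    also have "\<dots> = deck (\<Phi> t (shift (int n) x))"
      using assms(1) that by (intro \<Phi>_deck) (simp_all add: shift_in_S_plus_closed)
    also have "\<dots> = shift (int (Suc n)) (\<Phi> t x)" unfolding Suc.IH by (simp add: deck_eq_shift)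
    finally show ?case .
  qed simp
  show ?thesis
  proof (cases "k \<ge> 0")
    case True
    thus ?thesis using nat[OF assms(2), of "nat k"] by simp
  next
    case False
    define n where "n = nat (-k)"
    have k: "k = - int n" using False by (simp add: n_def)
    have "\<Phi> t x = \<Phi> t (shift (int n) (shift k x))" by (simp add: k)
    also have "\<dots> = shift (int n) (\<Phi> t (shift k x))"
      using assms(2) by (intro nat) (simp add: shift_in_S_plus_closed)
    finally show ?thesis by (simp add: k)
  qed
qed

text \<open>At this stage \<open>\<Phi> t\<close> is not known to be continuous; measurability of
  the slice comes from the joint measurability of the weak solution by fixing
  \<open>t\<close>.\<close>

lemma E_sets: "E t \<in> sets borel" if "0 \<le> t"
proof -
  let ?h = "\<lambda>p :: real \<times> real \<times> real.
    indicator ({0..} \<times> S_plus_period) p *\<^sub>R (indicator (\<Phi> (fst p) ` patch) (snd p) :: real)"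
  have "?h \<in> borel_measurable borel"
    using flow by (simp add: euler_patch_flow_def euler_weak_solution_def set_borel_measurable_def Let_def)
  moreover have "(\<lambda>x. (t, x)) \<in> borel_measurable (borel :: (real \<times> real) measure)"
    by (intro borel_measurable_continuous_onI continuous_intros)
  ultimately have "(\<lambda>x. ?h (t, x)) \<in> borel_measurable borel" by (rule measurable_compose[rotated])
  also have "(\<lambda>x. ?h (t, x)) = indicator (E t)"
    using that by (auto simp: fun_eq_iff E_def indicator_def)
  finally show ?thesis by (simp add: borel_measurable_indicator_iff)
qed

lemma E_subset: "E t \<subseteq> S_plus_period"
  by (auto simp: E_def)

lemma vorticity_set_E:
  assumes "0 \<le> t" "emeasure lborel (E t) = ennreal a" "0 \<le> a"
  shows "vorticity_set (E t) a"
  using assms E_sets E_subset by unfold_locales auto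

lemma vel_E: "vorticity_set (E t) a \<Longrightarrow> vorticity_set.vel (E t) = u t"
  by (simp add: fun_eq_iff vorticity_set.vel_def u_def)

definition modulus_at :: "real \<Rightarrow> real \<Rightarrow> real \<Rightarrow> bool" where
  "modulus_at C e t \<longleftrightarrow>
     (\<forall>x x'. norm (u t x - u t x') \<le> C / e * norm (x - x') powr (1 - e)) \<and> (\<forall>d. fst (u t (0, d)) = 0)"

text \<open>\<open>C\<close> comes from the mass bound and is fixed before \<open>e\<close>, as the
  limit of small \<open>e\<close> demands. The exceptional set of times may vary with
  \<open>e\<close>, since the differential inequality is integrated for one exponent at a
  time.\<close>

lemma AE_modulus: "\<exists>C>0. \<forall>e. 0 < e \<longrightarrow> e \<le> 1 \<longrightarrow> (AE t in lborel. 0 < t \<longrightarrow> modulus_at C e t)"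
proof -
  obtain M where M: "AE t in lborel. 0 < t \<longrightarrow>
        set_integrable lborel S_plus_period (indicator (\<Phi> t ` patch) :: _ \<Rightarrow> real) \<and>
        (LINT x:S_plus_period|lborel. \<bar>indicator (\<Phi> t ` patch) x :: real\<bar>) \<le> M"
  proof -
    have "euler_weak_solution (indicator patch) (\<lambda>t. indicator (\<Phi> t ` patch))"
      using flow by (simp add: euler_patch_flow_def Let_def)
    then obtain M where "AE t in lborel. 0 < t \<longrightarrow>
        set_integrable lborel S_plus_period (indicator (\<Phi> t ` patch) :: _ \<Rightarrow> real) \<and>
        (LINT x:S_plus_period|lborel. \<bar>indicator (\<Phi> t ` patch) x :: real\<bar>) \<le> M \<and>
        (AE x in lborel. x \<in> S_plus_period \<longrightarrow> \<bar>indicator (\<Phi> t ` patch) x :: real\<bar> \<le> M)"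
      unfolding euler_weak_solution_def by blast
    hence "AE t in lborel. 0 < t \<longrightarrow>
        set_integrable lborel S_plus_period (indicator (\<Phi> t ` patch) :: _ \<Rightarrow> real) \<and>
        (LINT x:S_plus_period|lborel. \<bar>indicator (\<Phi> t ` patch) x :: real\<bar>) \<le> M"
      by eventually_elim blast
    thus thesis by (rule that)
  qed
  define C where "C = 14 * max M 0 + 64 * pi"
  show ?thesis
  proof (intro exI[of _ C] conjI allI impI)
    show "C > 0" by (simp add: C_def add_nonneg_pos)
    fix e :: real assume e: "0 < e" "e \<le> 1"
    show "AE t in lborel. 0 < t \<longrightarrow> modulus_at C e t"
      using M
    proof eventually_elim
      case (elim t)
      show ?case
      proof
        assume t: "0 < t"
        have ind: "(\<lambda>x. indicator S_plus_period x *\<^sub>R (indicator (\<Phi> t ` patch) x :: real)) = indicator (E t)"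
          by (auto simp: fun_eq_iff E_def indicator_def)
        have int: "integrable lborel (indicator (E t) :: _ \<Rightarrow> real)"
          using elim t unfolding set_integrable_def ind by simp
        have Es: "E t \<in> sets lborel" using E_sets[of t] t by simp
        have fin: "emeasure lborel (E t) < \<infinity>" using int Es by (simp add: integrable_indicator_iff)
        have meas: "measure lborel (E t) \<le> M"
        proof -
          have "(\<lambda>x. indicator S_plus_period x *\<^sub>R \<bar>indicator (\<Phi> t ` patch) x :: real\<bar>) = indicator (E t)"
            by (auto simp: fun_eq_iff E_def indicator_def)
          hence "(LINT x:S_plus_period|lborel. \<bar>indicator (\<Phi> t ` patch) x :: real\<bar>) = measure lborel (E t)"
            unfolding set_lebesgue_integral_def by simp
          thus ?thesis using elim t by simp
        qed
        interpret V: vorticity_set "E t" "measure lborel (E t)"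
          using t fin by (intro vorticity_set_E) (auto simp: emeasure_eq_ennreal_measure)
        have u: "u t = V.vel" by (rule vel_E[OF V.vorticity_set_axioms, symmetric])
        have "V.C \<le> C" using meas by (simp add: V.C_def C_def)
        hence "V.C / e * norm (x - x') powr (1 - e) \<le> C / e * norm (x - x') powr (1 - e)" for x x' :: "real \<times> real"
          using e by (intro mult_right_mono divide_right_mono) auto
        thus "modulus_at C e t"
          unfolding modulus_at_def u using V.norm_vel_diff_le[OF e] V.fst_vel_wall by (blast intro: order_trans)
      qed
    qed
  qed
qed

text \<open>With \<open>s = 0\<close> this gives continuity of the flow map at time
  \<open>t\<close>; with the roles exchanged it gives injectivity.\<close>

lemma flow_modulus:
  assumes st: "0 \<le> s" "0 \<le> t" and \<delta>: "0 < \<delta>"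
  shows "\<exists>\<delta>'>0. \<forall>x\<in>S_plus_closed. \<forall>x'\<in>S_plus_closed.
    dist (\<Phi> s x) (\<Phi> s x') < \<delta>' \<longrightarrow> dist (\<Phi> t x) (\<Phi> t x') < \<delta>"
proof -
  obtain C where C: "C > 0"
    and bd: "\<And>e. 0 < e \<Longrightarrow> e \<le> 1 \<Longrightarrow> AE t in lborel. 0 < t \<longrightarrow> modulus_at C e t"
    using AE_modulus by blast
  have "\<exists>\<delta>'>0. \<forall>i\<in>S_plus_closed \<times> S_plus_closed.
      norm (\<Phi> s (fst i) - \<Phi> s (snd i)) < \<delta>' \<longrightarrow> norm (\<Phi> t (fst i) - \<Phi> t (snd i)) < \<delta>"
  proof (rule osgood_uniform[OF _ C _ st \<delta>])
    fix i :: "(real \<times> real) \<times> (real \<times> real)" and e s t :: real assume e: "0 < e" "e \<le> 1" and st: "0 \<le> s" "0 \<le> (t::real)"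
      and i: "i \<in> S_plus_closed \<times> S_plus_closed"
    show "norm (\<Phi> t (fst i) - \<Phi> t (snd i)) powr e \<le> norm (\<Phi> s (fst i) - \<Phi> s (snd i)) powr e + C * \<bar>t - s\<bar>"
    proof (rule osgood_modulus[where Z' = "\<lambda>t. u t (\<Phi> t (fst i)) - u t (\<Phi> t (snd i))"])
      show "((\<lambda>t. \<Phi> t (fst i) - \<Phi> t (snd i)) has_vector_derivative u t (\<Phi> t (fst i)) - u t (\<Phi> t (snd i))) (at t within {0..})"
        if "0 \<le> t" for t
        using that i by (intro has_vector_derivative_diff \<Phi>_derivative) auto
      show "AE t in lborel. 0 < t \<longrightarrow> norm (u t (\<Phi> t (fst i)) - u t (\<Phi> t (snd i)))
          \<le> C / e * norm (\<Phi> t (fst i) - \<Phi> t (snd i)) powr (1 - e)"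
        using bd[OF e] by eventually_elim (unfold modulus_at_def, blast)
    qed (use C e st in auto)
  qed auto
  thus ?thesis by (force simp: dist_norm)
qed

text \<open>The normal velocity at a point is compared with that at its foot on the wall, which is
  0. The distance to the wall therefore obeys the same Osgood inequality and, starting at 0, stays
  0.\<close>

lemma \<Phi>_wall:
  assumes "0 \<le> t"
  shows "fst (\<Phi> t (0, d)) = 0"
proof -
  obtain C where C: "C > 0"
    and bd: "\<And>e. 0 < e \<Longrightarrow> e \<le> 1 \<Longrightarrow> AE t in lborel. 0 < t \<longrightarrow> modulus_at C e t"
    using AE_modulus by blast
  have x: "(0, d) \<in> S_plus_closed" by (simp add: S_plus_closed_def)
  have "norm (fst (\<Phi> t (0, d))) < \<delta>" if \<delta>: "0 < \<delta>" for \<delta>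
  proof -
    have "\<exists>\<delta>'>0. \<forall>i\<in>{(0, d)}. norm (fst (\<Phi> 0 i)) < \<delta>' \<longrightarrow> norm (fst (\<Phi> t i)) < \<delta>"
    proof (rule osgood_uniform[OF _ C _ order_refl assms \<delta>])
      fix i :: "real \<times> real" and e s t :: real assume e: "0 < e" "e \<le> 1" and st: "0 \<le> s" "0 \<le> (t::real)" and i: "i \<in> {(0, d)}"
      show "norm (fst (\<Phi> t i)) powr e \<le> norm (fst (\<Phi> s i)) powr e + C * \<bar>t - s\<bar>"
      proof (rule osgood_modulus[where Z' = "\<lambda>t. fst (u t (\<Phi> t i))"])
        show "((\<lambda>t. fst (\<Phi> t i)) has_vector_derivative fst (u t (\<Phi> t i))) (at t within {0..})" if "0 \<le> t" for t
          using bounded_linear.has_vector_derivative[OF bounded_linear_fst \<Phi>_derivative[OF that x]] i by simp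
        show "AE t in lborel. 0 < t \<longrightarrow> norm (fst (u t (\<Phi> t i))) \<le> C / e * norm (fst (\<Phi> t i)) powr (1 - e)"
          using bd[OF e]
        proof eventually_elim
          case (elim t)
          show ?case
          proof
            assume "0 < t"
            hence el: "norm (u t (\<Phi> t i) - u t (0, snd (\<Phi> t i))) \<le> C / e * norm (\<Phi> t i - (0, snd (\<Phi> t i))) powr (1 - e)"
              "fst (u t (0, snd (\<Phi> t i))) = 0" using elim unfolding modulus_at_def by blast+
            have "fst (u t (\<Phi> t i)) = fst (u t (\<Phi> t i) - u t (0, snd (\<Phi> t i)))" using el(2) by simp
            also have "norm \<dots> \<le> norm (u t (\<Phi> t i) - u t (0, snd (\<Phi> t i)))" by (rule norm_fst_le')
            also have "\<Phi> t i - (0, snd (\<Phi> t i)) = (fst (\<Phi> t i), 0)" by (simp add: prod_eq_iff)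
            ultimately show "norm (fst (u t (\<Phi> t i))) \<le> C / e * norm (fst (\<Phi> t i)) powr (1 - e)"
              using el(1) by simp
          qed
        qed
      qed (use C e st in auto)
    qed auto
    moreover have "fst (\<Phi> 0 (0, d)) = 0" using \<Phi>_0[OF x] by simp
    ultimately show ?thesis by auto
  qed
  thus ?thesis by (metis less_irrefl norm_eq_zero zero_less_norm_iff)
qed

lemma \<Phi>_inj: "inj_on (\<Phi> t) S_plus_closed" if "0 \<le> t"
proof (rule inj_onI)
  fix x y assume xy: "x \<in> S_plus_closed" "y \<in> S_plus_closed" "\<Phi> t x = \<Phi> t y"
  have "dist x y < \<delta>" if "0 < \<delta>" for \<delta>
    using flow_modulus[OF \<open>0 \<le> t\<close> order_refl that] xy by (auto simp: \<Phi>_0)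
  thus "x = y" by (metis less_irrefl zero_less_dist_iff)
qed

lemma \<Phi>_continuous: "continuous_on S_plus_closed (\<Phi> t)" if "0 \<le> t"
  unfolding continuous_on_iff
proof (intro ballI allI impI)
  fix x and e :: real assume "x \<in> S_plus_closed" "0 < e"
  thus "\<exists>d>0. \<forall>x'\<in>S_plus_closed. dist x' x < d \<longrightarrow> dist (\<Phi> t x') (\<Phi> t x) < e"
    using flow_modulus[OF order_refl that \<open>0 < e\<close>] by (auto simp: \<Phi>_0)
qed

lemma open_image_disc: "open (\<Phi> t ` disc)" if "0 \<le> t"
  using \<Phi>_inj[OF that] \<Phi>_continuous[OF that] disc_subset_S_plus_closed
  by (intro invariance_of_domain) (auto simp: disc_def intro: inj_on_subset continuous_on_subset)

lemma image_patch: "\<Phi> t ` patch = (\<Union>k. shift k ` (\<Phi> t ` disc))" if "0 \<le> t"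
proof (intro equalityI subsetI)
  fix y assume "y \<in> \<Phi> t ` patch"
  then obtain x where x: "x \<in> patch" "y = \<Phi> t x" by blast
  then obtain k where k: "shift k x \<in> disc" unfolding patch_def by blast
  have "y = \<Phi> t (shift (-k) (shift k x))" using x by simp
  also have "\<dots> = shift (-k) (\<Phi> t (shift k x))"
    using that k disc_subset_S_plus_closed by (intro \<Phi>_shift) auto
  finally show "y \<in> (\<Union>k. shift k ` (\<Phi> t ` disc))" using k by blast
next
  fix y assume "y \<in> (\<Union>k. shift k ` (\<Phi> t ` disc))"
  then obtain k x where x: "x \<in> disc" "y = shift k (\<Phi> t x)" by blast
  hence "y = \<Phi> t (shift k x)" using that disc_subset_S_plus_closed by (subst \<Phi>_shift) auto
  moreover have "shift k x \<in> patch" using x disc_subset_patch by auto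
  ultimately show "y \<in> \<Phi> t ` patch" by blast
qed

lemma open_image_patch: "open (\<Phi> t ` patch)" if "0 \<le> t"
proof -
  have "shift k ` (\<Phi> t ` disc) = (+) (of_int k *\<^sub>R (0, 2 * pi)) ` (\<Phi> t ` disc)" for k
    by (simp add: shift_def image_image add.commute)
  thus ?thesis unfolding image_patch[OF that]
    using open_translation[OF open_image_disc[OF that]] by (intro open_UN) simp
qed

text \<open>An open subset of the closed half cylinder cannot contain wall points: a small step to
  the left would leave the half cylinder.\<close>

lemma image_patch_subset_S_plus: "\<Phi> t ` patch \<subseteq> S_plus" if "0 \<le> t"
proof
  fix y assume y: "y \<in> \<Phi> t ` patch"
  have "open (\<Phi> t ` patch)" by (rule open_image_patch[OF that])
  from openE[OF this y] obtain e where e: "e > 0" "ball y e \<subseteq> \<Phi> t ` patch" by blast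
  have "y - (e / 2, 0) \<in> ball y e" using e(1) by (simp add: dist_norm)
  hence "y - (e / 2, 0) \<in> \<Phi> t ` patch" by (rule subsetD[OF e(2)])
  then obtain x where x: "x \<in> patch" "y - (e / 2, 0) = \<Phi> t x" by (rule imageE)
  have "y - (e / 2, 0) \<in> S_plus_closed"
    unfolding x(2) by (rule \<Phi>_in[OF that subsetD[OF patch_subset_S_plus_closed x(1)]])
  thus "y \<in> S_plus" using e(1) by (simp add: S_plus_closed_def S_plus_def)
qed

lemma image_disc_shift_unique:
  assumes "0 \<le> t" "x \<in> \<Phi> t ` cball centre radius" "shift k x \<in> \<Phi> t ` cball centre radius"
  shows "k = 0"
proof -
  obtain p q where pq: "p \<in> cball centre radius" "x = \<Phi> t p" "q \<in> cball centre radius" "shift k x = \<Phi> t q"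
    using assms by blast
  have pS: "p \<in> S_plus_closed" "q \<in> S_plus_closed" using pq cball_subset_S_plus_closed by blast+
  have "\<Phi> t (shift k p) = \<Phi> t q"
    using \<Phi>_shift[OF assms(1) pS(1), of k] pq(2,4) by simp
  hence "shift k p = q"
    by (rule inj_onD[OF \<Phi>_inj[OF assms(1)]]) (simp_all add: shift_in_S_plus_closed pS)
  thus ?thesis using cball_shift_unique[OF pq(1), of k] pq(3) by simp
qed

text \<open>Conservation of area carries the integral to the image of \<open>disc\<close>, which may
  stretch over many periods. That image and \<open>E t\<close> are both fundamental domains of the
  moved patch, so periodic integrands have equal integrals over them.\<close>

lemma nn_integral_disc_flow:
  fixes f :: "real \<times> real \<Rightarrow> ennreal"
  assumes t: "0 \<le> t" and f [measurable]: "f \<in> borel_measurable borel"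
    and per: "\<And>x k. f (shift k x) = f x"
  shows "(\<integral>\<^sup>+x\<in>disc. f (\<Phi> t x) \<partial>lborel) = (\<integral>\<^sup>+x\<in>E t. f x \<partial>lborel)"
proof -
  define H where "H = (restrict_space lborel S_plus_closed :: (real \<times> real) measure)"
  have Sm: "S_plus_closed \<in> sets lborel" using S_plus_closed_closed by (simp add: borel_closed)
  have ap: "\<Phi> t \<in> measurable H H" "distr H H (\<Phi> t) = H"
    using flow t unfolding euler_patch_flow_def area_preserving_def Let_def H_def by blast+
  have Dm: "\<Phi> t ` disc \<in> sets borel" using open_image_disc[OF t] by simp
  have DS: "\<Phi> t ` disc \<subseteq> S_plus_closed" using \<Phi>_in[OF t] disc_subset_S_plus_closed by blast
  have restr: "integral\<^sup>N H g = (\<integral>\<^sup>+x\<in>S_plus_closed. g x \<partial>lborel)" for g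
    unfolding H_def using Sm by (subst nn_integral_restrict_space) auto
  have gm: "(\<lambda>x. f x * indicator (\<Phi> t ` disc) x) \<in> borel_measurable H"
    unfolding H_def
    by (intro measurable_restrict_space1 borel_measurable_times_ennreal borel_measurable_indicator) (use f Dm in simp_all)
  have "(\<integral>\<^sup>+x\<in>disc. f (\<Phi> t x) \<partial>lborel) = (\<integral>\<^sup>+x. f (\<Phi> t x) * indicator (\<Phi> t ` disc) (\<Phi> t x) \<partial>H)"
    unfolding restr
  proof (rule nn_integral_cong)
    fix x
    have "\<Phi> t x \<in> \<Phi> t ` disc \<longleftrightarrow> x \<in> disc" if "x \<in> S_plus_closed"
      using inj_on_image_mem_iff[OF \<Phi>_inj[OF t] that disc_subset_S_plus_closed] .
    thus "f (\<Phi> t x) * indicator disc x = f (\<Phi> t x) * indicator (\<Phi> t ` disc) (\<Phi> t x) * indicator S_plus_closed x"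
      using disc_subset_S_plus_closed by (auto simp: indicator_def)
  qed
  also have "\<dots> = (\<integral>\<^sup>+x. f x * indicator (\<Phi> t ` disc) x \<partial>distr H H (\<Phi> t))"
    by (rule nn_integral_distr[OF ap(1), symmetric]) (use gm in simp)
  also have "\<dots> = (\<integral>\<^sup>+x. f x * indicator (\<Phi> t ` disc) x \<partial>H)" by (simp add: ap(2))
  also have "\<dots> = (\<integral>\<^sup>+x\<in>\<Phi> t ` disc. f x \<partial>lborel)"
    unfolding restr using DS by (intro nn_integral_cong) (auto simp: indicator_def)
  also have "\<dots> = (\<integral>\<^sup>+x\<in>E t. f x \<partial>lborel)"
  proof (rule nn_integral_fundamental_domain[where v = "(0, 2 * pi)"])
    note shift_eq = shift_def[symmetric]
    show "f \<in> borel_measurable borel" "\<Phi> t ` disc \<in> sets borel" "E t \<in> sets borel"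
      using f Dm E_sets[OF t] by auto
    fix x and k :: int
    show "f (x + of_int k *\<^sub>R (0, 2 * pi)) = f x" unfolding shift_eq by (rule per)
    show "k = 0" if "x \<in> \<Phi> t ` disc" "x + of_int k *\<^sub>R (0, 2 * pi) \<in> \<Phi> t ` disc"
      using that disc_subset_cball unfolding shift_eq by (intro image_disc_shift_unique[OF t, of x]) auto
    show "k = 0" if "x \<in> E t" "x + of_int k *\<^sub>R (0, 2 * pi) \<in> E t"
    proof -
      have "x \<in> one_period" "shift k x \<in> one_period" using that E_subset unfolding shift_eq by blast+
      thus ?thesis by (intro shift_in_period_unique) (auto simp: one_period_def snd_shift)
    qed
    show "\<exists>k::int. x + of_int k *\<^sub>R (0, 2 * pi) \<in> E t" if "x \<in> \<Phi> t ` disc"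
    proof -
      obtain k where k: "-pi \<le> snd (shift k x) \<and> snd (shift k x) < pi" using exists_shift_period by blast
      have "shift k x \<in> \<Phi> t ` patch" unfolding image_patch[OF t] using that by blast
      hence "shift k x \<in> E t" using k image_patch_subset_S_plus[OF t] by (auto simp: E_def one_period_def)
      thus ?thesis unfolding shift_eq by blast
    qed
    show "\<exists>k::int. x + of_int k *\<^sub>R (0, 2 * pi) \<in> \<Phi> t ` disc" if "x \<in> E t"
    proof -
      have "x \<in> (\<Union>k. shift k ` (\<Phi> t ` disc))" using that unfolding E_def image_patch[OF t] by blast
      then obtain k y where "x = shift k y" "y \<in> \<Phi> t ` disc" by blast
      hence "shift (-k) x \<in> \<Phi> t ` disc" by simp
      thus ?thesis unfolding shift_eq by blast
    qed
  qed
  finally show ?thesis .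
qed

section \<open>Area, velocity bounds and mean motion at every time\<close>

definition a :: real where "a = pi * radius\<^sup>2"

text \<open>Replaces the almost-everywhere bound on the mass by the exact area at each time, which
  makes all bounds of \<open>vorticity_set\<close> available without exceptional times.\<close>

lemma emeasure_E: "emeasure lborel (E t) = ennreal a" if "0 \<le> t"
proof -
  have "(\<integral>\<^sup>+x\<in>disc. 1 \<partial>lborel) = (\<integral>\<^sup>+x\<in>E t. 1 \<partial>lborel)"
    using nn_integral_disc_flow[OF that, of "\<lambda>_. 1"] by simp
  moreover have "disc \<in> sets lborel" by (simp add: disc_def)
  ultimately show ?thesis using E_sets[OF that] by (simp add: emeasure_disc a_def)
qed

lemma vorticity_set_E_a: "vorticity_set (E t) a" if "0 \<le> t"
  using emeasure_E[OF that] radius_pos by (intro vorticity_set_E[OF that]) (auto simp: a_def)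

definition B :: real where "B = 14 * a + 64 * pi"

lemma
  assumes "0 \<le> t"
  shows norm_u_le: "norm (u t x) \<le> B"
    and snd_u_wall: "snd (u t (0, d)) \<ge> radius\<^sup>2 / 2 - 2 * ln 2"
    and u_measurable: "u t \<in> borel_measurable borel"
    and u_shift: "u t (shift k x) = u t x"
    and u_mean: "(LINT x:E t|lborel. snd (u t x)) \<le> a * (radius\<^sup>2 / 4 + 1/2 - ln (1 - exp (-1)))"
proof -
  interpret V: vorticity_set "E t" a by (rule vorticity_set_E_a[OF assms])
  have u: "u t = V.vel" by (rule vel_E[OF V.vorticity_set_axioms, symmetric])
  show "norm (u t x) \<le> B" unfolding u using V.norm_vel_le by (simp add: V.C_def B_def)
  show "snd (u t (0, d)) \<ge> radius\<^sup>2 / 2 - 2 * ln 2"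
    unfolding u using V.snd_vel_wall_ge[of d] by (simp add: a_def)
  show "u t \<in> borel_measurable borel" unfolding u by (rule V.borel_measurable_vel)
  have "shift k x = (fst x, snd x + of_int k * (2 * pi))" by (simp add: prod_eq_iff snd_shift)
  thus "u t (shift k x) = u t x" unfolding u using V.vel_shift by simp
  have eq: "a / (4 * pi) = radius\<^sup>2 / 4" by (simp add: a_def)
  show "(LINT x:E t|lborel. snd (u t x)) \<le> a * (radius\<^sup>2 / 4 + 1/2 - ln (1 - exp (-1)))"
    unfolding u using V.integral_snd_vel_le by (simp only: eq)
qed

lemma \<Phi>_snd_lipschitz:
  assumes "0 \<le> s" "0 \<le> t" "x \<in> S_plus_closed"
  shows "\<bar>snd (\<Phi> t x) - snd (\<Phi> s x)\<bar> \<le> B * \<bar>t - s\<bar>"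
proof -
  have der: "((\<lambda>t. snd (\<Phi> t x)) has_vector_derivative snd (u t (\<Phi> t x))) (at t within {0..})" if "0 \<le> t" for t
    using bounded_linear.has_vector_derivative[OF bounded_linear_snd \<Phi>_derivative[OF that assms(3)]] .
  have bd: "\<bar>snd (u t y)\<bar> \<le> B" if "0 \<le> t" for t y
    using norm_u_le[OF that, of y] norm_snd_le[of "snd (u t y)" "fst (u t y)"] by simp
  have "0 \<le> B" using norm_u_le[of 0 0] norm_ge_zero order_trans by blast
  hence "\<bar>snd (\<Phi> (max s t) x) - snd (\<Phi> (min s t) x)\<bar> \<le> B * (max s t - min s t)"
    using assms bd by (intro abs_increment_le_AE_derivative_bound[OF der]) auto
  thus ?thesis by (auto simp: max_def min_def abs_if split: if_splits)
qed

text \<open>Differentiation under the integral along sequences of times: the velocity bound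
  \<open>B\<close> dominates all difference quotients.\<close>

lemma mean_flow_derivative:
  assumes t: "0 \<le> t"
  shows "((\<lambda>s. \<integral>x. indicator disc x * snd (\<Phi> s x) \<partial>lborel) has_vector_derivative
      (\<integral>x. indicator disc x * snd (u t (\<Phi> t x)) \<partial>lborel)) (at t within {0..})"
proof -
  have disc_m [measurable]: "disc \<in> sets borel" by (simp add: disc_def)
  have B0: "0 \<le> B" using norm_u_le[of 0 0] norm_ge_zero order_trans by blast
  have bounded_disc: "\<bar>snd x\<bar> \<le> radius" if "x \<in> disc" for x
    using that cball_snd_le disc_subset_cball by blast
  have \<Phi>_m: "(\<lambda>x. indicator disc x * snd (\<Phi> s x)) \<in> borel_measurable borel" if "0 \<le> s" for s
  proof -
    have "continuous_on disc (\<lambda>x. snd (\<Phi> s x))"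
      by (intro continuous_on_snd continuous_on_subset[OF \<Phi>_continuous[OF that] disc_subset_S_plus_closed])
    thus ?thesis using borel_measurable_continuous_on_indicator[OF disc_m, of "\<lambda>x. snd (\<Phi> s x)"] by simp
  qed
  have one_int: "integrable lborel (\<lambda>x. indicator disc x * c :: real)" for c
    using emeasure_disc by (intro integrable_mult_left) (simp add: integrable_indicator_iff)
  have \<Phi>_int: "integrable lborel (\<lambda>x. indicator disc x * snd (\<Phi> s x))" if "0 \<le> s" for s
  proof (rule Bochner_Integration.integrable_bound[OF one_int[of "radius + B * s"]])
    show "(\<lambda>x. indicator disc x * snd (\<Phi> s x)) \<in> borel_measurable lborel" using \<Phi>_m[OF that] by simp
    show "AE x in lborel. norm (indicator disc x * snd (\<Phi> s x)) \<le> norm (indicator disc x * (radius + B * s))"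
    proof (intro AE_I2)
      fix x
      have "\<bar>snd (\<Phi> s x)\<bar> \<le> radius + B * s" if x: "x \<in> disc"
        using \<Phi>_snd_lipschitz[of 0 s x] bounded_disc[OF x] \<open>0 \<le> s\<close> x disc_subset_S_plus_closed \<Phi>_0[of x] by auto
      thus "norm (indicator disc x * snd (\<Phi> s x)) \<le> norm (indicator disc x * (radius + B * s))"
        by (auto simp: indicator_def)
    qed
  qed
  define A where "A s = (\<integral>x. indicator disc x * snd (\<Phi> s x) \<partial>lborel)" for s
  have "((\<lambda>s. (A s - A t) / (s - t)) \<longlongrightarrow> (\<integral>x. indicator disc x * snd (u t (\<Phi> t x)) \<partial>lborel)) (at t within {0..})"
    unfolding tendsto_at_iff_sequentially
  proof (intro allI impI)
    fix X :: "nat \<Rightarrow> real"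
    assume X: "\<forall>i. X i \<in> {0..} - {t}" "X \<longlonglongrightarrow> t"
    have X0: "0 \<le> X i" "X i \<noteq> t" for i using X(1) by auto
    define D where "D i x = indicator disc x * ((snd (\<Phi> (X i) x) - snd (\<Phi> t x)) / (X i - t))" for i x
    have D_eq: "D i x = (indicator disc x * snd (\<Phi> (X i) x) - indicator disc x * snd (\<Phi> t x)) / (X i - t)" for i x
      by (simp add: D_def right_diff_distrib)
    have D_m: "D i \<in> borel_measurable lborel" for i
      unfolding D_eq[abs_def] using \<Phi>_m[OF X0(1)] \<Phi>_m[OF t] by measurable
    have lim: "(\<lambda>i. D i x) \<longlonglongrightarrow> indicator disc x * snd (u t (\<Phi> t x))" for x
    proof (cases "x \<in> disc")
      case True
      hence x: "x \<in> S_plus_closed" using disc_subset_S_plus_closed by blast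
      have "((\<lambda>s. snd (\<Phi> s x)) has_vector_derivative snd (u t (\<Phi> t x))) (at t within {0..})"
        using bounded_linear.has_vector_derivative[OF bounded_linear_snd \<Phi>_derivative[OF t x]] .
      hence "((\<lambda>s. (snd (\<Phi> s x) - snd (\<Phi> t x)) / (s - t)) \<longlongrightarrow> snd (u t (\<Phi> t x))) (at t within {0..})"
        by (simp add: has_real_derivative_iff_has_vector_derivative[symmetric] has_field_derivative_iff)
      hence "(\<lambda>i. (snd (\<Phi> (X i) x) - snd (\<Phi> t x)) / (X i - t)) \<longlonglongrightarrow> snd (u t (\<Phi> t x))"
        using X unfolding tendsto_at_iff_sequentially o_def by blast
      thus ?thesis using True by (simp add: D_def)
    qed (simp add: D_def)
    have "(\<lambda>i. \<integral>x. D i x \<partial>lborel) \<longlonglongrightarrow> (\<integral>x. indicator disc x * snd (u t (\<Phi> t x)) \<partial>lborel)"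
    proof (rule integral_dominated_convergence[where w = "\<lambda>x. indicator disc x * B"])
      show "(\<lambda>x. indicator disc x * snd (u t (\<Phi> t x))) \<in> borel_measurable lborel"
        by (rule borel_measurable_LIMSEQ_real[OF lim]) (rule D_m)
      show "AE x in lborel. norm (D i x) \<le> indicator disc x * B" for i
      proof (intro AE_I2)
        fix x
        have "\<bar>(snd (\<Phi> (X i) x) - snd (\<Phi> t x)) / (X i - t)\<bar> \<le> B" if "x \<in> disc"
        proof -
          have "\<bar>snd (\<Phi> (X i) x) - snd (\<Phi> t x)\<bar> \<le> B * \<bar>X i - t\<bar>"
            using that disc_subset_S_plus_closed by (intro \<Phi>_snd_lipschitz t X0) auto
          thus ?thesis using X0(2)[of i] by (simp add: abs_divide pos_divide_le_eq)
        qed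
        thus "norm (D i x) \<le> indicator disc x * B" using B0 by (auto simp: D_def indicator_def)
      qed
    qed (use one_int D_m lim in auto)
    moreover have "(\<integral>x. D i x \<partial>lborel) = (A (X i) - A t) / (X i - t)" for i
      unfolding D_eq A_def using \<Phi>_int[OF X0(1)] \<Phi>_int[OF t] by simp
    ultimately show "((\<lambda>s. (A s - A t) / (s - t)) \<circ> X) \<longlonglongrightarrow> (\<integral>x. indicator disc x * snd (u t (\<Phi> t x)) \<partial>lborel)"
      by (simp add: o_def)
  qed
  thus ?thesis unfolding A_def[symmetric]
    by (simp add: has_real_derivative_iff_has_vector_derivative[symmetric] has_field_derivative_iff)
qed

definition mean_speed :: real where
  "mean_speed = radius\<^sup>2 / 4 + 1/2 - ln (1 - exp (-1))"

lemma mean_velocity_disc_le: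
  assumes t: "0 \<le> t"
  shows "(\<integral>x. indicator disc x * snd (u t (\<Phi> t x)) \<partial>lborel) \<le> a * mean_speed"
proof -
  \<comment> \<open>The shift by \<open>B\<close> makes the integrand nonnegative, as the change of
    variables requires. It is undone at no cost because \<open>disc\<close> and \<open>E t\<close>
    have the same area.\<close>
  define g where "g x = snd (u t x) + B" for x
  have g0: "0 \<le> g x" and gB: "g x \<le> 2 * B" for x
    using norm_u_le[OF t, of x] norm_snd_le[of "snd (u t x)" "fst (u t x)"] by (auto simp: g_def)
  have gabs: "\<bar>g y\<bar> \<le> \<bar>2 * B\<bar>" for y using g0[of y] gB[of y] by simp
  have disc_m [measurable]: "disc \<in> sets borel" by (simp add: disc_def)
  have E_m [measurable]: "E t \<in> sets borel" by (rule E_sets[OF t])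
  have snd_m: "(snd :: real \<times> real \<Rightarrow> real) \<in> borel_measurable borel"
    by (intro borel_measurable_continuous_onI continuous_intros)
  have g_m [measurable]: "g \<in> borel_measurable borel"
    unfolding g_def using measurable_compose[OF u_measurable[OF t] snd_m] by measurable
  have ug_m: "(\<lambda>x. indicator disc x * g (\<Phi> t x)) \<in> borel_measurable lborel"
  proof -
    have "(\<lambda>x. indicator disc x *\<^sub>R \<Phi> t x) \<in> borel_measurable borel"
      by (intro borel_measurable_continuous_on_indicator disc_m
            continuous_on_subset[OF \<Phi>_continuous[OF t] disc_subset_S_plus_closed])
    from measurable_compose[OF this g_m]
    have "(\<lambda>x. indicator disc x * g (indicator disc x *\<^sub>R \<Phi> t x)) \<in> borel_measurable borel" by measurable
    also have "(\<lambda>x. indicator disc x * g (indicator disc x *\<^sub>R \<Phi> t x)) = (\<lambda>x. indicator disc x * g (\<Phi> t x))"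
      by (auto simp: fun_eq_iff indicator_def)
    finally show ?thesis by simp
  qed
  have disc_int: "integrable lborel (\<lambda>x. indicator disc x * c :: real)" for c
    using emeasure_disc by (intro integrable_mult_left) (simp add: integrable_indicator_iff)
  have E_int: "integrable lborel (\<lambda>x. indicator (E t) x * c :: real)" for c
    using emeasure_E[OF t] E_m by (intro integrable_mult_left) (simp add: integrable_indicator_iff)
  have int1: "integrable lborel (\<lambda>x. indicator disc x * g (\<Phi> t x))"
    by (rule Bochner_Integration.integrable_bound[OF disc_int[of "2 * B"] ug_m])
       (auto intro!: AE_I2 simp: indicator_def gabs)
  have int2: "integrable lborel (\<lambda>x. indicator (E t) x * g x)"
    by (rule Bochner_Integration.integrable_bound[OF E_int[of "2 * B"]])
       (auto intro!: AE_I2 simp: indicator_def gabs)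
  have "ennreal (\<integral>x. indicator disc x * g (\<Phi> t x) \<partial>lborel) = (\<integral>\<^sup>+x\<in>disc. ennreal (g (\<Phi> t x)) \<partial>lborel)"
    using int1 g0 by (subst nn_integral_eq_integral[symmetric]) (auto intro!: nn_integral_cong simp: indicator_def)
  also have "\<dots> = (\<integral>\<^sup>+x\<in>E t. ennreal (g x) \<partial>lborel)"
    by (rule nn_integral_disc_flow[OF t]) (measurable, simp add: g_def u_shift[OF t])
  also have "\<dots> = ennreal (\<integral>x. indicator (E t) x * g x \<partial>lborel)"
    using int2 g0 by (subst nn_integral_eq_integral[symmetric]) (auto intro!: nn_integral_cong simp: indicator_def)
  finally have eq: "(\<integral>x. indicator disc x * g (\<Phi> t x) \<partial>lborel) = (\<integral>x. indicator (E t) x * g x \<partial>lborel)"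
    using g0 by (subst (asm) ennreal_inj) (auto intro!: Bochner_Integration.integral_nonneg)
  have a0: "a \<ge> 0" by (simp add: a_def)
  have disc_c: "(\<integral>x. indicator disc x * B \<partial>lborel) = a * B"
    using emeasure_disc a0 by (simp add: measure_def a_def)
  have E_c: "(\<integral>x. indicator (E t) x * B \<partial>lborel) = a * B"
    using emeasure_E[OF t] a0 E_m by (simp add: measure_def)
  have "(\<integral>x. indicator disc x * snd (u t (\<Phi> t x)) \<partial>lborel)
      = (\<integral>x. indicator disc x * g (\<Phi> t x) - indicator disc x * B \<partial>lborel)"
    by (intro Bochner_Integration.integral_cong) (auto simp: g_def algebra_simps)
  also have "\<dots> = (\<integral>x. indicator disc x * g (\<Phi> t x) \<partial>lborel) - a * B"
    unfolding disc_c[symmetric] by (rule Bochner_Integration.integral_diff[OF int1 disc_int])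
  also have "\<dots> = (\<integral>x. indicator (E t) x * g x - indicator (E t) x * B \<partial>lborel)"
    unfolding eq E_c[symmetric] by (rule Bochner_Integration.integral_diff[OF int2 E_int, symmetric])
  also have "\<dots> = (LINT x:E t|lborel. snd (u t x))"
    unfolding set_lebesgue_integral_def
    by (intro Bochner_Integration.integral_cong) (auto simp: g_def algebra_simps)
  also have "\<dots> \<le> a * mean_speed" using u_mean[OF t] by (simp only: mean_speed_def)
  finally show ?thesis .
qed

text \<open>The mean height starts at 0 and has speed at most \<open>mean_speed\<close>. Were every
  particle strictly above \<open>mean_speed * t\<close>, a nonnegative function that is positive
  throughout the disc would have integral 0.\<close>

lemma exists_slow_particle:
  assumes t: "0 \<le> t"
  shows "\<exists>q\<in>disc. snd (\<Phi> t q) \<le> mean_speed * t"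
proof (rule ccontr)
  assume "\<not> ?thesis"
  hence fast: "mean_speed * t < snd (\<Phi> t q)" if "q \<in> disc" for q using that by force
  define A where "A s = (\<integral>x. indicator disc x * snd (\<Phi> s x) \<partial>lborel)" for s
  have disc_m: "disc \<in> sets borel" by (simp add: disc_def)
  have one_int: "integrable lborel (\<lambda>x. indicator disc x * c :: real)" for c
    using emeasure_disc disc_m by (intro integrable_mult_left) (simp add: integrable_indicator_iff)
  have "- (a * mean_speed) * t \<le> (- A t) - (- A 0)"
  proof (rule increment_ge_derivative_bound[OF _ _ t])
    show "((\<lambda>s. - A s) has_vector_derivative - (\<integral>x. indicator disc x * snd (u s (\<Phi> s x)) \<partial>lborel)) (at s within {0..})"
      if "0 \<le> s" for s
      unfolding A_def by (intro has_vector_derivative_minus mean_flow_derivative that)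
    show "- (a * mean_speed) \<le> - (\<integral>x. indicator disc x * snd (u s (\<Phi> s x)) \<partial>lborel)" if "0 \<le> s" for s
      using mean_velocity_disc_le[OF that] by simp
  qed
  moreover have "A 0 = 0"
  proof -
    have "A 0 = (\<integral>x. indicator disc x * snd x \<partial>lborel)" unfolding A_def
      using \<Phi>_0 disc_subset_S_plus_closed
      by (intro Bochner_Integration.integral_cong) (auto simp: indicator_def)
    thus ?thesis by (simp add: integral_disc_snd)
  qed
  ultimately have A_le: "A t \<le> a * (mean_speed * t)" by simp
  define h where "h x = indicator disc x * snd (\<Phi> t x) - indicator disc x * (mean_speed * t)" for x
  have h0: "0 \<le> h x" for x using fast[of x] by (auto simp: h_def indicator_def)
  have \<Phi>_int: "integrable lborel (\<lambda>x. indicator disc x * snd (\<Phi> t x))"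
  proof (rule Bochner_Integration.integrable_bound[OF one_int[of "radius + B * t"]])
    have "continuous_on disc (\<lambda>x. snd (\<Phi> t x))"
      by (intro continuous_on_snd continuous_on_subset[OF \<Phi>_continuous[OF t] disc_subset_S_plus_closed])
    thus "(\<lambda>x. indicator disc x * snd (\<Phi> t x)) \<in> borel_measurable lborel"
      using borel_measurable_continuous_on_indicator[OF disc_m, of "\<lambda>x. snd (\<Phi> t x)"] by simp
    show "AE x in lborel. norm (indicator disc x * snd (\<Phi> t x)) \<le> norm (indicator disc x * (radius + B * t))"
    proof (intro AE_I2)
      fix x
      have "\<bar>snd (\<Phi> t x)\<bar> \<le> radius + B * t" if x: "x \<in> disc"
      proof -
        have "\<bar>snd x\<bar> \<le> radius" using x cball_snd_le disc_subset_cball by blast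
        thus ?thesis
          using \<Phi>_snd_lipschitz[of 0 t x] t x disc_subset_S_plus_closed \<Phi>_0[of x] by auto
      qed
      thus "norm (indicator disc x * snd (\<Phi> t x)) \<le> norm (indicator disc x * (radius + B * t))"
        by (auto simp: indicator_def)
    qed
  qed
  have h_int: "integrable lborel h" unfolding h_def by (intro Bochner_Integration.integrable_diff \<Phi>_int one_int)
  have "(\<integral>x. indicator disc x * (mean_speed * t) \<partial>lborel) = a * (mean_speed * t)"
    using emeasure_disc by (simp add: measure_def a_def)
  hence "(\<integral>x. h x \<partial>lborel) = A t - a * (mean_speed * t)"
    unfolding h_def A_def by (subst Bochner_Integration.integral_diff[OF \<Phi>_int one_int]) simp
  hence "(\<integral>x. h x \<partial>lborel) = 0" using A_le Bochner_Integration.integral_nonneg[of lborel h] h0 by simp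
  hence "AE x in lborel. h x = 0" using integral_nonneg_eq_0_iff_AE[OF h_int] h0 by simp
  hence "AE x in lborel. x \<notin> disc"
  proof eventually_elim
    case (elim x)
    thus ?case using fast[of x] by (auto simp: h_def)
  qed
  hence "emeasure lborel disc = 0" using AE_iff_measurable[of disc lborel "\<lambda>x. x \<notin> disc"] disc_m by simp
  thus False using radius_pos by (simp add: emeasure_disc)
qed

lemma origin_speed:
  assumes "0 \<le> t"
  shows "(radius\<^sup>2 / 2 - 2 * ln 2) * t \<le> snd (\<Phi> t (0, 0))"
proof -
  have o: "(0, 0) \<in> S_plus_closed" by (simp add: S_plus_closed_def)
  have "(radius\<^sup>2 / 2 - 2 * ln 2) * t \<le> snd (\<Phi> t (0, 0)) - snd (\<Phi> 0 (0, 0))"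
  proof (rule increment_ge_derivative_bound[OF _ _ assms])
    show "((\<lambda>s. snd (\<Phi> s (0, 0))) has_vector_derivative snd (u s (\<Phi> s (0, 0)))) (at s within {0..})" if "0 \<le> s" for s
      using bounded_linear.has_vector_derivative[OF bounded_linear_snd \<Phi>_derivative[OF that o]] .
    show "radius\<^sup>2 / 2 - 2 * ln 2 \<le> snd (u s (\<Phi> s (0, 0)))" if "0 \<le> s" for s
      using snd_u_wall[OF that, of "snd (\<Phi> s (0, 0))"] \<Phi>_wall[OF that, of 0]
      by (metis prod.collapse)
  qed
  thus ?thesis using \<Phi>_0[OF o] by simp
qed

lemma frontier_image_patch:
  assumes t: "0 \<le> t" and x: "x \<in> sphere centre radius"
  shows "shift k (\<Phi> t x) \<in> frontier (\<Phi> t ` patch)"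
proof -
  have xS: "x \<in> S_plus_closed" using x cball_subset_S_plus_closed by auto
  have "shift (-k) (shift k x) \<in> sphere centre radius" using x by simp
  hence kx: "shift k x \<in> frontier patch" unfolding frontier_patch by blast
  have cl: "closure patch \<subseteq> S_plus_closed"
    by (rule closure_minimal[OF patch_subset_S_plus_closed S_plus_closed_closed])
  have "\<Phi> t ` closure patch \<subseteq> closure (\<Phi> t ` patch)"
    by (rule image_closure_subset[OF continuous_on_subset[OF \<Phi>_continuous[OF t] cl] closed_closure closure_subset])
  moreover have "shift k x \<in> closure patch" "shift k x \<notin> patch"
    using kx open_patch by (auto simp: frontier_def interior_open)
  moreover have "\<Phi> t (shift k x) \<notin> \<Phi> t ` patch"
    using inj_on_image_mem_iff[OF \<Phi>_inj[OF t] _ patch_subset_S_plus_closed, of "shift k x"] xS calculation(3)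
    by (simp add: shift_in_S_plus_closed)
  ultimately have "\<Phi> t (shift k x) \<in> frontier (\<Phi> t ` patch)"
    using open_image_patch[OF t] by (auto simp: frontier_def interior_open)
  thus ?thesis by (simp add: \<Phi>_shift[OF t xS])
qed

text \<open>The slow particle lies inside the disc, so its height has to be transferred to the
  circle. On each level the rightmost point of the compact image is attained, and it cannot come
  from the open disc, whose image is open and would extend farther right.\<close>

lemma snd_image_sphere:
  assumes t: "0 \<le> t"
  shows "snd ` (\<Phi> t ` cball centre radius) \<subseteq> snd ` (\<Phi> t ` sphere centre radius)"
proof
  fix y assume "y \<in> snd ` (\<Phi> t ` cball centre radius)"
  define Q where "Q = \<Phi> t ` cball centre radius"
  define S where "S = Q \<inter> {z. snd z = y}"
  have "compact Q" unfolding Q_def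
    by (intro compact_continuous_image continuous_on_subset[OF \<Phi>_continuous[OF t] cball_subset_S_plus_closed]) simp
  hence cpt: "compact S" unfolding S_def by (intro compact_Int_closed closed_Collect_eq continuous_intros)
  have ne: "S \<noteq> {}" using \<open>y \<in> _\<close> by (auto simp: S_def Q_def)
  have "continuous_on S fst" by (intro continuous_intros)
  from continuous_attains_sup[OF cpt ne this] obtain z where z: "z \<in> S" "\<And>w. w \<in> S \<Longrightarrow> fst w \<le> fst z"
    by blast
  obtain x where x: "x \<in> cball centre radius" "z = \<Phi> t x" using z(1) by (auto simp: S_def Q_def)
  have "x \<notin> disc"
  proof
    assume "x \<in> disc"
    hence "z \<in> \<Phi> t ` disc" using x by blast
    from openE[OF open_image_disc[OF t] this] obtain e where e: "e > 0" "ball z e \<subseteq> \<Phi> t ` disc" by blast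
    have "z + (e / 2, 0) \<in> ball z e" using e(1) by (simp add: dist_norm)
    hence "z + (e / 2, 0) \<in> \<Phi> t ` disc" by (rule subsetD[OF e(2)])
    hence "z + (e / 2, 0) \<in> Q" unfolding Q_def by (rule subsetD[OF image_mono[OF disc_subset_cball]])
    hence "z + (e / 2, 0) \<in> S" using z(1) by (simp add: S_def)
    from z(2)[OF this] e(1) show False by simp
  qed
  hence "x \<in> sphere centre radius" using x(1) by (auto simp: disc_def)
  moreover have "snd (\<Phi> t x) = y" using z(1) x(2) by (simp add: S_def)
  ultimately show "y \<in> snd ` (\<Phi> t ` sphere centre radius)" by blast
qed

lemma cyl_length_growth:
  assumes t: "0 \<le> t"
  shows "ennreal (speed_gap * t) \<le> cyl_length (frontier (\<Phi> t ` patch))"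
proof -
  obtain q where q: "q \<in> disc" "snd (\<Phi> t q) \<le> mean_speed * t" using exists_slow_particle[OF t] by blast
  define \<alpha> \<beta> where "\<alpha> = snd (\<Phi> t q)" and "\<beta> = snd (\<Phi> t (0, 0))"
  have cont: "continuous_on (cball centre radius) (\<Phi> t)"
    by (rule continuous_on_subset[OF \<Phi>_continuous[OF t] cball_subset_S_plus_closed])
  have "connected (snd ` (\<Phi> t ` cball centre radius))"
    by (intro connected_continuous_image cont continuous_intros) simp
  moreover have "\<alpha> \<in> snd ` (\<Phi> t ` cball centre radius)" "\<beta> \<in> snd ` (\<Phi> t ` cball centre radius)"
    unfolding \<alpha>_def \<beta>_def using q disc_subset_cball origin_in_sphere sphere_cball by blast+
  ultimately have "{\<alpha>..\<beta>} \<subseteq> snd ` (\<Phi> t ` cball centre radius)" by (rule connected_contains_Icc)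
  hence proj: "{\<alpha>..\<beta>} \<subseteq> snd ` (\<Phi> t ` sphere centre radius)" using snd_image_sphere[OF t] by blast
  have gap: "speed_gap = (radius\<^sup>2 / 2 - 2 * ln 2) - mean_speed" by (simp only: speed_gap_def mean_speed_def)
  have "speed_gap * t = (radius\<^sup>2 / 2 - 2 * ln 2) * t - mean_speed * t"
    unfolding gap by (rule left_diff_distrib)
  also have "\<dots> \<le> \<beta> - \<alpha>" using origin_speed[OF t] q(2) by (simp add: \<alpha>_def \<beta>_def)
  finally have "ennreal (speed_gap * t) \<le> ennreal (\<beta> - \<alpha>)" by (rule ennreal_leI)
  also have "\<dots> \<le> cyl_length (frontier (\<Phi> t ` patch))"
  proof (rule cyl_length_ge[OF _ _ _ proj])
    show "compact (\<Phi> t ` sphere centre radius)"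
      by (intro compact_continuous_image continuous_on_subset[OF cont]) auto
    fix x and k :: int assume x: "x \<in> \<Phi> t ` sphere centre radius"
    show "x + of_int k *\<^sub>R (0, 2 * pi) \<in> frontier (\<Phi> t ` patch)"
      using x frontier_image_patch[OF t] unfolding shift_def[symmetric] by blast
    show "k = 0" if "x + of_int k *\<^sub>R (0, 2 * pi) \<in> \<Phi> t ` sphere centre radius"
      using that x sphere_cball[of centre radius] unfolding shift_def[symmetric]
      by (intro image_disc_shift_unique[OF t, of x k]) blast+
  qed
  finally show ?thesis .
qed

end

theorem theorem1p3:
  shows "\<exists>C2 :: real. C2 > 0 \<and> (\<exists>\<Omega>0 :: (real \<times> real) set.
     \<Omega>0 \<subseteq> S_plus \<and> periodic_set \<Omega>0 \<and> open \<Omega>0 \<and> cyl_bounded \<Omega>0 \<and>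
     smooth_boundary \<Omega>0 \<and> cyl_connected (frontier \<Omega>0) \<and>
     cyl_length (frontier \<Omega>0) \<le> 20 \<and>
     frontier \<Omega>0 \<inter> S_plus_boundary \<noteq> {} \<and>
     (\<forall>\<Phi>. euler_patch_flow \<Omega>0 \<Phi> \<longrightarrow>
        (\<forall>t\<ge>0. cyl_length (frontier (\<Phi> t ` \<Omega>0)) \<ge> ennreal (C2 * t))))"
proof (intro exI[of _ speed_gap] exI[of _ patch] conjI allI impI)
  fix \<Phi> and t :: real
  assume "euler_patch_flow patch \<Phi>" and t: "0 \<le> t"
  then interpret patch_flow \<Phi> by unfold_locales
  show "ennreal (speed_gap * t) \<le> cyl_length (frontier (\<Phi> t ` patch))" by (rule cyl_length_growth[OF t])
qed (fact speed_gap_pos patch_subset_S_plus periodic_patch open_patch cyl_bounded_patch smooth_boundary_patch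
       cyl_connected_frontier_patch cyl_length_frontier_patch frontier_patch_meets_boundary)+

end
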